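(* Let $D$ be a finite alphabet, $\Gamma$ a nonempty finite set of non-empty words over $D$, $n\ge 1$, and let real numbers $\psi^\alpha_{ij}$ be given for all $\alpha\in\Gamma$ and all $[i,j]\subseteq[1,n]$ with $j-i+1=|\alpha|$. For $x=x_1\ldots x_n\in D^n$ let $$E(x)=\sum_{\alpha\in\Gamma}\ \sum_{\substack{[i,j]\subseteq[1,n]\\ j-i+1=|\alpha|}}\psi^\alpha_{ij}\cdot[x_i\ldots x_j=\alpha],$$ where $[\cdot]$ is the Iverson bracket, and let $p(x)=\frac1Z\exp\{-E(x)\}$ with $Z=\sum_{x\in D^n}\exp\{-E(x)\}$. Let $L=\sum_{\alpha\in\Gamma}|\alpha|$. Then, given an oracle that produces independent samples from the uniform distribution on $[0,1]$ in $O(1)$ time, independent samples $x\in D^n$ from $p$ can be produced (i) in time $O(nL)$ per sample; and alternatively (ii) in time $O(n)$ per sample after a preprocessing taking time $O(nL|D|)$.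
   Context: Time is the number of elementary operations, with each arithmetic operation on or comparison of real numbers (and each evaluation of $\exp$) counted as $O(1)$. Combinatorial structures determined only by the word set $\Gamma$ (prefix/suffix structure of the words) are regarded as constructed in a preprocessing step. $|\alpha|$ denotes the length of a word $\alpha$. *)

theory Defs
  imports "HOL-Probability.Probability"
begin

section \<open>Pattern-based distributions on words\<close>

text \<open>Positions are 1-based, so \<open>subword x i j\<close> is $x_i \ldots x_j$ for
  \<open>1 \<le> i \<le> j \<le> length x\<close>.\<close>

definition subword :: "'a list \<Rightarrow> nat \<Rightarrow> nat \<Rightarrow> 'a list" where
  "subword x i j = map (\<lambda>k. x ! (k - 1)) [i..<j + 1]"

definition words :: "'a set \<Rightarrow> nat \<Rightarrow> 'a list set" where
  "words D n = {x. length x = n \<and> set x \<subseteq> D}"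

definition energy ::
  "'a list set \<Rightarrow> nat \<Rightarrow> ('a list \<Rightarrow> nat \<Rightarrow> nat \<Rightarrow> real) \<Rightarrow> 'a list \<Rightarrow> real" where
  "energy \<Gamma> n \<psi> x =
     (\<Sum>\<alpha>\<in>\<Gamma>. \<Sum>(i, j) \<in> {(i, j). 1 \<le> i \<and> i \<le> j \<and> j \<le> n \<and> j - i + 1 = length \<alpha>}.
        \<psi> \<alpha> i j * of_bool (subword x i j = \<alpha>))"

definition partition_fun ::
  "'a set \<Rightarrow> 'a list set \<Rightarrow> nat \<Rightarrow> ('a list \<Rightarrow> nat \<Rightarrow> nat \<Rightarrow> real) \<Rightarrow> real" where
  "partition_fun D \<Gamma> n \<psi> = (\<Sum>x\<in>words D n. exp (- energy \<Gamma> n \<psi> x))"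

definition gibbs ::
  "'a set \<Rightarrow> 'a list set \<Rightarrow> nat \<Rightarrow> ('a list \<Rightarrow> nat \<Rightarrow> nat \<Rightarrow> real) \<Rightarrow> 'a list \<Rightarrow> real" where
  "gibbs D \<Gamma> n \<psi> x = 1 / partition_fun D \<Gamma> n \<psi> * exp (- energy \<Gamma> n \<psi> x)"

definition total_length :: "'a list set \<Rightarrow> nat" where
  "total_length \<Gamma> = (\<Sum>\<alpha>\<in>\<Gamma>. length \<alpha>)"


section \<open>A randomised real RAM\<close>

text \<open>Programs are while programs over finitely many arrays of natural numbers (indices, letters)
  and finitely many arrays of reals, with indirect addressing.  An array is named by a number
  occurring literally in the program; a scalar variable is cell 0 of an array.  Every operator,
  memory access, assignment, test and random draw costs one unit of time.

  \<open>Floor\<close> turns a real into an array index.  Some such operation is unavoidable: with only binary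
  branching on comparisons, time \<open>O(n)\<close> with a constant not depending on \<open>card D\<close> could not even
  produce \<open>card D ^ n\<close> different outputs.  To exclude extracting digits of huge numbers, its
  result is capped by a bound \<open>B\<close>, which \<open>index_bound\<close> below fixes.\<close>

datatype nexp =
    Num nat
  | NGet nat nexp
  | NAdd nexp nexp
  | NSub nexp nexp
  | NMul nexp nexp
  | Floor rexp
and rexp =
    OfNat nexp
  | RGet nat nexp
  | RAdd rexp rexp
  | RSub rexp rexp
  | RMul rexp rexp
  | RDiv rexp rexp
  | RExp rexp

datatype bexp =
    NLess nexp nexp
  | RLess rexp rexp
  | BNot bexp
  | BAnd bexp bexp

datatype com =
    Skip
  | NSet nat nexp nexp
  | RSet nat nexp rexp
  | Draw nat nexp
  | Seq com com
  | If bexp com com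
  | While bexp com

text \<open>\<open>drawn\<close> counts the oracle values consumed so far.\<close>

record state =
  nmem :: "nat \<Rightarrow> nat \<Rightarrow> nat"
  rmem :: "nat \<Rightarrow> nat \<Rightarrow> real"
  drawn :: nat

primrec nval :: "nat \<Rightarrow> state \<Rightarrow> nexp \<Rightarrow> nat"
  and rval :: "nat \<Rightarrow> state \<Rightarrow> rexp \<Rightarrow> real" where
  "nval B s (Num k) = k"
| "nval B s (NGet a e) = nmem s a (nval B s e)"
| "nval B s (NAdd e f) = nval B s e + nval B s f"
| "nval B s (NSub e f) = nval B s e - nval B s f"
| "nval B s (NMul e f) = nval B s e * nval B s f"
| "nval B s (Floor r) = min B (nat \<lfloor>rval B s r\<rfloor>)"
| "rval B s (OfNat e) = real (nval B s e)"
| "rval B s (RGet a e) = rmem s a (nval B s e)"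
| "rval B s (RAdd q r) = rval B s q + rval B s r"
| "rval B s (RSub q r) = rval B s q - rval B s r"
| "rval B s (RMul q r) = rval B s q * rval B s r"
| "rval B s (RDiv q r) = rval B s q / rval B s r"
| "rval B s (RExp r) = exp (rval B s r)"

primrec bval :: "nat \<Rightarrow> state \<Rightarrow> bexp \<Rightarrow> bool" where
  "bval B s (NLess e f) \<longleftrightarrow> nval B s e < nval B s f"
| "bval B s (RLess q r) \<longleftrightarrow> rval B s q < rval B s r"
| "bval B s (BNot b) \<longleftrightarrow> \<not> bval B s b"
| "bval B s (BAnd b c) \<longleftrightarrow> bval B s b \<and> bval B s c"

primrec ncost :: "nexp \<Rightarrow> nat" and rcost :: "rexp \<Rightarrow> nat" where
  "ncost (Num k) = 1"
| "ncost (NGet a e) = ncost e + 1"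
| "ncost (NAdd e f) = ncost e + ncost f + 1"
| "ncost (NSub e f) = ncost e + ncost f + 1"
| "ncost (NMul e f) = ncost e + ncost f + 1"
| "ncost (Floor r) = rcost r + 1"
| "rcost (OfNat e) = ncost e + 1"
| "rcost (RGet a e) = ncost e + 1"
| "rcost (RAdd q r) = rcost q + rcost r + 1"
| "rcost (RSub q r) = rcost q + rcost r + 1"
| "rcost (RMul q r) = rcost q + rcost r + 1"
| "rcost (RDiv q r) = rcost q + rcost r + 1"
| "rcost (RExp r) = rcost r + 1"

primrec bcost :: "bexp \<Rightarrow> nat" where
  "bcost (NLess e f) = ncost e + ncost f + 1"
| "bcost (RLess q r) = rcost q + rcost r + 1"
| "bcost (BNot b) = bcost b + 1"
| "bcost (BAnd b c) = bcost b + bcost c + 1"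

definition nupd :: "nat \<Rightarrow> nat \<Rightarrow> nat \<Rightarrow> state \<Rightarrow> state" where
  "nupd a k v s = s\<lparr>nmem := (nmem s)(a := (nmem s a)(k := v))\<rparr>"

definition rupd :: "nat \<Rightarrow> nat \<Rightarrow> real \<Rightarrow> state \<Rightarrow> state" where
  "rupd a k v s = s\<lparr>rmem := (rmem s)(a := (rmem s a)(k := v))\<rparr>"

text \<open>\<open>exec B \<omega> c s t s'\<close>: with oracle values \<open>\<omega>\<close>, program \<open>c\<close> started in \<open>s\<close> terminates in
  \<open>s'\<close> after time \<open>t\<close>.\<close>

inductive exec :: "nat \<Rightarrow> (nat \<Rightarrow> real) \<Rightarrow> com \<Rightarrow> state \<Rightarrow> nat \<Rightarrow> state \<Rightarrow> bool"
  for B :: nat and \<omega> :: "nat \<Rightarrow> real" where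
  Skip: "exec B \<omega> Skip s 1 s"
| NSet: "exec B \<omega> (NSet a i e) s (ncost i + ncost e + 1) (nupd a (nval B s i) (nval B s e) s)"
| RSet: "exec B \<omega> (RSet a i r) s (ncost i + rcost r + 1) (rupd a (nval B s i) (rval B s r) s)"
| Draw: "exec B \<omega> (Draw a i) s (ncost i + 1)
           (rupd a (nval B s i) (\<omega> (drawn s)) s\<lparr>drawn := Suc (drawn s)\<rparr>)"
| Seq: "exec B \<omega> c s t s' \<Longrightarrow> exec B \<omega> d s' t' s'' \<Longrightarrow> exec B \<omega> (Seq c d) s (t + t') s''"
| IfT: "bval B s b \<Longrightarrow> exec B \<omega> c s t s' \<Longrightarrow> exec B \<omega> (If b c d) s (bcost b + t + 1) s'"
| IfF: "\<not> bval B s b \<Longrightarrow> exec B \<omega> d s t s' \<Longrightarrow> exec B \<omega> (If b c d) s (bcost b + t + 1) s'"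
| WhileF: "\<not> bval B s b \<Longrightarrow> exec B \<omega> (While b c) s (bcost b + 1) s"
| WhileT: "bval B s b \<Longrightarrow> exec B \<omega> c s t s' \<Longrightarrow> exec B \<omega> (While b c) s' t' s'' \<Longrightarrow>
           exec B \<omega> (While b c) s (bcost b + t + t' + 1) s''"

inductive_cases exec_SkipE: "exec B \<omega> Skip s t s'"
inductive_cases exec_NSetE: "exec B \<omega> (NSet a i e) s t s'"
inductive_cases exec_RSetE: "exec B \<omega> (RSet a i r) s t s'"
inductive_cases exec_DrawE: "exec B \<omega> (Draw a i) s t s'"
inductive_cases exec_SeqE: "exec B \<omega> (Seq c d) s t s'"
inductive_cases exec_IfE: "exec B \<omega> (If b c d) s t s'"
inductive_cases exec_WhileE: "exec B \<omega> (While b c) s t s'"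

text \<open>Execution is deterministic once the oracle values are fixed, so all randomness of a run is
  that of the oracle.\<close>

lemma exec_deterministic:
  "exec B \<omega> c s t s' \<Longrightarrow> exec B \<omega> c s u r' \<Longrightarrow> u = t \<and> r' = s'"
proof (induction arbitrary: u r' rule: exec.induct)
  case Skip then show ?case by (auto elim: exec_SkipE)
next
  case NSet then show ?case by (auto elim: exec_NSetE)
next
  case RSet then show ?case by (auto elim: exec_RSetE)
next
  case Draw then show ?case by (auto elim: exec_DrawE)
next
  case (Seq c s t s' d t' s'')
  from Seq.prems obtain v r v' where "u = v + v'" "exec B \<omega> c s v r" "exec B \<omega> d r v' r'"
    by (rule exec_SeqE)
  with Seq.IH show ?case by metis
next
  case (IfT s b c t s' d)
  from IfT.prems IfT.hyps obtain v where "u = bcost b + v + 1" "exec B \<omega> c s v r'"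
    by (auto elim: exec_IfE)
  with IfT.IH show ?case by metis
next
  case (IfF s b d t s' c)
  from IfF.prems IfF.hyps obtain v where "u = bcost b + v + 1" "exec B \<omega> d s v r'"
    by (auto elim: exec_IfE)
  with IfF.IH show ?case by metis
next
  case (WhileF s b c)
  from WhileF.prems WhileF.hyps show ?case by (auto elim: exec_WhileE)
next
  case (WhileT s b c t s' t' s'')
  from WhileT.prems WhileT.hyps obtain v r v' where
    "u = bcost b + v + v' + 1" "exec B \<omega> c s v r" "exec B \<omega> (While b c) r v' r'"
    by (auto elim: exec_WhileE)
  with WhileT.IH show ?case by metis
qed

definition uniform_oracle :: "(nat \<Rightarrow> real) measure" where
  "uniform_oracle = PiM UNIV (\<lambda>_. restrict_space lborel {0..1})"


section \<open>Problem instances and sampling\<close>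

text \<open>Letters are presented to the machine as the numbers below \<open>card D\<close>, through an arbitrary
  bijection \<open>enc\<close>, and the words of \<open>\<Gamma>\<close> in an arbitrary order \<open>gs\<close>.\<close>

definition crf_instance ::
  "'a set \<Rightarrow> 'a list set \<Rightarrow> nat \<Rightarrow> ('a \<Rightarrow> nat) \<Rightarrow> 'a list list \<Rightarrow> bool" where
  "crf_instance D \<Gamma> n enc gs \<longleftrightarrow>
     finite D \<and> finite \<Gamma> \<and> \<Gamma> \<noteq> {} \<and> [] \<notin> \<Gamma> \<and> \<Gamma> \<subseteq> lists D \<and> 1 \<le> n \<and>
     bij_betw enc D {..<card D} \<and> distinct gs \<and> set gs = \<Gamma>"

text \<open>Initial memory: the numbers \<open>n\<close>, \<open>card D\<close>, \<open>card \<Gamma>\<close> in array 1; in array 2 a table \<open>T\<close>,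
  which in the theorem is a function of the encoded word list only; and in real array 0 the value
  \<open>\<psi> \<alpha> i j\<close> at address \<open>g * n + (i - 1)\<close>, where \<open>\<alpha> = gs ! g\<close>.  Everything else is 0.\<close>

definition init_state ::
  "'a set \<Rightarrow> 'a list list \<Rightarrow> nat \<Rightarrow> ('a list \<Rightarrow> nat \<Rightarrow> nat \<Rightarrow> real) \<Rightarrow> nat list \<Rightarrow> state" where
  "init_state D gs n \<psi> T = \<lparr>
     nmem = (\<lambda>a k.
       if a = 1 then (if k = 0 then n else if k = 1 then card D else if k = 2 then length gs else 0)
       else if a = 2 \<and> k < length T then T ! k
       else 0),
     rmem = (\<lambda>a k.
       if a = 0 \<and> k < length gs * n then
         (let \<alpha> = gs ! (k div n); i = k mod n + 1; j = i + length \<alpha> - 1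
          in if j \<le> n then \<psi> \<alpha> i j else 0)
       else 0),
     drawn = 0\<rparr>"

text \<open>The output word is read off the first \<open>n\<close> cells of array 0.\<close>

definition output_word :: "'a set \<Rightarrow> ('a \<Rightarrow> nat) \<Rightarrow> nat \<Rightarrow> state \<Rightarrow> 'a list" where
  "output_word D enc n s = map (\<lambda>k. inv_into D enc (nmem s 0 k)) [0..<n]"

definition index_bound :: "'a set \<Rightarrow> 'a list set \<Rightarrow> nat \<Rightarrow> nat" where
  "index_bound D \<Gamma> n = (n + 1) * (total_length \<Gamma> + 1) * (card D + 1)"

text \<open>\<open>iid_sampler\<close>: running \<open>c\<close> over and over, first in state \<open>s0 \<omega>\<close> and then always in the state
  left behind by the previous run, each run takes time at most \<open>t\<close> for all oracle values in
  \<open>[0,1]\<close>, and the successive outputs are independent with distribution \<open>p\<close> on \<open>words D n\<close>.\<close>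

definition iid_sampler ::
  "nat \<Rightarrow> com \<Rightarrow> ((nat \<Rightarrow> real) \<Rightarrow> state) \<Rightarrow> nat \<Rightarrow> 'a set \<Rightarrow> ('a \<Rightarrow> nat) \<Rightarrow> nat \<Rightarrow>
     ('a list \<Rightarrow> real) \<Rightarrow> bool" where
  "iid_sampler B c s0 t D enc n p \<longleftrightarrow>
     (\<exists>S :: nat \<Rightarrow> (nat \<Rightarrow> real) \<Rightarrow> state.
        (\<forall>\<omega>\<in>space uniform_oracle.
           S 0 \<omega> = s0 \<omega> \<and> (\<forall>k. \<exists>u\<le>t. exec B \<omega> c (S k \<omega>) u (S (Suc k) \<omega>))) \<and>
        (let X = (\<lambda>k \<omega>. output_word D enc n (S (Suc k) \<omega>)); N = count_space (words D n)
         in prob_space.indep_vars uniform_oracle (\<lambda>_. N) X UNIV \<and>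
            (\<forall>k. distributed uniform_oracle N (X k) (\<lambda>x. ennreal (p x)))))"

end

(* Let V_r(q) be |D| times the weight of all continuations from position n - r in state q of the automaton
   whose states are the prefixes of words.  Reading e in state q differs from reading it in the
   failure state of q only if qe is again a prefix, hence
     V_r(q) = V_r(fail q) + (sum over prefixes p = qe) (A_r(p) - A_r(fail p)),
   where A_r(p) is the weight of entering p.  One level thus costs as many operations as there are
   prefixes, at most L + 1.  A word is then sampled letter by letter, e with probability
   A_r(q.e) / V_r(q); these probabilities telescope to the Gibbs weight.  Letters occurring in no
   word all lead to the empty prefix and are treated as one outcome, so that at most
   min(L, |D|) + 1 outcomes remain.  A Walker alias table turns uniform draws into an
   outcome in constant time.  It is built for the current state only in (i), and for all levels and
   states beforehand in (ii). *)
theory Submission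
  imports Defs "HOL-Library.Sublist"
begin

section \<open>Running time of programs\<close>

text \<open>Programs and probability meet only in \<open>letter_at\<close>. It computes the letters
  from the oracle values by the arithmetic of the machine, which is shown to output them for every
  oracle with values in [0,1], not merely almost surely; so the null case of a draw equal to 1 gets
  a default in the program and in the function alike. Each letter consumes three values whether or
  not it needs them. Run k therefore reads exactly the values 3nk, ..., 3n(k+1)-1, and disjoint
  blocks give independence although every run inherits the memory of the previous one. No
  conditional probabilities occur: along a fixed target word the states of the automaton are
  constants, so drawing that word is an intersection of events about disjoint triples of draws. That
  the resulting factor is 1/Z follows from total probability 1, without evaluating Z. Two
  constraints shape the data. And V_r(q) uses V_r(fail q) of the same level, so the failure link
  must decrease in the numbering of the states.\<close>

definition terminates ::
  "nat \<Rightarrow> (nat \<Rightarrow> real) \<Rightarrow> com \<Rightarrow> state \<Rightarrow> nat \<Rightarrow> (state \<Rightarrow> bool) \<Rightarrow> bool" where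
  "terminates B \<omega> c s t Q \<longleftrightarrow> (\<exists>u s'. exec B \<omega> c s u s' \<and> u \<le> t \<and> Q s')"

lemma terminates_weaken:
  assumes "terminates B \<omega> c s t Q" "t \<le> t'" "\<And>s'. Q s' \<Longrightarrow> Q' s'"
  shows "terminates B \<omega> c s t' Q'"
  using assms unfolding terminates_def by (meson order_trans)

lemma terminates_Seq:
  assumes "terminates B \<omega> c s t Q" "\<And>s'. Q s' \<Longrightarrow> terminates B \<omega> d s' t' R"
  shows "terminates B \<omega> (Seq c d) s (t + t') R"
  using assms unfolding terminates_def by (meson add_mono exec.Seq)

primrec straight :: "com \<Rightarrow> bool" where
  "straight Skip = True"
| "straight (NSet a i e) = True"
| "straight (RSet a i r) = True"
| "straight (Draw a i) = True"
| "straight (Seq c d) = (straight c \<and> straight d)"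
| "straight (If b c d) = (straight c \<and> straight d)"
| "straight (While b c) = False"

text \<open>A loop-free program computes a function of its start state, so the simplifier can
  execute it symbolically. The value for \<open>While\<close> is a placeholder; the hypothesis of
  \<open>straight_exec\<close> excludes loops.\<close>

primrec straight_result :: "nat \<Rightarrow> (nat \<Rightarrow> real) \<Rightarrow> com \<Rightarrow> state \<Rightarrow> state" where
  "straight_result B \<omega> Skip s = s"
| "straight_result B \<omega> (NSet a i e) s = nupd a (nval B s i) (nval B s e) s"
| "straight_result B \<omega> (RSet a i r) s = rupd a (nval B s i) (rval B s r) s"
| "straight_result B \<omega> (Draw a i) s =
     rupd a (nval B s i) (\<omega> (drawn s)) s\<lparr>drawn := Suc (drawn s)\<rparr>"
| "straight_result B \<omega> (Seq c d) s = straight_result B \<omega> d (straight_result B \<omega> c s)"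
| "straight_result B \<omega> (If b c d) s =
     (if bval B s b then straight_result B \<omega> c s else straight_result B \<omega> d s)"
| "straight_result B \<omega> (While b c) s = s"

primrec straight_cost :: "com \<Rightarrow> nat" where
  "straight_cost Skip = 1"
| "straight_cost (NSet a i e) = ncost i + ncost e + 1"
| "straight_cost (RSet a i r) = ncost i + rcost r + 1"
| "straight_cost (Draw a i) = ncost i + 1"
| "straight_cost (Seq c d) = straight_cost c + straight_cost d"
| "straight_cost (If b c d) = bcost b + max (straight_cost c) (straight_cost d) + 1"
| "straight_cost (While b c) = 0"

lemma straight_exec:
  "straight c \<Longrightarrow> \<exists>u \<le> straight_cost c. exec B \<omega> c s u (straight_result B \<omega> c s)"
proof (induction c arbitrary: s)
  case Skip
  show ?case using exec.Skip[of B \<omega> s] by (intro exI[of _ 1]) simp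
next
  case (NSet a i e)
  show ?case using exec.NSet[of B \<omega> a i e s] by (intro exI[of _ "ncost i + ncost e + 1"]) simp
next
  case (RSet a i e)
  show ?case using exec.RSet[of B \<omega> a i e s] by (intro exI[of _ "ncost i + rcost e + 1"]) simp
next
  case (Draw a i)
  show ?case using exec.Draw[of B \<omega> a i s] by (intro exI[of _ "ncost i + 1"]) simp
next
  case (Seq c d)
  then show ?case
    by simp (meson add_mono exec.Seq)
next
  case (If b c d)
  show ?case
  proof (cases "bval B s b")
    case True
    obtain u where "u \<le> straight_cost c" "exec B \<omega> c s u (straight_result B \<omega> c s)"
      using If by (meson straight.simps(6))
    then show ?thesis
      using exec.IfT[OF True, of \<omega> c u _ d] True
      by (intro exI[of _ "bcost b + u + 1"]) (auto simp: le_max_iff_disj)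
  next
    case False
    obtain u where "u \<le> straight_cost d" "exec B \<omega> d s u (straight_result B \<omega> d s)"
      using If by (meson straight.simps(6))
    then show ?thesis
      using exec.IfF[OF False, of \<omega> d u _ c] False
      by (intro exI[of _ "bcost b + u + 1"]) (auto simp: le_max_iff_disj)
  qed
qed simp

lemma terminates_straight:
  assumes "straight c" "straight_cost c \<le> t" "Q (straight_result B \<omega> c s)"
  shows "terminates B \<omega> c s t Q"
  using straight_exec[OF assms(1), of B \<omega> s] assms(2,3)
  unfolding terminates_def by (meson order_trans)

definition For :: "nat \<Rightarrow> nexp \<Rightarrow> com \<Rightarrow> com" where
  "For v e c = Seq (NSet v (Num 0) (Num 0))
     (While (NLess (NGet v (Num 0)) e) (Seq c (NSet v (Num 0) (NAdd (NGet v (Num 0)) (Num 1)))))"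

text \<open>The bound \<open>e\<close> is evaluated again before every round, hence the premise that
  the invariant fixes its value. One round costs \<open>t\<close> for the body, 6 for advancing the
  counter and \<open>ncost e + 4\<close> for the test, together
  \<open>t + ncost e + 10\<close>.\<close>

lemma terminates_For:
  assumes bound: "\<And>j s. j \<le> N \<Longrightarrow> I j s \<Longrightarrow> nval B s e = N"
    and init: "I 0 (nupd v 0 0 s)"
    and step: "\<And>j s. j < N \<Longrightarrow> I j s \<Longrightarrow> nmem s v 0 = j \<Longrightarrow>
      terminates B \<omega> c s t (\<lambda>s'. nmem s' v 0 = j \<and> I (Suc j) (nupd v 0 (Suc j) s'))"
    and post: "\<And>s. I N s \<Longrightarrow> nmem s v 0 = N \<Longrightarrow> Q s"
  shows "terminates B \<omega> (For v e c) s (N * (t + ncost e + 10) + (ncost e + 10)) Q"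
proof -
  let ?W = "While (NLess (NGet v (Num 0)) e) (Seq c (NSet v (Num 0) (NAdd (NGet v (Num 0)) (Num 1))))"
  have loop: "terminates B \<omega> ?W s ((N - j) * (t + ncost e + 10) + (ncost e + 4)) Q"
    if "j \<le> N" "I j s" "nmem s v 0 = j" for j s
    using that
  proof (induction "N - j" arbitrary: j s)
    case 0
    then have "j = N" by simp
    then have "exec B \<omega> ?W s (bcost (NLess (NGet v (Num 0)) e) + 1) s"
      using 0 bound[of j s] by (intro exec.WhileF) auto
    then show ?case
      unfolding terminates_def using 0 \<open>j = N\<close> post[of s] by fastforce
  next
    case (Suc k)
    then have "j < N" by simp
    from step[OF this Suc.prems(2,3)] obtain u s1 where s1:
      "exec B \<omega> c s u s1" "u \<le> t" "nmem s1 v 0 = j" "I (Suc j) (nupd v 0 (Suc j) s1)"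
      unfolding terminates_def by auto
    have ex: "exec B \<omega> (Seq c (NSet v (Num 0) (NAdd (NGet v (Num 0)) (Num 1)))) s (u + 6)
        (nupd v 0 (Suc j) s1)"
      using exec.Seq[OF s1(1) exec.NSet[of B \<omega> v "Num 0" "NAdd (NGet v (Num 0)) (Num 1)" s1]] s1(3)
      by (simp add: eval_nat_numeral)
    have nv: "nmem (nupd v 0 (Suc j) s1) v 0 = Suc j" by (simp add: nupd_def)
    have "k = N - Suc j" "Suc j \<le> N" using Suc.hyps \<open>j < N\<close> by auto
    from Suc.hyps(1)[OF this s1(4) nv] obtain w s2 where s2:
      "exec B \<omega> ?W (nupd v 0 (Suc j) s1) w s2"
      "w \<le> (N - Suc j) * (t + ncost e + 10) + (ncost e + 4)" "Q s2"
      unfolding terminates_def by auto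
    have "bval B s (NLess (NGet v (Num 0)) e)"
      using bound[OF Suc.prems(1,2)] Suc.prems \<open>j < N\<close> by simp
    from exec.WhileT[OF this ex s2(1)]
    have "exec B \<omega> ?W s (ncost e + 3 + (u + 6) + w + 1) s2" by (simp add: eval_nat_numeral)
    moreover have "N - j = Suc (N - Suc j)" using \<open>j < N\<close> by simp
    then have "ncost e + 3 + (u + 6) + w + 1 \<le> (N - j) * (t + ncost e + 10) + (ncost e + 4)"
      using s2(2) s1(2) by simp
    ultimately show ?case unfolding terminates_def using s2(3) by blast
  qed
  have "terminates B \<omega> (For v e c) s (3 + ((N - 0) * (t + ncost e + 10) + (ncost e + 4))) Q"
    unfolding For_def
  proof (rule terminates_Seq[where Q = "\<lambda>s'. s' = nupd v 0 0 s"])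
    show "terminates B \<omega> (NSet v (Num 0) (Num 0)) s 3 (\<lambda>s'. s' = nupd v 0 0 s)"
      by (rule terminates_straight) auto
    show "terminates B \<omega> ?W s' ((N - 0) * (t + ncost e + 10) + (ncost e + 4)) Q"
      if "s' = nupd v 0 0 s" for s'
      using that by (intro loop) (auto simp: init nupd_def[of v 0 0 s, symmetric], simp add: nupd_def)
  qed
  then show ?thesis by (rule terminates_weaken) auto
qed

section \<open>Frame conditions\<close>

primrec nat_writes :: "com \<Rightarrow> nat set" where
  "nat_writes Skip = {}"
| "nat_writes (NSet a i e) = {a}"
| "nat_writes (RSet a i r) = {}"
| "nat_writes (Draw a i) = {}"
| "nat_writes (Seq c d) = nat_writes c \<union> nat_writes d"
| "nat_writes (If b c d) = nat_writes c \<union> nat_writes d"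
| "nat_writes (While b c) = nat_writes c"

primrec real_writes :: "com \<Rightarrow> nat set" where
  "real_writes Skip = {}"
| "real_writes (NSet a i e) = {}"
| "real_writes (RSet a i r) = {a}"
| "real_writes (Draw a i) = {a}"
| "real_writes (Seq c d) = real_writes c \<union> real_writes d"
| "real_writes (If b c d) = real_writes c \<union> real_writes d"
| "real_writes (While b c) = real_writes c"

primrec drawless :: "com \<Rightarrow> bool" where
  "drawless Skip = True"
| "drawless (NSet a i e) = True"
| "drawless (RSet a i r) = True"
| "drawless (Draw a i) = False"
| "drawless (Seq c d) = (drawless c \<and> drawless d)"
| "drawless (If b c d) = (drawless c \<and> drawless d)"
| "drawless (While b c) = drawless c"

text \<open>Read off the program text: an array that is nowhere a target keeps its contents, so such
  arrays need not be carried through every loop invariant.\<close>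

definition unwritten :: "com \<Rightarrow> state \<Rightarrow> state \<Rightarrow> bool" where
  "unwritten c s s' \<longleftrightarrow> (\<forall>a. a \<notin> nat_writes c \<longrightarrow> nmem s' a = nmem s a) \<and>
     (\<forall>a. a \<notin> real_writes c \<longrightarrow> rmem s' a = rmem s a) \<and> (drawless c \<longrightarrow> drawn s' = drawn s)"

lemma exec_unwritten: "exec B \<omega> c s t s' \<Longrightarrow> unwritten c s s'"
  unfolding unwritten_def
  by (induction rule: exec.induct) (auto simp: nupd_def rupd_def)

lemma terminates_unwritten:
  "terminates B \<omega> c s t Q \<Longrightarrow> terminates B \<omega> c s t (\<lambda>s'. Q s' \<and> unwritten c s s')"
  unfolding terminates_def using exec_unwritten by blast

lemma writes_For [simp]:
  "nat_writes (For v e c) = insert v (nat_writes c)"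
  "real_writes (For v e c) = real_writes c"
  "drawless (For v e c) = drawless c"
  by (auto simp: For_def)

section \<open>Alias tables\<close>

text \<open>A state consists of the stacks of columns below 1 and of at least 1, the amounts \<open>b\<close> in the
  columns, and the columns \<open>al\<close> from which they are filled up to 1: a small column keeps its own
  outcome with probability \<open>b\<close> and otherwise yields \<open>al\<close>.\<close>

type_synonym alias_state = "nat list \<times> nat list \<times> (nat \<Rightarrow> real) \<times> (nat \<Rightarrow> nat)"

text \<open>The reversal mirrors the stacks of the machine: columns are pushed in increasing order,
  and the head of each list is the column pushed last.\<close>

definition alias_init :: "nat \<Rightarrow> (nat \<Rightarrow> real) \<Rightarrow> alias_state" where
  "alias_init k w =
     (rev (filter (\<lambda>e. w e < 1) [0..<k]), rev (filter (\<lambda>e. \<not> w e < 1) [0..<k]), w, id)"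

text \<open>Vose's form of Walker's construction: the small column \<open>s\<close> is closed with
  \<open>l\<close> as donor, and \<open>l\<close> gives away what \<open>s\<close> lacks. With an
  empty stack nothing changes, so a loop of exactly \<open>k\<close> rounds serves every weight
  function.\<close>

fun alias_step :: "alias_state \<Rightarrow> alias_state" where
  "alias_step (s # sm, l # lg, b, al) =
     (let b' = b(l := b l - (1 - b s)); al' = al(s := l)
      in if b' l < 1 then (l # sm, lg, b', al') else (sm, l # lg, b', al'))"
| "alias_step ([], lg, b, al) = ([], lg, b, al)"
| "alias_step (sm, [], b, al) = (sm, [], b, al)"

definition alias_run :: "nat \<Rightarrow> (nat \<Rightarrow> real) \<Rightarrow> alias_state" where
  "alias_run k w = (alias_step ^^ k) (alias_init k w)"

definition alias_keep :: "nat \<Rightarrow> (nat \<Rightarrow> real) \<Rightarrow> nat \<Rightarrow> real" where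
  "alias_keep k w = fst (snd (snd (alias_run k w)))"

definition alias_other :: "nat \<Rightarrow> (nat \<Rightarrow> real) \<Rightarrow> nat \<Rightarrow> nat" where
  "alias_other k w = snd (snd (snd (alias_run k w)))"

text \<open>Columns on neither stack are closed. The last conjunct is conservation of mass: a weight
  is what remains in its own column plus what it has given to closed columns. The condition on the
  sum says that the open columns have average 1.\<close>

fun alias_inv :: "nat \<Rightarrow> (nat \<Rightarrow> real) \<Rightarrow> alias_state \<Rightarrow> bool" where
  "alias_inv k w (sm, lg, b, al) \<longleftrightarrow>
     distinct (sm @ lg) \<and> set (sm @ lg) \<subseteq> {..<k} \<and>
     (\<forall>j\<in>set sm. 0 \<le> b j \<and> b j < 1) \<and> (\<forall>j\<in>set lg. 1 \<le> b j) \<and>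
     (\<forall>j\<in>{..<k} - set (sm @ lg). 0 \<le> b j \<and> b j \<le> 1) \<and> (\<forall>j<k. al j < k) \<and>
     (\<Sum>j\<in>set (sm @ lg). b j) = card (set (sm @ lg)) \<and>
     (\<forall>x<k. w x = b x + (\<Sum>j\<in>{..<k} - set (sm @ lg). of_bool (al j = x) * (1 - b j)))"

lemma alias_inv_init:
  assumes "\<And>e. e < k \<Longrightarrow> 0 \<le> w e" "(\<Sum>e<k. w e) = real k"
  shows "alias_inv k w (alias_init k w)"
proof -
  have *: "{x. x < k \<and> w x < 1} \<union> {x. x < k \<and> \<not> w x < 1} = {..<k}" by auto
  show ?thesis
    using assms by (auto simp: alias_init_def *)
qed

text \<open>Closing \<open>s\<close> moves \<open>1 - b s\<close> from the amount of
  \<open>l\<close> to the share of \<open>l\<close> in a closed column, so every weight is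
  conserved. The open columns lose \<open>b s + (1 - b s) = 1\<close> in total and one in number, so
  their average stays 1.\<close>

lemma alias_inv_step:
  assumes "alias_inv k w st"
  shows "alias_inv k w (alias_step st)"
proof (cases st rule: alias_step.cases)
  case (1 s sm l lg b al)
  define b' where "b' = b(l := b l - (1 - b s))"
  define al' where "al' = al(s := l)"
  define R where "R = insert l (set sm \<union> set lg)"
  define J where "J = {..<k} - insert s R"
  have inv: "distinct (s # sm @ l # lg)" "insert s R \<subseteq> {..<k}"
    "\<forall>j\<in>insert s (set sm). 0 \<le> b j \<and> b j < 1" "\<forall>j\<in>insert l (set lg). 1 \<le> b j"
    "\<forall>j\<in>J. 0 \<le> b j \<and> b j \<le> 1" "\<forall>j<k. al j < k"
    "(\<Sum>j\<in>insert s R. b j) = card (insert s R)"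
    "\<And>x. x < k \<Longrightarrow> w x = b x + (\<Sum>j\<in>J. of_bool (al j = x) * (1 - b j))"
    using assms unfolding 1 R_def J_def by (auto simp: insert_commute)
  have fin: "finite R" "finite J" by (auto simp: R_def J_def)
  have nin: "s \<notin> R" "l \<notin> set sm" "l \<notin> set lg" "s \<noteq> l" "l \<in> R" "l \<notin> J" "s \<notin> J"
    using inv(1) by (auto simp: R_def J_def)
  have sk: "s < k" "l < k" using inv(2) by (auto simp: R_def)
  have diff: "{..<k} - R = insert s J" using sk nin by (auto simp: J_def)
  have "(\<Sum>j\<in>R. b' j) = b' l + (\<Sum>j\<in>R - {l}. b j)"
    using nin fin by (subst sum.remove[of R l]) (auto simp: b'_def intro!: sum.cong)
  also have "\<dots> = b l - (1 - b s) + (\<Sum>j\<in>R - {l}. b j)" by (simp add: b'_def)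
  also have "\<dots> = (\<Sum>j\<in>R. b j) + b s - 1"
    using nin fin by (subst sum.remove[of R l b]) auto
  also have "\<dots> = card R" using inv(7) nin fin by simp
  finally have sumR: "(\<Sum>j\<in>R. b' j) = card R" .
  have w: "w x = b' x + (\<Sum>j\<in>{..<k} - R. of_bool (al' j = x) * (1 - b' j))" if "x < k" for x
  proof -
    have "(\<Sum>j\<in>{..<k} - R. of_bool (al' j = x) * (1 - b' j)) =
        of_bool (l = x) * (1 - b s) + (\<Sum>j\<in>J. of_bool (al' j = x) * (1 - b' j))"
      unfolding diff using nin fin by (simp add: al'_def b'_def)
    also have "(\<Sum>j\<in>J. of_bool (al' j = x) * (1 - b' j)) =
        (\<Sum>j\<in>J. of_bool (al j = x) * (1 - b j))"
      using nin by (intro sum.cong) (auto simp: al'_def b'_def)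
    finally show ?thesis using inv(8)[OF that] by (auto simp: b'_def)
  qed
  have small: "\<forall>j\<in>set sm. 0 \<le> b' j \<and> b' j < 1" using inv(3) nin by (auto simp: b'_def)
  have large: "\<forall>j\<in>set lg. 1 \<le> b' j" using inv(4) nin by (auto simp: b'_def)
  have out: "\<forall>j\<in>{..<k} - R. 0 \<le> b' j \<and> b' j \<le> 1"
    unfolding diff using inv(3,5) nin by (auto simp: b'_def)
  have al: "\<forall>j<k. al' j < k" using inv(6) sk by (simp add: al'_def)
  have l0: "0 \<le> b' l" using inv(3,4) by (simp add: b'_def)
  have step: "alias_step st = (if b' l < 1 then (l # sm, lg, b', al') else (sm, l # lg, b', al'))"
    unfolding 1 by (simp add: b'_def al'_def Let_def)
  show ?thesis
  proof (cases "b' l < 1")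
    case True
    then show ?thesis
      unfolding step
      using inv(1,2) small large out al l0 sumR w unfolding R_def by auto
  next
    case False
    then show ?thesis
      unfolding step
      using inv(1,2) small large out al sumR w unfolding R_def by auto
  qed
qed (use assms in auto)

lemma alias_step_progress:
  "length (fst (alias_step st)) + length (fst (snd (alias_step st))) <
     length (fst st) + length (fst (snd st)) \<or>
   fst (alias_step st) = [] \<or> fst (snd (alias_step st)) = []"
  by (cases st rule: alias_step.cases) (auto simp: Let_def)

lemma alias_step_idle:
  "fst st = [] \<or> fst (snd st) = [] \<Longrightarrow> alias_step st = st"
  by (cases st rule: alias_step.cases) auto

text \<open>The stacks hold \<open>k\<close> columns at the start and every effective step closes
  one, so \<open>k\<close> steps exhaust at least one stack.\<close>

lemma alias_run_done:
  "fst (alias_run k w) = [] \<or> fst (snd (alias_run k w)) = []"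
proof -
  let ?st = "\<lambda>i. (alias_step ^^ i) (alias_init k w)"
  have "length (fst (?st i)) + length (fst (snd (?st i))) + i \<le> k \<or>
    fst (?st i) = [] \<or> fst (snd (?st i)) = []" for i
  proof (induction i)
    case 0
    have "length (filter (\<lambda>e. w e < 1) [0..<k]) + length (filter (\<lambda>e. \<not> w e < 1) [0..<k]) = k"
      using sum_length_filter_compl[of "\<lambda>e. w e < 1" "[0..<k]"] by simp
    then show ?case by (simp add: alias_init_def)
  next
    case (Suc i)
    then show ?case
      using alias_step_progress[of "?st i"] alias_step_idle[of "?st i"] by auto
  qed
  from this[of k] show ?thesis by (auto simp: alias_run_def)
qed

lemma alias_table:
  assumes "\<And>e. e < k \<Longrightarrow> 0 \<le> w e" "(\<Sum>e<k. w e) = real k"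
  shows "j < k \<Longrightarrow> 0 \<le> alias_keep k w j \<and> alias_keep k w j \<le> 1 \<and> alias_other k w j < k"
    and "x < k \<Longrightarrow>
      w x = (\<Sum>j<k. of_bool (j = x) * alias_keep k w j +
               of_bool (alias_other k w j = x) * (1 - alias_keep k w j))"
proof -
  obtain sm lg b al where run: "alias_run k w = (sm, lg, b, al)" by (cases "alias_run k w") auto
  have "alias_inv k w ((alias_step ^^ i) (alias_init k w))" for i
    by (induction i) (use alias_inv_init[OF assms] alias_inv_step in auto)
  then have inv: "alias_inv k w (sm, lg, b, al)"
    using run unfolding alias_run_def by metis
  define R where "R = set (sm @ lg)"
  have "sum b R = card R" using inv by (simp add: R_def)
  then have sumR: "(\<Sum>j\<in>R. 1 - b j) = 0" by (simp add: sum_subtractf)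
  \<comment> \<open>With one stack empty, the open columns lie on the same side of 1 while their
    average is 1. Hence all equal 1; leftover small columns, being strictly below 1, are
    impossible.\<close>
  have one: "b j = 1" if "j \<in> R" for j
  proof (cases "sm = []")
    case True
    have "(\<Sum>j\<in>R. b j - 1) = 0" using sumR by (simp add: sum_subtractf)
    moreover have "\<forall>j\<in>R. 0 \<le> b j - 1" using True inv by (auto simp: R_def)
    ultimately have "\<forall>j\<in>R. b j - 1 = 0"
      by (subst (asm) sum_nonneg_eq_0_iff) (auto simp: R_def)
    then show ?thesis using that by simp
  next
    case False
    then have "lg = []" using alias_run_done[of k w] run by simp
    then have "\<forall>j\<in>R. 0 < 1 - b j" using inv by (auto simp: R_def)
    then have "0 < (\<Sum>j\<in>R. 1 - b j)"
      using that by (intro sum_pos) (auto simp: R_def)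
    then show ?thesis using sumR by simp
  qed
  have keep: "alias_keep k w = b" "alias_other k w = al"
    by (simp_all add: alias_keep_def alias_other_def run)
  show "0 \<le> alias_keep k w j \<and> alias_keep k w j \<le> 1 \<and> alias_other k w j < k" if "j < k"
    unfolding keep using inv one[of j] that by (cases "j \<in> R") (auto simp: R_def)
  show "w x = (\<Sum>j<k. of_bool (j = x) * alias_keep k w j +
               of_bool (alias_other k w j = x) * (1 - alias_keep k w j))" if "x < k"
  proof -
    have "w x = b x + (\<Sum>j\<in>{..<k} - R. of_bool (al j = x) * (1 - b j))"
      using inv that by (simp add: R_def)
    \<comment> \<open>Columns still open hold exactly 1 and have nothing to be filled up, so the sum
      extends to all columns.\<close>
    also have "(\<Sum>j\<in>{..<k} - R. of_bool (al j = x) * (1 - b j)) =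
        (\<Sum>j<k. of_bool (al j = x) * (1 - b j))"
      using one by (intro sum.mono_neutral_left) auto
    also have "b x = (\<Sum>j<k. of_bool (j = x) * b j)"
      using that by (simp add: of_bool_def if_distrib[of "\<lambda>c. c * _"] sum.delta cong: if_cong)
    finally show ?thesis unfolding keep by (simp add: sum.distrib)
  qed
qed

section \<open>The programs\<close>

definition tab :: "nat \<Rightarrow> nexp \<Rightarrow> nexp" where
  "tab r e = NGet 2 (NAdd (NMul e (Num 8)) (Num r))"

definition look :: "(nat \<Rightarrow> nat) \<Rightarrow> nat \<Rightarrow> nat \<Rightarrow> nat" where
  "look N r k = N (k * 8 + r)"

lemma tab_simps [simp]:
  "nval B s (tab r e) = look (nmem s 2) r (nval B s e)"
  "ncost (tab r e) = ncost e + 5"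
  by (simp_all add: tab_def look_def)

notation Seq (infixr ";;" 60)

abbreviation scalar :: "nat \<Rightarrow> nexp" where "scalar a \<equiv> NGet a (Num 0)"
abbreviation "var_n \<equiv> NGet 1 (Num 0)"
abbreviation "var_d \<equiv> NGet 1 (Num 1)"
abbreviation "num_states \<equiv> tab 0 (Num 0)"
abbreviation "num_used \<equiv> tab 0 (Num 1)"
abbreviation "num_outcomes \<equiv> NAdd num_used (Num 1)"
abbreviation "cell r q \<equiv> NAdd (NMul r num_states) q"
abbreviation "goto q e \<equiv> tab 5 (NAdd (NMul q num_outcomes) e)"

text \<open>Integer arrays: 0 output, 1 and 2 input, 3 level \<open>r\<close>, 4 state \<open>q\<close>, 5 loop counter,
  6 aliases, 7 and 8 the stacks of small and large columns with heights in 9 and 10, 11 offset of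
  the current alias table, 12 and 15 columns to be paired, 13 drawn letter, 14 position.
  Real arrays: 0 input, 1 \<open>A\<close>, 2 \<open>V\<close>, 3 costs of the current level, 4 accumulated differences,
  5 alias thresholds, 6 drawn numbers.  Columns of the input table 2: 0 sizes, 1 failure link,
  2 parent, 3 number of the word plus one, 4 length, 5 transitions, 6 and 7 relabelling of letters.\<close>

definition add_differences :: com where
  "add_differences = If (NLess (Num 0) (scalar 4))
     (RSet 4 (tab 2 (scalar 4))
       (RAdd (RGet 4 (tab 2 (scalar 4)))
         (RSub (RGet 1 (cell (scalar 3) (scalar 4))) (RGet 1 (cell (scalar 3) (tab 1 (scalar 4)))))))
     Skip"

text \<open>Under truncated subtraction \<open>1 - (1 - x)\<close> is 1 for positive
  \<open>x\<close> and 0 otherwise; applied to column 3 it tells whether the state is a word. That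
  word ends at position \<open>n - r\<close>, so \<open>n - r\<close> minus its length is its start
  counted from 0, as the input array requires. The failure state has a smaller number, so its
  entries of this level are already present.\<close>

definition set_message :: com where
  "set_message =
     If (NLess (Num 0) (scalar 4))
       (RSet 2 (cell (scalar 3) (scalar 4))
          (RAdd (RGet 2 (cell (scalar 3) (tab 1 (scalar 4)))) (RGet 4 (scalar 4))) ;;
        RSet 3 (scalar 4)
          (RAdd (RGet 3 (tab 1 (scalar 4)))
            (RMul (OfNat (NSub (Num 1) (NSub (Num 1) (tab 3 (scalar 4)))))
              (RGet 0 (NAdd (NMul (NSub (tab 3 (scalar 4)) (Num 1)) var_n)
                (NSub (NSub var_n (scalar 3)) (tab 4 (scalar 4))))))))
       (RSet 2 (cell (scalar 3) (Num 0))
          (RAdd (RMul (OfNat var_d) (RGet 1 (cell (scalar 3) (Num 0)))) (RGet 4 (Num 0))) ;;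
        RSet 3 (Num 0) (OfNat (Num 0))) ;;
     RSet 1 (cell (NAdd (scalar 3) (Num 1)) (scalar 4))
       (RMul (RExp (RSub (OfNat (Num 0)) (RGet 3 (scalar 4))))
         (RGet 2 (cell (scalar 3) (scalar 4))))"

definition level :: com where
  "level = For 4 num_states (RSet 4 (scalar 4) (OfNat (Num 0))) ;;
     For 4 num_states add_differences ;; For 4 num_states set_message"

definition messages :: com where
  "messages = For 4 num_states (RSet 1 (scalar 4) (OfNat (Num 1))) ;;
     For 3 (NAdd var_n (Num 1)) level"

text \<open>The integer factor is 1 for outcomes below \<open>num_used\<close> and
  \<open>var_d - num_used\<close> for the last one, which stands for that many letters. Multiplying
  by the number of outcomes makes the average column 1.\<close>

definition classify :: com where
  "classify =
     RSet 5 (NAdd (scalar 11) (scalar 5))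
       (RDiv (RMul
         (RMul
           (OfNat (NAdd (NSub (Num 1) (NSub (NAdd (scalar 5) (Num 1)) num_used))
             (NMul (NSub (NAdd (scalar 5) (Num 1)) num_used) (NSub var_d num_used))))
           (RGet 1 (cell (scalar 3) (goto (scalar 4) (scalar 5)))))
         (OfNat num_outcomes))
         (RGet 2 (cell (scalar 3) (scalar 4)))) ;;
     NSet 6 (NAdd (scalar 11) (scalar 5)) (scalar 5) ;;
     If (RLess (RGet 5 (NAdd (scalar 11) (scalar 5))) (OfNat (Num 1)))
       (NSet 7 (scalar 9) (scalar 5) ;; NSet 9 (Num 0) (NAdd (scalar 9) (Num 1)))
       (NSet 8 (scalar 10) (scalar 5) ;; NSet 10 (Num 0) (NAdd (scalar 10) (Num 1)))"

text \<open>One \<open>alias_step\<close> in place. The large column is read without being popped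
  and leaves its stack only if it becomes small.\<close>

definition pair_columns :: com where
  "pair_columns = If (BAnd (NLess (Num 0) (scalar 9)) (NLess (Num 0) (scalar 10)))
     (NSet 9 (Num 0) (NSub (scalar 9) (Num 1)) ;;
      NSet 12 (Num 0) (NGet 7 (scalar 9)) ;;
      NSet 15 (Num 0) (NGet 8 (NSub (scalar 10) (Num 1))) ;;
      NSet 6 (NAdd (scalar 11) (scalar 12)) (scalar 15) ;;
      RSet 5 (NAdd (scalar 11) (scalar 15))
        (RSub (RGet 5 (NAdd (scalar 11) (scalar 15)))
          (RSub (OfNat (Num 1)) (RGet 5 (NAdd (scalar 11) (scalar 12))))) ;;
      If (RLess (RGet 5 (NAdd (scalar 11) (scalar 15))) (OfNat (Num 1)))
        (NSet 10 (Num 0) (NSub (scalar 10) (Num 1)) ;;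
         NSet 7 (scalar 9) (scalar 15) ;;
         NSet 9 (Num 0) (NAdd (scalar 9) (Num 1)))
        Skip)
     Skip"

definition set_offset :: com where
  "set_offset = NSet 11 (Num 0) (NMul (cell (scalar 3) (scalar 4)) num_outcomes)"

definition build_alias :: com where
  "build_alias =
     (set_offset ;; NSet 9 (Num 0) (Num 0) ;; NSet 10 (Num 0) (Num 0)) ;;
     For 5 num_outcomes classify ;; For 5 num_outcomes pair_columns"

text \<open>Its effect is a single update whose value contains the case distinction, so symbolic
  execution of several such commands does not branch into several states.\<close>

definition set_unless :: "bexp \<Rightarrow> nat \<Rightarrow> nexp \<Rightarrow> com" where
  "set_unless b a e = If b Skip (NSet a (Num 0) e)"

lemma set_unless_simps [simp]:
  "straight (set_unless b a e)"
  "straight_cost (set_unless b a e) = bcost b + ncost e + 3"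
  "nat_writes (set_unless b a e) = {a}"
  "real_writes (set_unless b a e) = {}"
  "drawless (set_unless b a e)"
  "straight_result B \<omega> (set_unless b a e) s =
     nupd a 0 (if bval B s b then nmem s a 0 else nval B s e) s"
  by (auto simp: set_unless_def nupd_def)

definition step :: com where
  "step =
    set_offset ;;
    Draw 6 (Num 0) ;; Draw 6 (Num 1) ;; Draw 6 (Num 2) ;;
    NSet 13 (Num 0) (Floor (RMul (RGet 6 (Num 0)) (OfNat num_outcomes))) ;;
    set_unless (NLess (scalar 13) num_outcomes) 13 (Num 0) ;;
    set_unless (RLess (RGet 6 (Num 1)) (RGet 5 (NAdd (scalar 11) (scalar 13)))) 13
      (NGet 6 (NAdd (scalar 11) (scalar 13))) ;;
    NSet 12 (Num 0) (NAdd num_used (Floor (RMul (RGet 6 (Num 2)) (OfNat (NSub var_d num_used))))) ;;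
    set_unless (NLess (scalar 12) var_d) 12 (Num 0) ;;
    set_unless (NLess (scalar 13) num_used) 13 (scalar 12) ;;
    NSet 4 (Num 0) (goto (scalar 4) (NSub (scalar 13) (NSub (scalar 13) num_used))) ;;
    NSet 0 (scalar 14) (NSub (NAdd (scalar 13) (tab 6 (scalar 13))) (tab 7 (scalar 13)))"

definition sample_with :: "com \<Rightarrow> com" where
  "sample_with c = NSet 4 (Num 0) (Num 0) ;;
     For 14 var_n (NSet 3 (Num 0) (NSub var_n (scalar 14)) ;; c ;; step)"

definition sample_direct :: com where
  "sample_direct = messages ;; sample_with build_alias"

definition preprocess :: com where
  "preprocess = messages ;; For 3 (NAdd var_n (Num 1)) (For 4 num_states build_alias)"

definition sample_prepared :: com where
  "sample_prepared = sample_with Skip"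

text \<open>States are numbered so that the failure link \<open>fl\<close> decreases.  Letters are relabelled by \<open>pm\<close>
  so that those occurring in words are the numbers below \<open>m\<close>; \<open>gt q m\<close> is the transition on any
  other letter.\<close>

locale sampler_machine =
  fixes n d S m B :: nat and N1 N2 :: "nat \<Rightarrow> nat" and R0 :: "nat \<Rightarrow> real"
    and fl par pm :: "nat \<Rightarrow> nat" and gt :: "nat \<Rightarrow> nat \<Rightarrow> nat" and cst :: "nat \<Rightarrow> nat \<Rightarrow> real"
  assumes pos: "0 < n" "0 < d" "0 < S" "m \<le> d" "m + 1 \<le> B" "d \<le> B"
    and N1: "N1 0 = n" "N1 (Suc 0) = d"
    and sizes: "look N2 0 0 = S" "look N2 0 (Suc 0) = m"
    and fl: "\<And>q. 0 < q \<Longrightarrow> q < S \<Longrightarrow> look N2 (Suc 0) q = fl q"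
    and fl_less: "\<And>q. 0 < q \<Longrightarrow> q < S \<Longrightarrow> fl q < q"
    and par: "\<And>q. 0 < q \<Longrightarrow> q < S \<Longrightarrow> look N2 2 q = par q"
    and par_less: "\<And>q. 0 < q \<Longrightarrow> q < S \<Longrightarrow> par q < S"
    and gt: "\<And>q e. q < S \<Longrightarrow> e \<le> m \<Longrightarrow> look N2 5 (q * Suc m + e) = gt q e"
    and gt_less: "\<And>q e. q < S \<Longrightarrow> e \<le> m \<Longrightarrow> gt q e < S"
    and pm: "\<And>c. c < d \<Longrightarrow> c + look N2 6 c - look N2 7 c = pm c"
    and cst_0: "\<And>i. cst i 0 = 0"
    and cst_rec: "\<And>i q. i \<le> n \<Longrightarrow> 0 < q \<Longrightarrow> q < S \<Longrightarrow> cst i q = cst i (fl q) +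
      real (Suc 0 - (Suc 0 - look N2 3 q)) * R0 ((look N2 3 q - Suc 0) * n + (i - look N2 4 q))"
    and root: "\<And>f :: nat \<Rightarrow> real. (\<Sum>e<d. f (gt 0 (min e m))) =
      real d * f 0 + (\<Sum>p | 0 < p \<and> p < S \<and> par p = 0. f p - f (fl p))"
    and trans: "\<And>(f :: nat \<Rightarrow> real) q. 0 < q \<Longrightarrow> q < S \<Longrightarrow> (\<Sum>e<d. f (gt q (min e m))) =
      (\<Sum>e<d. f (gt (fl q) (min e m))) + (\<Sum>p | 0 < p \<and> p < S \<and> par p = q. f p - f (fl p))"
begin

abbreviation "K \<equiv> Suc m"

text \<open>The start value 1 gives \<open>V 0 q = d\<close>. This is the origin of the factor |D|,
  and it lets all levels obey one recursion. Index \<open>Suc r\<close> belongs to position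
  \<open>n - r\<close>: the cost of the state entered there, times the contribution of the
  \<open>r\<close> letters that follow.\<close>

primrec A :: "nat \<Rightarrow> nat \<Rightarrow> real" where
  "A 0 = (\<lambda>q. 1)"
| "A (Suc r) = (\<lambda>q. exp (- cst (n - r) q) * (\<Sum>e<d. A r (gt q (min e m))))"

definition V :: "nat \<Rightarrow> nat \<Rightarrow> real" where
  "V r q = (\<Sum>e<d. A r (gt q (min e m)))"

lemma A_Suc: "A (Suc r) q = exp (- cst (n - r) q) * V r q"
  by (simp add: V_def)

lemma A_pos: "q < S \<Longrightarrow> 0 < A r q"
proof (induction r arbitrary: q)
  case (Suc r)
  then have "0 < (\<Sum>e<d. A r (gt q (min e m)))"
    using pos by (intro sum_pos) (auto simp: gt_less)
  then show ?case by simp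
qed simp

lemma V_pos: "q < S \<Longrightarrow> 0 < V r q"
  using A_pos[of q "Suc r"] unfolding A_Suc by (simp add: zero_less_mult_iff)

text \<open>The outcome probabilities scaled to average 1, as the alias construction requires. The
  integer factor has the truncated form that \<open>classify\<close> evaluates;
  \<open>weight_eq\<close> resolves it.\<close>

definition weight :: "nat \<Rightarrow> nat \<Rightarrow> nat \<Rightarrow> real" where
  "weight r q e = real (Suc 0 - (Suc e - m) + (Suc e - m) * (d - m)) * A r (gt q e) * (1 + real m) / V r q"

lemma weight_eq:
  "e < m \<Longrightarrow> weight r q e = A r (gt q e) * K / V r q"
  "weight r q m = real (d - m) * A r (gt q m) * K / V r q"
  by (simp_all add: weight_def)

lemma weight_nonneg: "q < S \<Longrightarrow> e < K \<Longrightarrow> 0 \<le> weight r q e"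
  using A_pos[of "gt q e" r] V_pos[of q r] gt_less[of q e]
  unfolding weight_def by (intro divide_nonneg_nonneg mult_nonneg_nonneg of_nat_0_le_iff) auto

text \<open>All letters from \<open>m\<close> on share the transition \<open>gt q m\<close>, so they
  contribute \<open>d - m\<close> equal terms to \<open>V r q\<close>.\<close>

lemma weight_sum:
  assumes "q < S"
  shows "(\<Sum>e<K. weight r q e) = K"
proof -
  have "{..<d} = {..<m} \<union> {m..<d}" using pos by auto
  then have "V r q = (\<Sum>e<m. A r (gt q (min e m))) + (\<Sum>e\<in>{m..<d}. A r (gt q (min e m)))"
    unfolding V_def by (simp add: sum.union_disjoint ivl_disj_int)
  also have "\<dots> = (\<Sum>e<m. A r (gt q e)) + real (d - m) * A r (gt q m)" by simp
  finally have "(\<Sum>e<m. A r (gt q e)) + real (d - m) * A r (gt q m) = V r q" ..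
  moreover have "(\<Sum>e<K. weight r q e) =
      ((\<Sum>e<m. A r (gt q e)) + real (d - m) * A r (gt q m)) * K / V r q"
    by (simp add: weight_eq sum_distrib_right sum_divide_distrib add_divide_distrib distrib_right
        del: of_nat_Suc)
  ultimately show ?thesis using V_pos[OF assms, of r] by simp
qed

abbreviation "keep r q \<equiv> alias_keep K (weight r q)"
abbreviation "other r q \<equiv> alias_other K (weight r q)"

text \<open>The value 0 is taken for a draw equal to 1, or if the group of unused letters, which then
  has weight 0, is empty.\<close>

definition pick :: "nat \<Rightarrow> nat \<Rightarrow> real \<Rightarrow> real \<Rightarrow> real \<Rightarrow> nat" where
  "pick r q u v w =
     (let j = (if nat \<lfloor>u * K\<rfloor> < K then nat \<lfloor>u * K\<rfloor> else 0);
          c = (if v < keep r q j then j else other r q j);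
          l = (if m + nat \<lfloor>w * real (d - m)\<rfloor> < d then m + nat \<lfloor>w * real (d - m)\<rfloor> else 0)
      in if c < m then c else l)"

primrec state_at :: "(nat \<Rightarrow> real) \<Rightarrow> nat \<Rightarrow> nat" where
  "state_at \<eta> 0 = 0"
| "state_at \<eta> (Suc i) = gt (state_at \<eta> i)
     (min (pick (n - i) (state_at \<eta> i) (\<eta> (3 * i)) (\<eta> (3 * i + 1)) (\<eta> (3 * i + 2))) m)"

definition letter_at :: "(nat \<Rightarrow> real) \<Rightarrow> nat \<Rightarrow> nat" where
  "letter_at \<eta> i = pick (n - i) (state_at \<eta> i) (\<eta> (3 * i)) (\<eta> (3 * i + 1)) (\<eta> (3 * i + 2))"

lemma state_at_Suc: "state_at \<eta> (Suc i) = gt (state_at \<eta> i) (min (letter_at \<eta> i) m)"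
  by (simp add: letter_at_def)

lemma state_at_less: "state_at \<eta> i < S"
  by (induction i) (auto simp: gt_less pos)

lemma pick_less: "pick r q u v w < d"
  using pos by (auto simp: pick_def Let_def)

section \<open>Correctness of the message computation\<close>

definition static :: "state \<Rightarrow> bool" where
  "static s \<longleftrightarrow> nmem s 1 = N1 \<and> nmem s 2 = N2 \<and> rmem s 0 = R0"

text \<open>Level \<open>r\<close> reads \<open>A r\<close> and writes \<open>V r\<close> and
  \<open>A (Suc r)\<close>; hence the bound is inclusive for \<open>A\<close> and strict for
  \<open>V\<close>.\<close>

definition messages_upto :: "nat \<Rightarrow> state \<Rightarrow> bool" where
  "messages_upto r s \<longleftrightarrow> (\<forall>r'\<le>r. \<forall>q<S. rmem s 1 (r' * S + q) = A r' q) \<and>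
     (\<forall>r'<r. \<forall>q<S. rmem s 2 (r' * S + q) = V r' q)"

lemma row_less: "r' < r \<Longrightarrow> q < S \<Longrightarrow> r' * S + q < r * S"
proof -
  assume "r' < r" "q < S"
  then have "r' * S + q < Suc r' * S" by simp
  also have "\<dots> \<le> r * S" using \<open>r' < r\<close> by (intro mult_le_mono1) simp
  finally show ?thesis .
qed

lemmas upd_simps = nupd_def rupd_def static_def N1 sizes

text \<open>The message of a state needs the complete sum over its children, so the differences are
  accumulated at the parents in a separate pass. The last pass goes upwards and finds the value of
  the smaller failure state already stored.\<close>

lemma level_correct:
  assumes s: "static s" "nmem s 3 0 = r" "r \<le> n" "messages_upto r s"
  shows "terminates B \<omega> level s (1000 * S) (\<lambda>s'. static s' \<and> nmem s' 3 0 = r \<and>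
    messages_upto (Suc r) s')"
proof -
  define I0 where "I0 s' \<longleftrightarrow> static s' \<and> nmem s' 3 0 = r" for s'
  define D where "D j x = (\<Sum>p | 0 < p \<and> p < j \<and> par p = x. A r p - A r (fl p))" for j x
  have 1: "terminates B \<omega> (For 4 num_states (RSet 4 (scalar 4) (OfNat (Num 0)))) s (40 * S)
      (\<lambda>s'. I0 s' \<and> rmem s' 1 = rmem s 1 \<and> rmem s' 2 = rmem s 2 \<and> (\<forall>x<S. rmem s' 4 x = 0))"
    apply (rule terminates_weaken)
      apply (rule terminates_For[where N = S and t = 5 and I = "\<lambda>j s'. I0 s' \<and> rmem s' 1 = rmem s 1 \<and>
        rmem s' 2 = rmem s 2 \<and> (\<forall>x<j. rmem s' 4 x = 0)"])
    using s pos apply (auto simp: I0_def upd_simps less_Suc_eq intro!: terminates_straight)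
    done
  have 2: "terminates B \<omega> (For 4 num_states add_differences) s1 (200 * S)
      (\<lambda>s'. I0 s' \<and> rmem s' 1 = rmem s 1 \<and> rmem s' 2 = rmem s 2 \<and> (\<forall>x<S. rmem s' 4 x = D S x))"
    if s1: "I0 s1 \<and> rmem s1 1 = rmem s 1 \<and> rmem s1 2 = rmem s 2 \<and> (\<forall>x<S. rmem s1 4 x = 0)" for s1
  proof (rule terminates_weaken, rule terminates_For[where N = S and t = "straight_cost add_differences"
      and I = "\<lambda>j s'. I0 s' \<and> rmem s' 1 = rmem s 1 \<and>
        rmem s' 2 = rmem s 2 \<and> (\<forall>x<S. rmem s' 4 x = D j x)"])
    fix j s' assume j: "j < S" and I: "I0 s' \<and> rmem s' 1 = rmem s 1 \<and>
        rmem s' 2 = rmem s 2 \<and> (\<forall>x<S. rmem s' 4 x = D j x)" and v: "nmem s' 4 0 = j"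
    have D: "D (Suc j) x = D j x + (if 0 < j \<and> par j = x then A r j - A r (fl j) else 0)" for x
    proof (cases "0 < j \<and> par j = x")
      case True
      have "{p. 0 < p \<and> p < Suc j \<and> par p = x} = insert j {p. 0 < p \<and> p < j \<and> par p = x}"
        using True by auto
      then show ?thesis unfolding D_def using True by simp
    next
      case False
      then have "{p. 0 < p \<and> p < Suc j \<and> par p = x} = {p. 0 < p \<and> p < j \<and> par p = x}"
        by (auto simp: less_Suc_eq)
      then show ?thesis unfolding D_def using False by auto
    qed
    have AA: "rmem s 1 (r * S + q) = A r q" if "q < S" for q
      using s(4) that by (simp add: messages_upto_def)
    show "terminates B \<omega> add_differences s' (straight_cost add_differences)
      (\<lambda>s'. nmem s' 4 0 = j \<and> I0 (nupd 4 0 (Suc j) s') \<and> rmem (nupd 4 0 (Suc j) s') 1 = rmem s 1 \<and>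
        rmem (nupd 4 0 (Suc j) s') 2 = rmem s 2 \<and>
        (\<forall>x<S. rmem (nupd 4 0 (Suc j) s') 4 x = D (Suc j) x))"
      apply (rule terminates_straight)
        apply (simp add: add_differences_def)
       apply simp
      using I j v s fl_less[of j] AA[of j] AA[of "fl j"]
      apply (auto simp: add_differences_def I0_def upd_simps fl par par_less D)
      done
  qed (use s1 s pos in \<open>auto simp: I0_def upd_simps add_differences_def D_def\<close>)
  have 3: "terminates B \<omega> (For 4 num_states set_message) s1 (400 * S)
      (\<lambda>s'. static s' \<and> nmem s' 3 0 = r \<and> messages_upto (Suc r) s')"
    if s1: "I0 s1 \<and> rmem s1 1 = rmem s 1 \<and> rmem s1 2 = rmem s 2 \<and> (\<forall>x<S. rmem s1 4 x = D S x)" for s1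
  proof (rule terminates_weaken, rule terminates_For[where N = S and t = "straight_cost set_message"
      and I = "\<lambda>j s'. I0 s' \<and> (\<forall>a<Suc r * S. rmem s' 1 a = rmem s 1 a) \<and>
        (\<forall>a<r * S. rmem s' 2 a = rmem s 2 a) \<and> (\<forall>x<S. rmem s' 4 x = D S x) \<and>
        (\<forall>q<j. rmem s' 2 (r * S + q) = V r q \<and> rmem s' 3 q = cst (n - r) q \<and>
               rmem s' 1 (Suc r * S + q) = A (Suc r) q)"])
    fix j s' assume j: "j < S" and I: "I0 s' \<and> (\<forall>a<Suc r * S. rmem s' 1 a = rmem s 1 a) \<and>
        (\<forall>a<r * S. rmem s' 2 a = rmem s 2 a) \<and> (\<forall>x<S. rmem s' 4 x = D S x) \<and>
        (\<forall>q<j. rmem s' 2 (r * S + q) = V r q \<and> rmem s' 3 q = cst (n - r) q \<and>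
               rmem s' 1 (Suc r * S + q) = A (Suc r) q)" and v: "nmem s' 4 0 = j"
    have A0: "rmem s' 1 (r * S) = A r 0"
      using s(4) I pos unfolding messages_upto_def by (metis add.right_neutral le_refl lessI row_less)
    have V0: "V r 0 = real d * A r 0 + D S 0"
      using root[of "A r"] by (simp add: V_def D_def)
    have Vj: "V r j = V r (fl j) + D S j" if "0 < j"
      using trans[of j "A r"] that j by (simp add: V_def D_def)
    show "terminates B \<omega> set_message s' (straight_cost set_message)
      (\<lambda>s'. nmem s' 4 0 = j \<and> I0 (nupd 4 0 (Suc j) s') \<and>
        (\<forall>a<Suc r * S. rmem (nupd 4 0 (Suc j) s') 1 a = rmem s 1 a) \<and>
        (\<forall>a<r * S. rmem (nupd 4 0 (Suc j) s') 2 a = rmem s 2 a) \<and>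
        (\<forall>x<S. rmem (nupd 4 0 (Suc j) s') 4 x = D S x) \<and>
        (\<forall>q<Suc j. rmem (nupd 4 0 (Suc j) s') 2 (r * S + q) = V r q \<and>
               rmem (nupd 4 0 (Suc j) s') 3 q = cst (n - r) q \<and>
               rmem (nupd 4 0 (Suc j) s') 1 (Suc r * S + q) = A (Suc r) q))"
    proof (rule terminates_straight)
      show "straight set_message" by (simp add: set_message_def)
      show "nmem (straight_result B \<omega> set_message s') 4 0 = j \<and>
        I0 (nupd 4 0 (Suc j) (straight_result B \<omega> set_message s')) \<and>
        (\<forall>a<Suc r * S. rmem (nupd 4 0 (Suc j) (straight_result B \<omega> set_message s')) 1 a = rmem s 1 a) \<and>
        (\<forall>a<r * S. rmem (nupd 4 0 (Suc j) (straight_result B \<omega> set_message s')) 2 a = rmem s 2 a) \<and>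
        (\<forall>x<S. rmem (nupd 4 0 (Suc j) (straight_result B \<omega> set_message s')) 4 x = D S x) \<and>
        (\<forall>q<Suc j. rmem (nupd 4 0 (Suc j) (straight_result B \<omega> set_message s')) 2 (r * S + q) = V r q \<and>
               rmem (nupd 4 0 (Suc j) (straight_result B \<omega> set_message s')) 3 q = cst (n - r) q \<and>
               rmem (nupd 4 0 (Suc j) (straight_result B \<omega> set_message s')) 1 (Suc r * S + q) = A (Suc r) q)"
      proof (cases "0 < j")
        case True
        then have f: "fl j < j" "look N2 (Suc 0) j = fl j" using fl fl_less j by auto
        have c: "cst (n - r) j = cst (n - r) (fl j) + real (Suc 0 - (Suc 0 - look N2 3 j)) *
            R0 ((look N2 3 j - Suc 0) * n + (n - r - look N2 4 j))"
          using cst_rec[of "n - r" j] True j by simp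
        show ?thesis
          using True I v f j c Vj[OF True]
          by (auto simp: set_message_def I0_def upd_simps less_Suc_eq A_Suc simp del: A.simps)
      next
        case False
        then show ?thesis
          using I v j A0 V0
          by (auto simp: set_message_def I0_def upd_simps less_Suc_eq A_Suc cst_0 simp del: A.simps)
      qed
    qed simp
  next
    fix s' assume I: "I0 s' \<and> (\<forall>a<Suc r * S. rmem s' 1 a = rmem s 1 a) \<and>
        (\<forall>a<r * S. rmem s' 2 a = rmem s 2 a) \<and> (\<forall>x<S. rmem s' 4 x = D S x) \<and>
        (\<forall>q<S. rmem s' 2 (r * S + q) = V r q \<and> rmem s' 3 q = cst (n - r) q \<and>
               rmem s' 1 (Suc r * S + q) = A (Suc r) q)"
    \<comment> \<open>Earlier rows survive because the pass writes array 1 only in row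
      \<open>Suc r\<close> and array 2 only in row \<open>r\<close>.\<close>
    have "rmem s' 1 (r' * S + q) = A r' q" if "r' \<le> Suc r" "q < S" for r' q
    proof (cases "r' = Suc r")
      case False
      then have "r' * S + q < Suc r * S" using that by (intro row_less) auto
      then show ?thesis using I that False s(4) by (auto simp: messages_upto_def)
    qed (use I that in auto)
    moreover have "rmem s' 2 (r' * S + q) = V r' q" if "r' < Suc r" "q < S" for r' q
    proof (cases "r' = r")
      case False
      then have "r' * S + q < r * S" using that by (intro row_less) auto
      then show ?thesis using I that False s(4) by (auto simp: messages_upto_def)
    qed (use I that in auto)
    ultimately show "static s' \<and> nmem s' 3 0 = r \<and> messages_upto (Suc r) s'"
      using I by (auto simp: I0_def messages_upto_def)
  qed (use s1 s pos in \<open>auto simp: I0_def upd_simps set_message_def\<close>)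
  show ?thesis
    unfolding level_def
    by (rule terminates_weaken, rule terminates_Seq[OF 1 terminates_Seq[OF 2 3]]) auto
qed

lemma messages_correct:
  assumes "static s"
  shows "terminates B \<omega> messages s (4000 * (n * S))
    (\<lambda>s'. static s' \<and> messages_upto (Suc n) s' \<and> unwritten messages s s')"
proof (rule terminates_unwritten[THEN terminates_weaken])
  have 1: "terminates B \<omega> (For 4 num_states (RSet 1 (scalar 4) (OfNat (Num 1)))) s (40 * S)
      (\<lambda>s'. static s' \<and> (\<forall>q<S. rmem s' 1 q = 1))"
    apply (rule terminates_weaken)
      apply (rule terminates_For[where N = S and t = 5 and I = "\<lambda>j s'. static s' \<and> (\<forall>x<j. rmem s' 1 x = 1)"])
    using assms pos apply (auto simp: upd_simps less_Suc_eq intro!: terminates_straight)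
    done
  have 2: "terminates B \<omega> (For 3 (NAdd var_n (Num 1)) level) s1 (3000 * (n * S))
      (\<lambda>s'. static s' \<and> messages_upto (Suc n) s')"
    if s1: "static s1 \<and> (\<forall>q<S. rmem s1 1 q = 1)" for s1
  proof (rule terminates_weaken[where Q = "\<lambda>s'. static s' \<and> messages_upto (Suc n) s'"],
      rule terminates_For[where N = "Suc n" and t = "1000 * S"
      and I = "\<lambda>r s'. static s' \<and> messages_upto r s'"])
    fix j s' assume "j < Suc n" "static s' \<and> messages_upto j s'" "nmem s' 3 0 = j"
    then show "terminates B \<omega> level s' (1000 * S) (\<lambda>s'. nmem s' 3 0 = j \<and>
      static (nupd 3 0 (Suc j) s') \<and> messages_upto (Suc j) (nupd 3 0 (Suc j) s'))"
      by (intro terminates_weaken[OF level_correct]) (auto simp: upd_simps messages_upto_def)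
  next
    have "n \<le> n * S" "S \<le> n * S" "0 < n * S" using pos by auto
    moreover have "Suc n * (1000 * S + ncost (NAdd var_n (Num 1)) + 10) + (ncost (NAdd var_n (Num 1)) + 10)
      = 1000 * (n * S) + 14 * n + 1000 * S + 28" by (simp add: algebra_simps)
    ultimately show "Suc n * (1000 * S + ncost (NAdd var_n (Num 1)) + 10) +
      (ncost (NAdd var_n (Num 1)) + 10) \<le> 3000 * (n * S)" by linarith
  qed (use s1 in \<open>auto simp: upd_simps messages_upto_def\<close>)
  show "terminates B \<omega> messages s (40 * S + 3000 * (n * S)) (\<lambda>s'. static s' \<and> messages_upto (Suc n) s')"
    unfolding messages_def by (rule terminates_Seq[OF 1 2])
  show "40 * S + 3000 * (n * S) \<le> 4000 * (n * S)" using pos by simp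
qed auto

section \<open>Alias tables in memory\<close>

definition table_at :: "nat \<Rightarrow> state \<Rightarrow> bool" where
  "table_at \<rho> s \<longleftrightarrow> (\<forall>e<K. rmem s 5 (\<rho> * K + e) = keep (\<rho> div S) (\<rho> mod S) e \<and>
     nmem s 6 (\<rho> * K + e) = other (\<rho> div S) (\<rho> mod S) e)"

text \<open>\<open>j\<close> counts the columns already written: it grows during the classification
  and is \<open>K\<close> during the pairing. List heads are stack tops, so the arrays hold the
  reversed lists.\<close>

definition holds_alias :: "nat \<Rightarrow> state \<Rightarrow> alias_state \<Rightarrow> nat \<Rightarrow> bool" where
  "holds_alias base s st j \<longleftrightarrow> (case st of (sm, lg, b, al) \<Rightarrow>
     nmem s 9 0 = length sm \<and> nmem s 10 0 = length lg \<and>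
     (\<forall>i<length sm. nmem s 7 i = rev sm ! i) \<and> (\<forall>i<length lg. nmem s 8 i = rev lg ! i) \<and>
     (\<forall>e<j. rmem s 5 (base + e) = b e \<and> nmem s 6 (base + e) = al e))"

text \<open>The postcondition also protects all addresses below the table, because the preprocessing
  builds the tables in increasing order and must keep the finished ones.\<close>

lemma build_alias_correct:
  assumes s: "static s" "nmem s 3 0 = r" "nmem s 4 0 = q" "q < S" "r \<le> n" "messages_upto (Suc n) s"
  shows "terminates B \<omega> build_alias s (1000 * K)
    (\<lambda>s'. table_at (r * S + q) s' \<and>
      (\<forall>a<(r * S + q) * K. rmem s' 5 a = rmem s 5 a \<and> nmem s' 6 a = nmem s 6 a) \<and>
      unwritten build_alias s s')"
proof -
  define base where "base = (r * S + q) * K"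
  define w where "w = weight r q"
  define F where "F s' \<longleftrightarrow> static s' \<and> nmem s' 3 0 = r \<and> nmem s' 4 0 = q \<and> nmem s' 11 0 = base \<and>
    rmem s' 1 = rmem s 1 \<and> rmem s' 2 = rmem s 2 \<and>
    (\<forall>a<base. rmem s' 5 a = rmem s 5 a \<and> nmem s' 6 a = nmem s 6 a)" for s'
  \<comment> \<open>The form of \<open>alias_init\<close> after the first \<open>j\<close> columns
    have been classified; for \<open>j = K\<close> it is \<open>st 0\<close>.\<close>
  define init where "init j = (rev (filter (\<lambda>e. w e < 1) [0..<j]),
    rev (filter (\<lambda>e. \<not> w e < 1) [0..<j]), w, id :: nat \<Rightarrow> nat)" for j
  define st where "st i = (alias_step ^^ i) (alias_init K w)" for i
  have inv: "alias_inv K w (st i)" for i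
  proof (induction i)
    case 0
    then show ?case
      unfolding st_def funpow_0 w_def
      by (rule alias_inv_init) (use weight_nonneg weight_sum s in auto)
  next
    case (Suc i)
    then show ?case using alias_inv_step by (simp add: st_def)
  qed
  have 0: "terminates B \<omega> (set_offset ;; NSet 9 (Num 0) (Num 0) ;; NSet 10 (Num 0) (Num 0)) s 50
     (\<lambda>s'. F s' \<and> holds_alias base s' (init 0) 0)"
    using s by (intro terminates_straight)
      (auto simp: set_offset_def F_def upd_simps base_def holds_alias_def init_def)
  have 1: "terminates B \<omega> (For 5 num_outcomes classify) s1 (200 * K)
     (\<lambda>s'. F s' \<and> holds_alias base s' (st 0) K)"
    if s1: "F s1 \<and> holds_alias base s1 (init 0) 0" for s1
  proof (rule terminates_weaken, rule terminates_For[where N = K and t = "straight_cost classify"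
      and I = "\<lambda>j s'. F s' \<and> holds_alias base s' (init j) j"])
    fix j s' assume j: "j < K" and I: "F s' \<and> holds_alias base s' (init j) j" and v: "nmem s' 5 0 = j"
    define x where "x = real (Suc 0 - (Suc j - m) + (Suc j - m) * (d - m)) *
      rmem s 1 (r * S + gt q j) * (1 + real m) / rmem s 2 (r * S + q)"
    have x: "x = w j"
      using s gt_less[OF s(4)] j by (simp add: w_def weight_def messages_upto_def x_def)
    have g: "look N2 5 (q * Suc m + j) = gt q j" "look N2 5 (q + q * m + j) = gt q j"
      using gt[of q j] s j by auto
    define s2 where "s2 = nupd 6 (base + j) j (rupd 5 (base + j) (w j) s')"
    have res: "straight_result B \<omega> classify s' =
      (if w j < 1 then nupd 9 0 (Suc (nmem s' 9 0)) (nupd 7 (nmem s' 9 0) j s2)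
       else nupd 10 0 (Suc (nmem s' 10 0)) (nupd 8 (nmem s' 10 0) j s2))"
      using I v x g unfolding s2_def
      by (simp add: classify_def F_def upd_simps x_def)
    show "terminates B \<omega> classify s' (straight_cost classify)
      (\<lambda>s'. nmem s' 5 0 = j \<and> F (nupd 5 0 (Suc j) s') \<and>
         holds_alias base (nupd 5 0 (Suc j) s') (init (Suc j)) (Suc j))"
    proof (rule terminates_straight)
      show "straight classify" by (simp add: classify_def)
      show "nmem (straight_result B \<omega> classify s') 5 0 = j \<and>
        F (nupd 5 0 (Suc j) (straight_result B \<omega> classify s')) \<and>
        holds_alias base (nupd 5 0 (Suc j) (straight_result B \<omega> classify s')) (init (Suc j)) (Suc j)"
        unfolding res using I v
        by (auto simp: s2_def F_def upd_simps holds_alias_def init_def less_Suc_eq nth_append)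
    qed simp
  qed (use s1 s pos in \<open>auto simp: F_def upd_simps classify_def holds_alias_def init_def st_def
        alias_init_def\<close>)
  have 2: "terminates B \<omega> (For 5 num_outcomes pair_columns) s1 (200 * K)
     (\<lambda>s'. F s' \<and> holds_alias base s' (st K) K)"
    if s1: "F s1 \<and> holds_alias base s1 (st 0) K" for s1
  proof (rule terminates_weaken, rule terminates_For[where N = K and t = "straight_cost pair_columns"
      and I = "\<lambda>i s'. F s' \<and> holds_alias base s' (st i) K"])
    fix j s' assume j: "j < K" and I: "F s' \<and> holds_alias base s' (st j) K" and v: "nmem s' 5 0 = j"
    have st: "st (Suc j) = alias_step (st j)" by (simp add: st_def)
    show "terminates B \<omega> pair_columns s' (straight_cost pair_columns)
      (\<lambda>s'. nmem s' 5 0 = j \<and> F (nupd 5 0 (Suc j) s') \<and>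
         holds_alias base (nupd 5 0 (Suc j) s') (st (Suc j)) K)"
    proof (rule terminates_straight)
      show "straight pair_columns" by (simp add: pair_columns_def)
      show "nmem (straight_result B \<omega> pair_columns s') 5 0 = j \<and>
        F (nupd 5 0 (Suc j) (straight_result B \<omega> pair_columns s')) \<and>
        holds_alias base (nupd 5 0 (Suc j) (straight_result B \<omega> pair_columns s')) (st (Suc j)) K"
      proof (cases "st j" rule: alias_step.cases)
        case (1 x sm l lg b al)
        \<comment> \<open>Distinctness of the stacks gives \<open>x \<noteq> l\<close>, so the new
          amount of \<open>l\<close> leaves the amount of \<open>x\<close> intact.\<close>
        have d: "x < K" "l < K" "x \<noteq> l" using inv[of j] unfolding 1 by auto
        have m: "nmem s' 9 0 = Suc (length sm)" "nmem s' 10 0 = Suc (length lg)"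
          "nmem s' 7 (length sm) = x" "nmem s' 8 (length lg) = l"
          "\<forall>i<length sm. nmem s' 7 i = rev sm ! i" "\<forall>i<length lg. nmem s' 8 i = rev lg ! i"
          "\<forall>e<K. rmem s' 5 (base + e) = b e \<and> nmem s' 6 (base + e) = al e"
          using I unfolding 1 by (auto simp: holds_alias_def nth_append less_Suc_eq all_conj_distrib)
        define y where "y = b l - (1 - b x)"
        define s2 where "s2 = rupd 5 (base + l) y (nupd 6 (base + x) l (nupd 15 0 l (nupd 12 0 x
          (nupd 9 0 (length sm) s'))))"
        have res: "straight_result B \<omega> pair_columns s' =
          (if y < 1 then nupd 9 0 (Suc (length sm)) (nupd 7 (length sm) l (nupd 10 0 (length lg) s2))
           else s2)"
          using I v m d unfolding s2_def y_def
          by (simp add: pair_columns_def F_def upd_simps)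
        show ?thesis
        proof (cases "y < 1")
          case True
          have "st (Suc j) = (l # sm, lg, b(l := y), al(x := l))"
            unfolding st 1 using True by (simp add: y_def Let_def)
          then show ?thesis
            unfolding res using I v m d True
            by (auto simp: s2_def F_def upd_simps holds_alias_def less_Suc_eq nth_append)
        next
          case False
          have "st (Suc j) = (sm, l # lg, b(l := y), al(x := l))"
            unfolding st 1 using False by (simp add: y_def Let_def)
          then show ?thesis
            unfolding res using I v m d False
            by (auto simp: s2_def F_def upd_simps holds_alias_def less_Suc_eq nth_append)
        qed
      qed (use I v st in \<open>auto simp: pair_columns_def F_def upd_simps holds_alias_def\<close>)
    qed simp
  qed (use s1 s pos in \<open>auto simp: F_def upd_simps pair_columns_def holds_alias_def\<close>)
  have q: "(r * S + q) div S = r" "(r * S + q) mod S = q" using s(4) by simp_all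
  have stK: "st K = alias_run K w" by (simp add: st_def alias_run_def)
  have "terminates B \<omega> build_alias s (1000 * K) (\<lambda>s'. F s' \<and> holds_alias base s' (st K) K)"
    unfolding build_alias_def
    by (rule terminates_weaken, rule terminates_Seq[OF 0 terminates_Seq[OF 1 2]]) auto
  from terminates_unwritten[OF this] show ?thesis
  proof (rule terminates_weaken)
    fix s' assume s': "(F s' \<and> holds_alias base s' (st K) K) \<and> unwritten build_alias s s'"
    then have "\<forall>e<K. rmem s' 5 (base + e) = alias_keep K w e \<and> nmem s' 6 (base + e) = alias_other K w e"
      by (auto simp: holds_alias_def stK alias_keep_def alias_other_def split: prod.splits)
    then have "table_at (r * S + q) s'" by (simp only: table_at_def q base_def w_def)
    then show "table_at (r * S + q) s' \<and>
      (\<forall>a<(r * S + q) * K. rmem s' 5 a = rmem s 5 a \<and> nmem s' 6 a = nmem s 6 a) \<and>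
      unwritten build_alias s s'"
      using s' by (auto simp: F_def base_def)
  qed simp
qed

section \<open>One letter and one complete run\<close>

lemma step_correct:
  assumes s: "static s" "nmem s 3 0 = r" "nmem s 4 0 = q" "nmem s 14 0 = i" "q < S"
    "table_at (r * S + q) s" and \<omega>: "\<And>j. \<omega> j \<in> {0..1}"
    and l: "l = pick r q (\<omega> (drawn s)) (\<omega> (drawn s + 1)) (\<omega> (drawn s + 2))"
  shows "terminates B \<omega> step s 1000
    (\<lambda>s'. nmem s' 4 0 = gt q (min l m) \<and> nmem s' 0 = (nmem s 0)(i := pm l) \<and>
      drawn s' = drawn s + 3 \<and> unwritten step s s')"
proof -
  define base where "base = (r * S + q) * K"
  define u v w where "u = \<omega> (drawn s)" and "v = \<omega> (drawn s + 1)" and "w = \<omega> (drawn s + 2)"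
  \<comment> \<open>A draw is at most 1, so the index is at most \<open>k \<le> B\<close> and the
    cap on \<open>Floor\<close> never takes effect.\<close>
  have floor: "min B (nat \<lfloor>x * real k\<rfloor>) = nat \<lfloor>x * real k\<rfloor>" if "x \<in> {0..1}" "k \<le> B" for x k
  proof -
    have "x * real k \<le> real k" using that by (simp add: mult_left_le_one_le)
    then show ?thesis using that by linarith
  qed
  have fu: "min B (nat \<lfloor>u * (1 + real m)\<rfloor>) = nat \<lfloor>u * (1 + real m)\<rfloor>"
    using floor[of u K] \<omega> pos by (simp add: u_def)
  have fw: "min B (nat \<lfloor>w * real (d - m)\<rfloor>) = nat \<lfloor>w * real (d - m)\<rfloor>"
    using floor[of w "d - m"] \<omega> pos by (simp add: w_def)
  define j where "j = (if nat \<lfloor>u * (1 + real m)\<rfloor> < K then nat \<lfloor>u * (1 + real m)\<rfloor> else 0)"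
  define c where "c = (if v < keep r q j then j else other r q j)"
  define l' where "l' = (if m + nat \<lfloor>w * real (d - m)\<rfloor> < d then m + nat \<lfloor>w * real (d - m)\<rfloor> else 0)"
  have l: "l = (if c < m then c else l')"
    unfolding l pick_def Let_def c_def j_def l'_def u_def v_def w_def by (simp del: of_nat_diff)
  have "j < K" by (simp add: j_def)
  moreover have "(r * S + q) div S = r" "(r * S + q) mod S = q" using s(5) by simp_all
  ultimately have t: "rmem s 5 (base + j) = keep r q j" "nmem s 6 (base + j) = other r q j"
    using s(6) by (simp_all add: table_at_def base_def)
  have gt': "look N2 5 (q * K + min l m) = gt q (min l m)" using gt[of q "min l m"] s by simp
  have min: "l - (l - m) = min l m" by auto
  have pm': "l + look N2 6 l - look N2 7 l = pm l" by (intro pm) (simp add: assms pick_less)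
  define R where "R = straight_result B \<omega> step s"
  have st: "straight step" "straight_cost step \<le> 1000" by (auto simp: step_def set_offset_def)
  \<comment> \<open>The program is executed in four segments with named intermediate states, which
    keeps the terms manageable for the simplifier.\<close>
  define s1 where "s1 = nupd 13 0 j (nupd 13 0 (nat \<lfloor>u * (1 + real m)\<rfloor>) (rupd 6 2 w (rupd 6 1 v (rupd 6 0 u
      (nupd 11 0 base s)))))\<lparr>drawn := drawn s + 3\<rparr>"
  define s2 where "s2 = nupd 12 0 l' (nupd 12 0 (m + nat \<lfloor>w * real (d - m)\<rfloor>) (nupd 13 0 c s1))"
  have R1: "straight_result B \<omega>
     (set_offset ;;
    Draw 6 (Num 0) ;; Draw 6 (Num 1) ;; Draw 6 (Num 2) ;;
    NSet 13 (Num 0) (Floor (RMul (RGet 6 (Num 0)) (OfNat num_outcomes))) ;;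
    set_unless (NLess (scalar 13) num_outcomes) 13 (Num 0)) s = s1"
    using s fu by (simp add: s1_def set_offset_def upd_simps base_def u_def v_def w_def j_def
      numeral_3_eq_3 numeral_2_eq_2)
  have R2: "straight_result B \<omega>
     (set_unless (RLess (RGet 6 (Num 1)) (RGet 5 (NAdd (scalar 11) (scalar 13)))) 13
      (NGet 6 (NAdd (scalar 11) (scalar 13))) ;;
    NSet 12 (Num 0) (NAdd num_used (Floor (RMul (RGet 6 (Num 2)) (OfNat (NSub var_d num_used))))) ;;
    set_unless (NLess (scalar 12) var_d) 12 (Num 0)) s1 = s2"
    using s(1) t fw by (simp add: s1_def s2_def upd_simps c_def l'_def numeral_2_eq_2 del: of_nat_diff)
  define s3 where "s3 = nupd 13 0 l s2"
  have R3: "straight_result B \<omega> (set_unless (NLess (scalar 13) num_used) 13 (scalar 12)) s2 = s3"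
  proof -
    have "nmem s2 13 0 = c" "nmem s2 12 0 = l'" "nmem s2 2 = N2"
      using s(1) by (simp_all add: s2_def s1_def nupd_def rupd_def static_def)
    then show ?thesis unfolding s3_def l by (simp add: sizes)
  qed
  have q': "q + q * m + l - (l - m) = q * K + min l m" by (simp add: min_def)
  have R4: "straight_result B \<omega>
    (NSet 4 (Num 0) (goto (scalar 4) (NSub (scalar 13) (NSub (scalar 13) num_used))) ;;
    NSet 0 (scalar 14) (NSub (NAdd (scalar 13) (tab 6 (scalar 13))) (tab 7 (scalar 13)))) s3
      = nupd 0 i (pm l) (nupd 4 0 (gt q (min l m)) s3)"
  proof -
    have "nmem s3 4 0 = q" "nmem s3 13 0 = l" "nmem s3 14 0 = i" "nmem s3 2 = N2"
      using s(1,3,4) by (simp_all add: s3_def s2_def s1_def nupd_def rupd_def static_def)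
    then have "nval B s3 (goto (scalar 4) (NSub (scalar 13) (NSub (scalar 13) num_used))) = gt q (min l m)"
      "nval B s3 (NSub (NAdd (scalar 13) (tab 6 (scalar 13))) (tab 7 (scalar 13))) = pm l"
      "nmem s3 14 0 = i" "nmem s3 13 0 = l" "nmem s3 2 = N2"
      using gt' min pm' q' by (simp_all add: sizes del: mult_Suc_right)
    then show ?thesis by (simp add: nupd_def)
  qed
  have R: "R = nupd 0 i (pm l) (nupd 4 0 (gt q (min l m)) s3)"
    unfolding R4[symmetric]
    unfolding R3[symmetric] R2[symmetric] R1[symmetric] R_def
    by (simp only: step_def straight_result.simps(5))
  show ?thesis
    by (intro terminates_weaken[OF terminates_unwritten[OF terminates_straight[OF st, where Q = "\<lambda>s'. s' = R"]]])
      (auto simp: R_def[symmetric], auto simp: R s3_def s2_def s1_def upd_simps)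
qed

text \<open>\<open>P\<close> stands for what later letters need from memory: the messages if tables
  are built on the way, all tables if they were built beforehand. \<open>P_cong\<close> lists the
  arrays on which it may depend, none of which \<open>step\<close> writes.\<close>

lemma sample_with_correct:
  assumes s: "static s" "P s" and \<omega>: "\<And>j. \<omega> j \<in> {0..1}"
    and P_cong: "\<And>s s'. P s \<Longrightarrow> nmem s' 6 = nmem s 6 \<Longrightarrow> rmem s' 1 = rmem s 1 \<Longrightarrow>
      rmem s' 2 = rmem s 2 \<Longrightarrow> rmem s' 5 = rmem s 5 \<Longrightarrow> P s'"
    and c: "\<And>s r q. static s \<Longrightarrow> P s \<Longrightarrow> nmem s 3 0 = r \<Longrightarrow> nmem s 4 0 = q \<Longrightarrow> q < S \<Longrightarrow> r \<le> n \<Longrightarrow>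
      terminates B \<omega> c s t (\<lambda>s'. P s' \<and> table_at (r * S + q) s')"
    and c_writes: "nat_writes c \<inter> {0, 1, 2, 3, 4, 14} = {}" "0 \<notin> real_writes c" "drawless c"
  shows "terminates B \<omega> (sample_with c) s (n * (t + 2000))
    (\<lambda>s'. static s' \<and> P s' \<and> drawn s' = drawn s + 3 * n \<and>
      (\<forall>i<n. nmem s' 0 i = pm (letter_at (\<lambda>j. \<omega> (drawn s + j)) i)))"
proof -
  define \<eta> where "\<eta> = (\<lambda>j. \<omega> (drawn s + j))"
  define I where "I i s' \<longleftrightarrow> static s' \<and> P s' \<and> nmem s' 4 0 = state_at \<eta> i \<and> drawn s' = drawn s + 3 * i \<and>
      (\<forall>j<i. nmem s' 0 j = pm (letter_at \<eta> j))" for i s'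
  have 1: "terminates B \<omega> (NSet 4 (Num 0) (Num 0)) s 10 (I 0)"
    using s by (intro terminates_straight) (auto simp: I_def upd_simps intro: P_cong)
  have 2: "terminates B \<omega> (For 14 var_n (NSet 3 (Num 0) (NSub var_n (scalar 14)) ;; c ;; step)) s1
      (n * (t + 1500) + 20) (I n)" if s1: "I 0 s1" for s1
  proof (rule terminates_weaken[where Q = "I n"], rule terminates_For[where N = n and t = "10 + (t + 1000)"
      and I = I])
    fix i s2 assume i: "i < n" and I: "I i s2" and v: "nmem s2 14 0 = i"
    define q where "q = state_at \<eta> i"
    define G where "G s' \<longleftrightarrow> I i s' \<and> nmem s' 14 0 = i \<and> nmem s' 3 0 = n - i" for s'
    have q: "q < S" by (simp add: q_def state_at_less)
    have a: "terminates B \<omega> (NSet 3 (Num 0) (NSub var_n (scalar 14))) s2 10 G"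
      using I v by (intro terminates_straight) (auto simp: G_def I_def upd_simps intro: P_cong)
    have b: "terminates B \<omega> c s' t (\<lambda>s'. G s' \<and> table_at ((n - i) * S + q) s')" if "G s'" for s'
      by (rule terminates_weaken[OF terminates_unwritten[OF c[of s' "n - i" q]]])
        (use that q c_writes in \<open>auto simp: G_def I_def q_def static_def unwritten_def\<close>)
    have e: "terminates B \<omega> step s3 1000
      (\<lambda>s'. nmem s' 14 0 = i \<and> I (Suc i) (nupd 14 0 (Suc i) s'))"
      if s3: "G s3 \<and> table_at ((n - i) * S + q) s3" for s3
    proof -
      have l: "letter_at \<eta> i = pick (n - i) q (\<omega> (drawn s3)) (\<omega> (drawn s3 + 1)) (\<omega> (drawn s3 + 2))"
        using s3 by (simp add: letter_at_def G_def I_def \<eta>_def q_def add.assoc)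
      have st: "static s3" "nmem s3 3 0 = n - i" "nmem s3 4 0 = q" "nmem s3 14 0 = i"
        using s3 by (auto simp: G_def I_def q_def)
      show ?thesis
      proof (rule terminates_weaken[OF step_correct[OF st q _ \<omega> l]])
        show "table_at ((n - i) * S + q) s3" using s3 by simp
        fix s'
        assume s': "nmem s' 4 0 = gt q (min (letter_at \<eta> i) m) \<and>
          nmem s' 0 = (nmem s3 0)(i := pm (letter_at \<eta> i)) \<and>
          drawn s' = drawn s3 + 3 \<and> unwritten step s3 s'"
        then have u: "nmem s' 1 = nmem s3 1" "nmem s' 2 = nmem s3 2" "nmem s' 6 = nmem s3 6"
          "nmem s' 14 = nmem s3 14" "rmem s' 0 = rmem s3 0" "rmem s' 1 = rmem s3 1"
          "rmem s' 2 = rmem s3 2" "rmem s' 5 = rmem s3 5"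
          by (auto simp: unwritten_def step_def set_offset_def)
        have "P s3" using s3 by (simp add: G_def I_def)
        then have "P (nupd 14 0 (Suc i) s')" by (rule P_cong) (simp_all add: nupd_def u[simplified])
        then show "nmem s' 14 0 = i \<and> I (Suc i) (nupd 14 0 (Suc i) s')"
          using s' s3 u by (auto simp: I_def G_def static_def nupd_def state_at_Suc q_def less_Suc_eq
              simp del: state_at.simps)
      qed simp
    qed
    show "terminates B \<omega> (NSet 3 (Num 0) (NSub var_n (scalar 14)) ;; c ;; step) s2 (10 + (t + 1000))
      (\<lambda>s'. nmem s' 14 0 = i \<and> I (Suc i) (nupd 14 0 (Suc i) s'))"
      by (rule terminates_Seq[OF a terminates_Seq[OF b e]])
  next
    show "I 0 (nupd 14 0 0 s1)" using s1 by (auto simp: I_def upd_simps intro: P_cong)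
  qed (auto simp: I_def static_def N1 algebra_simps)
  show ?thesis
    unfolding sample_with_def
  proof (rule terminates_weaken[OF terminates_Seq[OF 1 2]])
    have "n * (t + 1500) + 500 * n = n * (t + 2000)" by (simp add: algebra_simps)
    then show "10 + (n * (t + 1500) + 20) \<le> n * (t + 2000)" using pos(1) by linarith
  qed (auto simp: I_def \<eta>_def)
qed

lemma nat_writes_build_alias: "nat_writes build_alias = {5, 6, 7, 8, 9, 10, 11, 12, 15}"
    "real_writes build_alias = {5}" "drawless build_alias"
  by (auto simp: build_alias_def set_offset_def classify_def pair_columns_def)

lemma messages_upto_cong:
  "messages_upto r s \<Longrightarrow> rmem s' 1 = rmem s 1 \<Longrightarrow> rmem s' 2 = rmem s 2 \<Longrightarrow> messages_upto r s'"
  by (simp add: messages_upto_def)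

lemma drawless_messages: "drawless messages"
  by (simp add: messages_def level_def add_differences_def set_message_def)

text \<open>Each run recomputes the messages, so only the input arrays have to survive from one run
  to the next.\<close>

lemma sample_direct_correct:
  assumes s: "static s" and \<omega>: "\<And>j. \<omega> j \<in> {0..1}"
  shows "terminates B \<omega> sample_direct s (4000 * (n * S) + n * (1000 * K + 2000))
    (\<lambda>s'. static s' \<and> drawn s' = drawn s + 3 * n \<and>
      (\<forall>i<n. nmem s' 0 i = pm (letter_at (\<lambda>j. \<omega> (drawn s + j)) i)))"
  unfolding sample_direct_def
proof (rule terminates_Seq[OF messages_correct[OF s]])
  fix s1 assume s1: "static s1 \<and> messages_upto (Suc n) s1 \<and> unwritten messages s s1"
  have d: "drawn s1 = drawn s" using s1 drawless_messages by (simp add: unwritten_def)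
  have "terminates B \<omega> (sample_with build_alias) s1 (n * (1000 * K + 2000))
    (\<lambda>s'. static s' \<and> messages_upto (Suc n) s' \<and> drawn s' = drawn s1 + 3 * n \<and>
      (\<forall>i<n. nmem s' 0 i = pm (letter_at (\<lambda>j. \<omega> (drawn s1 + j)) i)))"
  proof (rule sample_with_correct)
    fix s r q assume *: "static s" "messages_upto (Suc n) s" "nmem s 3 0 = r" "nmem s 4 0 = q" "q < S" "r \<le> n"
    show "terminates B \<omega> build_alias s (1000 * K)
      (\<lambda>s'. messages_upto (Suc n) s' \<and> table_at (r * S + q) s')"
      by (rule terminates_weaken[OF build_alias_correct[OF *(1,3,4,5,6,2)]])
        (use *(2) in \<open>auto simp: unwritten_def nat_writes_build_alias intro: messages_upto_cong\<close>)
  qed (use s1 \<omega> in \<open>auto simp: nat_writes_build_alias intro: messages_upto_cong\<close>)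
  then show "terminates B \<omega> (sample_with build_alias) s1 (n * (1000 * K + 2000))
    (\<lambda>s'. static s' \<and> drawn s' = drawn s + 3 * n \<and>
      (\<forall>i<n. nmem s' 0 i = pm (letter_at (\<lambda>j. \<omega> (drawn s + j)) i)))"
    by (rule terminates_weaken) (auto simp: d)
qed

section \<open>Preprocessing of all tables\<close>

definition prepared :: "state \<Rightarrow> bool" where
  "prepared s \<longleftrightarrow> (\<forall>\<rho> < Suc n * S. table_at \<rho> s)"

lemma table_at_cong:
  assumes "table_at \<rho> s" "\<rho> < \<rho>'" "\<And>a. a < \<rho>' * K \<Longrightarrow> rmem s' 5 a = rmem s 5 a \<and> nmem s' 6 a = nmem s 6 a"
  shows "table_at \<rho> s'"
proof -
  have "\<rho> * K + e < \<rho>' * K" if "e < K" for e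
  proof -
    have "\<rho> * K + e < Suc \<rho> * K" using that by simp
    also have "\<dots> \<le> \<rho>' * K" using assms(2) by (intro mult_le_mono1) simp
    finally show ?thesis .
  qed
  then show ?thesis using assms(1,3) by (simp add: table_at_def)
qed

text \<open>Finished cells are counted by the flat index \<open>r * S + q\<close>, so the end of row
  \<open>r\<close> is the start of row \<open>Suc r\<close> and both loops share the predicate
  \<open>G\<close>.\<close>

lemma preprocess_correct:
  assumes s: "static s"
  shows "terminates B \<omega> preprocess s (4000 * (n * S) + 5000 * (n * S * K))
    (\<lambda>s'. static s' \<and> prepared s' \<and> drawn s' = drawn s)"
  unfolding preprocess_def
proof (rule terminates_Seq[OF messages_correct[OF s]])
  fix s1 assume s1: "static s1 \<and> messages_upto (Suc n) s1 \<and> unwritten messages s s1"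
  define G where "G \<rho> s' \<longleftrightarrow> static s' \<and> messages_upto (Suc n) s' \<and> drawn s' = drawn s \<and>
    (\<forall>\<rho>' < \<rho>. table_at \<rho>' s')" for \<rho> s'
  have G_cong: "G \<rho> (nupd a 0 x s') \<longleftrightarrow> G \<rho> s'" if "a \<in> {3, 4}" for \<rho> a x s'
    using that by (auto simp: G_def static_def messages_upto_def table_at_def nupd_def)
  have inner: "terminates B \<omega> (For 4 num_states build_alias) s2 (S * (1000 * K + 20) + 20)
      (\<lambda>s'. nmem s' 3 0 = r \<and> G (Suc r * S) (nupd 3 0 (Suc r) s'))"
    if r: "r < Suc n" and s2: "G (r * S) s2" "nmem s2 3 0 = r" for r s2
  proof (rule terminates_weaken[where Q = "\<lambda>s'. nmem s' 3 0 = r \<and> G (r * S + S) s'"],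
      rule terminates_For[where N = S and t = "1000 * K"
      and I = "\<lambda>q s'. nmem s' 3 0 = r \<and> G (r * S + q) s'"])
    fix q s3 assume q: "q < S" and s3: "nmem s3 3 0 = r \<and> G (r * S + q) s3" "nmem s3 4 0 = q"
    have st: "static s3" "nmem s3 3 0 = r" "r \<le> n" "messages_upto (Suc n) s3"
      using s3 r by (auto simp: G_def)
    show "terminates B \<omega> build_alias s3 (1000 * K)
      (\<lambda>s'. nmem s' 4 0 = q \<and> nmem (nupd 4 0 (Suc q) s') 3 0 = r \<and>
         G (r * S + Suc q) (nupd 4 0 (Suc q) s'))"
    proof (rule terminates_weaken[OF build_alias_correct[OF st(1,2) s3(2) q st(3,4)]])
      fix s' assume s': "table_at (r * S + q) s' \<and>
        (\<forall>a<(r * S + q) * K. rmem s' 5 a = rmem s3 5 a \<and> nmem s' 6 a = nmem s3 6 a) \<and>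
        unwritten build_alias s3 s'"
      then have u: "nmem s' 1 = nmem s3 1" "nmem s' 2 = nmem s3 2" "nmem s' 3 = nmem s3 3"
          "nmem s' 4 = nmem s3 4" "rmem s' 0 = rmem s3 0" "rmem s' 1 = rmem s3 1"
          "rmem s' 2 = rmem s3 2" "drawn s' = drawn s3"
        by (auto simp: unwritten_def nat_writes_build_alias)
      have "table_at \<rho> s'" if "\<rho> < r * S + Suc q" for \<rho>
      proof (cases "\<rho> = r * S + q")
        case False
        then have "\<rho> < r * S + q" using that by simp
        then show ?thesis using s3(1) s' by (intro table_at_cong[of \<rho> s3 "r * S + q" s']) (simp_all add: G_def)
      qed (use s' in simp)
      moreover have "messages_upto (Suc n) s'" by (rule messages_upto_cong[OF st(4) u(6,7)])
      moreover have "static s'" using st(1) u by (simp only: static_def)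
      moreover have "drawn s' = drawn s" using s3(1) u by (simp add: G_def)
      ultimately have "G (r * S + Suc q) s'" unfolding G_def by blast
      then show "nmem s' 4 0 = q \<and> nmem (nupd 4 0 (Suc q) s') 3 0 = r \<and>
          G (r * S + Suc q) (nupd 4 0 (Suc q) s')"
        using u(3,4) s3(2) st(2) by (simp add: G_cong) (simp add: nupd_def)
    qed simp
  next
    fix s' assume "nmem s' 3 0 = r \<and> G (r * S + S) s'"
    then show "nmem s' 3 0 = r \<and> G (Suc r * S) (nupd 3 0 (Suc r) s')"
      by (simp add: G_cong add.commute)
  next
    show "nmem (nupd 4 0 0 s2) 3 0 = r \<and> G (r * S + 0) (nupd 4 0 0 s2)"
      using s2 by (simp add: G_cong) (simp add: nupd_def)
  next
    fix q s' assume "nmem s' 3 0 = r \<and> G (r * S + q) s'"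
    then show "nval B s' num_states = S" by (simp add: G_def static_def sizes)
  next
    show "S * (1000 * K + ncost num_states + 10) + (ncost num_states + 10) \<le> S * (1000 * K + 20) + 20"
      by (rule add_mono, rule mult_le_mono2) simp_all
  qed
  show "terminates B \<omega> (For 3 (NAdd var_n (Num 1)) (For 4 num_states build_alias)) s1
      (5000 * (n * S * K)) (\<lambda>s'. static s' \<and> prepared s' \<and> drawn s' = drawn s)"
  proof (rule terminates_weaken[where Q = "G (Suc n * S)"], rule terminates_For[where N = "Suc n" and
      t = "S * (1000 * K + 20) + 20" and I = "\<lambda>r. G (r * S)"])
    define x where "x = n * S * K"
    have nS: "n * S \<le> x" "S \<le> n * S" "n \<le> n * S" "0 < x"
      using pos by (simp_all add: x_def)
    moreover have "S \<le> x" "n \<le> x" using nS by linarith+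
    moreover have "S * K \<le> x" using pos(1) by (cases n) (simp_all add: x_def algebra_simps)
    moreover have "Suc n * (S * (1000 * K + 20) + 20 + ncost (NAdd var_n (Num 1)) + 10) +
        (ncost (NAdd var_n (Num 1)) + 10) = 1000 * x + 20 * (n * S) + 1000 * (S * K) + 20 * S + 34 * n + 48"
      by (simp add: x_def algebra_simps)
    ultimately show "Suc n * (S * (1000 * K + 20) + 20 + ncost (NAdd var_n (Num 1)) + 10) +
        (ncost (NAdd var_n (Num 1)) + 10) \<le> 5000 * (n * S * K)"
      unfolding x_def[symmetric] by linarith
  next
    show "G (0 * S) (nupd 3 0 0 s1)"
      using s1 drawless_messages by (subst G_cong) (auto simp: G_def unwritten_def)
  next
    fix r s2 assume "r < Suc n" "G (r * S) s2" "nmem s2 3 0 = r"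
    then show "terminates B \<omega> (For 4 num_states build_alias) s2 (S * (1000 * K + 20) + 20)
      (\<lambda>s'. nmem s' 3 0 = r \<and> G (Suc r * S) (nupd 3 0 (Suc r) s'))" by (rule inner)
  qed (auto simp: G_def static_def N1 prepared_def)
qed

lemma sample_prepared_correct:
  assumes s: "static s" "prepared s" and \<omega>: "\<And>j. \<omega> j \<in> {0..1}"
  shows "terminates B \<omega> sample_prepared s (n * 3000)
    (\<lambda>s'. static s' \<and> prepared s' \<and> drawn s' = drawn s + 3 * n \<and>
      (\<forall>i<n. nmem s' 0 i = pm (letter_at (\<lambda>j. \<omega> (drawn s + j)) i)))"
proof -
  have "terminates B \<omega> (sample_with Skip) s (n * (1 + 2000))
    (\<lambda>s'. static s' \<and> prepared s' \<and> drawn s' = drawn s + 3 * n \<and>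
      (\<forall>i<n. nmem s' 0 i = pm (letter_at (\<lambda>j. \<omega> (drawn s + j)) i)))"
  proof (rule sample_with_correct)
    fix s r q assume *: "prepared s" "q < S" "r \<le> n"
    have "r * S + q < Suc n * S" using * by (intro row_less) auto
    then show "terminates B \<omega> Skip s 1 (\<lambda>s'. prepared s' \<and> table_at (r * S + q) s')"
      using * by (intro terminates_straight) (auto simp: prepared_def)
  qed (use s \<omega> in \<open>auto simp: prepared_def table_at_def\<close>)
  then show ?thesis
    unfolding sample_prepared_def by (rule terminates_weaken) auto
qed

end

section \<open>Distribution of the output\<close>

abbreviation unit_uniform :: "real measure" where
  "unit_uniform \<equiv> restrict_space lborel {0..1}"

lemma space_unit_uniform [simp]: "space unit_uniform = {0..1}"
  by (simp add: space_restrict_space)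

lemma prob_space_unit_uniform: "prob_space unit_uniform"
  by (rule prob_space_restrict_space) simp_all

interpretation coord: product_prob_space "\<lambda>_ :: nat. unit_uniform" UNIV
  by (rule product_prob_spaceI) (rule prob_space_unit_uniform)

lemma prob_space_oracle: "prob_space uniform_oracle"
  unfolding uniform_oracle_def by unfold_locales

interpretation uo: prob_space uniform_oracle
  by (rule prob_space_oracle)

lemma space_oracle: "\<omega> \<in> space uniform_oracle \<longleftrightarrow> (\<forall>i. \<omega> i \<in> {0..1})"
  by (auto simp: uniform_oracle_def space_PiM PiE_def Pi_iff)

lemma coordinate_measurable: "(\<lambda>\<omega>. \<omega> i) \<in> borel_measurable (PiM J (\<lambda>_. unit_uniform))" if "i \<in> J" for i J
  by (rule measurable_compose[OF measurable_component_singleton[OF that]])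
    (auto intro!: measurable_restrict_space1)

lemma oracle_coordinate_measurable: "(\<lambda>\<omega>. \<omega> i) \<in> borel_measurable uniform_oracle"
  unfolding uniform_oracle_def by (rule coordinate_measurable) simp

lemma oracle_indep: "uo.indep_vars (\<lambda>_. unit_uniform) (\<lambda>i \<omega>. \<omega> i) UNIV"
proof (subst uo.indep_vars_iff_distr_eq_PiM)
  show "(\<lambda>\<omega>. \<omega> i) \<in> measurable uniform_oracle unit_uniform" for i
    unfolding uniform_oracle_def by (rule measurable_component_singleton) simp
  have "distr uniform_oracle (PiM UNIV (\<lambda>_. unit_uniform)) (\<lambda>x. restrict x UNIV) = uniform_oracle"
    unfolding uniform_oracle_def by (simp add: restrict_def distr_id)
  also have "\<dots> = (\<Pi>\<^sub>M i\<in>UNIV. distr uniform_oracle unit_uniform (\<lambda>\<omega>. \<omega> i))"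
    unfolding uniform_oracle_def by (intro PiM_cong refl) (simp add: coord.PiM_component)
  finally show "distr uniform_oracle (PiM UNIV (\<lambda>_. unit_uniform)) (\<lambda>x. \<lambda>i\<in>UNIV. x i) =
    (\<Pi>\<^sub>M i\<in>UNIV. distr uniform_oracle unit_uniform (\<lambda>\<omega>. \<omega> i))" .
qed simp

text \<open>Serves at two scales: for triples of draws, to multiply the probabilities of the
  letters, and for the blocks of whole runs, to make successive samples independent.\<close>

lemma oracle_blocks_indep:
  assumes "disjoint_family_on J L" "L \<noteq> {}"
    and f: "\<And>k. k \<in> L \<Longrightarrow> f k \<in> measurable (PiM (J k) (\<lambda>_. unit_uniform)) (N k)"
    and eq: "\<And>k \<omega>. k \<in> L \<Longrightarrow> g k \<omega> = f k (restrict \<omega> (J k))"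
  shows "uo.indep_vars N g L"
proof -
  have "uo.indep_vars (\<lambda>k. PiM (J k) (\<lambda>_. unit_uniform)) (\<lambda>k \<omega>. restrict (\<lambda>i. \<omega> i) (J k)) L"
    by (rule uo.indep_vars_restrict[OF oracle_indep _ assms(1)]) simp
  then have "uo.indep_vars N (\<lambda>k \<omega>. f k (restrict \<omega> (J k))) L"
    by (rule uo.indep_vars_compose2) (rule f)
  then show ?thesis
    by (subst uo.indep_vars_cong[OF refl _ refl, of L g "\<lambda>k \<omega>. f k (restrict \<omega> (J k))"])
      (auto simp: eq fun_eq_iff)
qed

lemma oracle_box3:
  assumes "a \<noteq> b" "a \<noteq> c" "b \<noteq> c"
    and "X \<in> sets unit_uniform" "Y \<in> sets unit_uniform" "Z \<in> sets unit_uniform"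
  shows "measure uniform_oracle {\<omega> \<in> space uniform_oracle. \<omega> a \<in> X \<and> \<omega> b \<in> Y \<and> \<omega> c \<in> Z} =
    measure unit_uniform X * measure unit_uniform Y * measure unit_uniform Z"
proof -
  define F where "F i = (if i = a then X else if i = b then Y else Z)" for i
  have "{\<omega> \<in> space uniform_oracle. \<omega> a \<in> X \<and> \<omega> b \<in> Y \<and> \<omega> c \<in> Z} =
      {\<omega> \<in> space uniform_oracle. \<forall>i\<in>{a, b, c}. \<omega> i \<in> F i}"
    using assms(1-3) by (auto simp: F_def)
  then have "emeasure uniform_oracle {\<omega> \<in> space uniform_oracle. \<omega> a \<in> X \<and> \<omega> b \<in> Y \<and> \<omega> c \<in> Z} =
      (\<Prod>i\<in>{a, b, c}. emeasure unit_uniform (F i))"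
    unfolding uniform_oracle_def
    using assms by (simp only:) (rule coord.emeasure_PiM_Collect, auto simp: F_def)
  also have "\<dots> = ennreal (measure unit_uniform X * measure unit_uniform Y * measure unit_uniform Z)"
    using assms(1-3) by (simp add: F_def coord.M.emeasure_eq_measure ennreal_mult mult.assoc)
  finally show ?thesis
    by (simp add: uo.emeasure_eq_measure)
qed

lemma measure_unit_Ico:
  assumes "0 \<le> a" "a \<le> b" "b \<le> 1"
  shows "measure unit_uniform {a..<b} = b - a"
  using assms by (subst measure_restrict_space) auto

lemma AE_unit_less: "AE u in unit_uniform. u < 1"
proof (subst AE_restrict_space_iff)
  show "AE x in lborel. x \<in> {0..1} \<longrightarrow> x < (1::real)"
    using AE_lborel_singleton[of "1::real"] by eventually_elim auto
qed simp

lemma floor_iff: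
  assumes "0 \<le> u" "0 < k"
  shows "nat \<lfloor>u * real k\<rfloor> = j \<longleftrightarrow> real j / real k \<le> u \<and> u < (real j + 1) / real k"
proof -
  have "0 \<le> u * real k" using assms by simp
  then have "nat \<lfloor>u * real k\<rfloor> = j \<longleftrightarrow> real j \<le> u * real k \<and> u * real k < real j + 1" by linarith
  then show ?thesis using assms by (simp add: field_simps)
qed

lemma floor_less:
  assumes "u < 1" "0 < k"
  shows "nat \<lfloor>u * real k\<rfloor> < k"
proof -
  have "u * real k < real k" using assms by simp
  then show ?thesis using assms(2) by linarith
qed

text \<open>Up to a null set the event is the interval from j/k to (j+1)/k. Agreement is required
  only below 1 because \<open>pick\<close> may use a default at the endpoint.\<close>

lemma measure_unit_floor:
  assumes "j < k" "{u \<in> {0..1}. P u} \<in> sets unit_uniform"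
    and P: "\<And>u. 0 \<le> u \<Longrightarrow> u < 1 \<Longrightarrow> P u \<longleftrightarrow> nat \<lfloor>u * real k\<rfloor> = j"
  shows "measure unit_uniform {u \<in> {0..1}. P u} = 1 / real k"
proof -
  have *: "(real j + 1) / real k \<le> 1" using assms(1) by simp
  have "measure unit_uniform {u \<in> {0..1}. P u} =
      measure unit_uniform {real j / real k ..< (real j + 1) / real k}"
  proof (rule coord.M.finite_measure_eq_AE)
    show "AE u in unit_uniform. u \<in> {u \<in> {0..1}. P u} \<longleftrightarrow> u \<in> {real j / real k ..< (real j + 1) / real k}"
      using AE_unit_less AE_space
    proof eventually_elim
      case (elim u)
      then show ?case using floor_iff[of u k j] P[of u] assms(1) by auto
    qed
    show "{real j / real k ..< (real j + 1) / real k} \<in> sets unit_uniform"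
    proof -
      have "0 \<le> x" if "real j / real k \<le> x" for x by (rule order_trans[OF _ that]) simp
      then show ?thesis using * by (auto simp: sets_restrict_space_iff)
    qed
  qed (rule assms(2))
  also have "\<dots> = 1 / real k"
    using assms(1) * by (subst measure_unit_Ico) (auto simp: divide_simps)
  finally show ?thesis .
qed

section \<open>Law of a single letter\<close>

context sampler_machine begin

text \<open>\<open>column\<close>, \<open>outcome\<close> and \<open>rare\<close> separate
  \<open>pick\<close> according to the draws involved, so that independence of the three coordinates
  can be applied.\<close>

definition column :: "real \<Rightarrow> nat" where
  "column u = (if nat \<lfloor>u * K\<rfloor> < K then nat \<lfloor>u * K\<rfloor> else 0)"

definition outcome :: "nat \<Rightarrow> nat \<Rightarrow> real \<Rightarrow> real \<Rightarrow> nat" where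
  "outcome r q u v = (if v < keep r q (column u) then column u else other r q (column u))"

definition rare :: "real \<Rightarrow> nat" where
  "rare w = (if m + nat \<lfloor>w * real (d - m)\<rfloor> < d then m + nat \<lfloor>w * real (d - m)\<rfloor> else 0)"

lemma pick_alt: "pick r q u v w = (if outcome r q u v < m then outcome r q u v else rare w)"
  by (simp add: pick_def Let_def outcome_def column_def rare_def)

lemma column_less: "column u < K"
  by (simp add: column_def)

lemma column_measurable [measurable]: "column \<in> borel \<rightarrow>\<^sub>M count_space UNIV"
  unfolding column_def by measurable

lemma rare_measurable [measurable]: "rare \<in> borel \<rightarrow>\<^sub>M count_space UNIV"
  unfolding rare_def by measurable

lemma outcome_measurable [measurable (raw)]:
  assumes [measurable]: "f \<in> borel_measurable N" "g \<in> borel_measurable N"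
  shows "(\<lambda>x. outcome r q (f x) (g x)) \<in> N \<rightarrow>\<^sub>M count_space UNIV"
proof -
  have [measurable]: "(\<lambda>x. F (column (f x))) \<in> borel_measurable N" for F :: "nat \<Rightarrow> real"
    by (rule measurable_compose[of "\<lambda>x. column (f x)" N "count_space UNIV"]) auto
  have [measurable]: "(\<lambda>x. F (column (f x))) \<in> N \<rightarrow>\<^sub>M count_space UNIV" for F :: "nat \<Rightarrow> nat"
    by (rule measurable_compose[of "\<lambda>x. column (f x)" N "count_space UNIV"]) auto
  show ?thesis unfolding outcome_def by measurable
qed

lemma pick_measurable [measurable (raw)]:
  assumes [measurable]: "f \<in> borel_measurable N" "g \<in> borel_measurable N" "h \<in> borel_measurable N"
  shows "(\<lambda>x. pick r q (f x) (g x) (h x)) \<in> N \<rightarrow>\<^sub>M count_space UNIV"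
  unfolding pick_alt by measurable

lemma unit_sets: "{u \<in> {0..1}. P u} \<in> sets unit_uniform" if "Measurable.pred borel P" for P
  using that by (auto simp: sets_restrict_space_iff)

lemma prob_column: "j < K \<Longrightarrow> measure unit_uniform {u \<in> {0..1}. column u = j} = 1 / real K"
  by (rule measure_unit_floor, assumption, rule unit_sets, measurable)
    (use floor_less[where k = K] in \<open>auto simp: column_def\<close>)

lemma prob_rare:
  assumes "m \<le> c" "c < d"
  shows "measure unit_uniform {u \<in> {0..1}. rare u = c} = 1 / real (d - m)"
proof (rule measure_unit_floor[of "c - m"])
  fix u :: real assume "0 \<le> u" "u < 1"
  then have "nat \<lfloor>u * real (d - m)\<rfloor> < d - m" using assms by (intro floor_less) auto
  then show "rare u = c \<longleftrightarrow> nat \<lfloor>u * real (d - m)\<rfloor> = c - m"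
    using assms by (auto simp: rare_def)
next
  show "{u \<in> {0..1}. rare u = c} \<in> sets unit_uniform" by (rule unit_sets) measurable
qed (use assms in auto)

lemma prob_rare_0:
  assumes "c < m" "m < d"
  shows "measure unit_uniform {u \<in> {0..1}. rare u = c} = 0"
proof -
  have "measure unit_uniform {u \<in> {0..1}. rare u = c} = measure unit_uniform {}"
  proof (rule coord.M.finite_measure_eq_AE)
    show "AE u in unit_uniform. u \<in> {u \<in> {0..1}. rare u = c} \<longleftrightarrow> u \<in> {}"
      using AE_unit_less AE_space
    proof eventually_elim
      case (elim u)
      then have "nat \<lfloor>u * real (d - m)\<rfloor> < d - m" using assms by (intro floor_less) auto
      then show ?case using assms by (auto simp: rare_def)
    qed
  next
    show "{u \<in> {0..1}. rare u = c} \<in> sets unit_uniform" by (rule unit_sets) measurable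
  qed simp
  then show ?thesis by simp
qed

lemma prob_keep:
  assumes "0 \<le> b" "b \<le> 1"
  shows "measure unit_uniform {v \<in> {0..1}. v < b} = b" "measure unit_uniform {v \<in> {0..1}. \<not> v < b} = 1 - b"
proof -
  have "{v \<in> {0..1}. v < b} = {0..<b}" using assms by auto
  then show 1: "measure unit_uniform {v \<in> {0..1}. v < b} = b"
    using assms measure_unit_Ico[of 0 b] by simp
  have "{v \<in> {0..1}. \<not> v < b} = space unit_uniform - {v \<in> {0..1}. v < b}" by auto
  then show "measure unit_uniform {v \<in> {0..1}. \<not> v < b} = 1 - b"
    using 1 by (simp only:) (subst coord.M.prob_compl, rule unit_sets, auto)
qed

lemma prob_outcome:
  assumes "q < S" "x < K" "{w \<in> {0..1}. W w} \<in> sets unit_uniform"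
  shows "measure uniform_oracle {\<omega> \<in> space uniform_oracle.
      outcome r q (\<omega> a) (\<omega> (a + 1)) = x \<and> W (\<omega> (a + 2))} =
    weight r q x / K * measure unit_uniform {w \<in> {0..1}. W w}"
proof -
  define b where "b = keep r q"
  define al where "al = other r q"
  have table: "0 \<le> b j \<and> b j \<le> 1" if "j < K" for j
    using alias_table(1)[of K "weight r q" j, OF weight_nonneg weight_sum] that assms(1) by (simp add: b_def)
  define E1 where "E1 j = (if j = x then {\<omega> \<in> space uniform_oracle. \<omega> a \<in> {u \<in> {0..1}. column u = j} \<and>
      \<omega> (a + 1) \<in> {v \<in> {0..1}. v < b j} \<and> \<omega> (a + 2) \<in> {w \<in> {0..1}. W w}} else {})" for j
  define E2 where "E2 j = (if al j = x then {\<omega> \<in> space uniform_oracle. \<omega> a \<in> {u \<in> {0..1}. column u = j} \<and>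
      \<omega> (a + 1) \<in> {v \<in> {0..1}. \<not> v < b j} \<and> \<omega> (a + 2) \<in> {w \<in> {0..1}. W w}} else {})" for j
  have comp: "{\<omega> \<in> space uniform_oracle. \<omega> i \<in> X} \<in> sets uniform_oracle"
    if "X \<in> sets unit_uniform" for i X
    using that unfolding uniform_oracle_def
    by (auto intro!: measurable_sets_Collect[OF measurable_component_singleton])
  have box: "{\<omega> \<in> space uniform_oracle. \<omega> a \<in> X \<and> \<omega> (a + 1) \<in> Y \<and> \<omega> (a + 2) \<in> Z} \<in> sets uniform_oracle"
    if "X \<in> sets unit_uniform" "Y \<in> sets unit_uniform" "Z \<in> sets unit_uniform" for X Y Z
    using comp[of X a] comp[of Y "a + 1"] comp[of Z "a + 2"] that
    by (intro sets.sets_Collect_conj) simp_all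
  have sets: "{u \<in> {0..1}. column u = j} \<in> sets unit_uniform"
    "{v \<in> {0..1}. v < b j} \<in> sets unit_uniform" "{v \<in> {0..1}. \<not> v < b j} \<in> sets unit_uniform" for j
    by (rule unit_sets; measurable)+
  have E1: "E1 j \<in> sets uniform_oracle" and E2: "E2 j \<in> sets uniform_oracle" for j
    using box[OF sets(1) sets(2) assms(3)] box[OF sets(1) sets(3) assms(3)] by (auto simp: E1_def E2_def)
  have mE: "measure uniform_oracle (E1 j \<union> E2 j) =
      (of_bool (j = x) * b j + of_bool (al j = x) * (1 - b j)) / K * measure unit_uniform {w \<in> {0..1}. W w}"
    if "j < K" for j
  proof -
    have "0 \<le> b j" "b j \<le> 1" using table[OF that] by auto
    note prob_keep[OF this]
    moreover have "measure uniform_oracle (E1 j \<union> E2 j) = measure uniform_oracle (E1 j) + measure uniform_oracle (E2 j)"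
      by (intro uo.finite_measure_Union E1 E2) (auto simp: E1_def E2_def)
    moreover have "measure uniform_oracle (E1 j) =
      of_bool (j = x) * (1 / K * measure unit_uniform {v \<in> {0..1}. v < b j} * measure unit_uniform {w \<in> {0..1}. W w})"
      using oracle_box3[of a "a + 1" "a + 2", OF _ _ _ sets(1)[of j] sets(2)[of j] assms(3)] prob_column[OF that]
      by (cases "j = x") (simp_all add: E1_def del: of_nat_Suc)
    moreover have "measure uniform_oracle (E2 j) =
      of_bool (al j = x) * (1 / K * measure unit_uniform {v \<in> {0..1}. \<not> v < b j} * measure unit_uniform {w \<in> {0..1}. W w})"
      using oracle_box3[of a "a + 1" "a + 2", OF _ _ _ sets(1)[of j] sets(3)[of j] assms(3)] prob_column[OF that]
      by (simp add: E2_def del: of_nat_Suc)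
    ultimately show ?thesis by (simp add: add_divide_distrib distrib_right del: of_nat_Suc)
  qed
  have "{\<omega> \<in> space uniform_oracle. outcome r q (\<omega> a) (\<omega> (a + 1)) = x \<and> W (\<omega> (a + 2))} =
      (\<Union>j<K. E1 j \<union> E2 j)" (is "?L = ?R")
  proof (intro equalityI subsetI)
    fix \<omega> assume \<omega>: "\<omega> \<in> ?L"
    then have "\<omega> i \<in> {0..1}" for i by (auto simp: space_oracle)
    then have "\<omega> \<in> E1 (column (\<omega> a)) \<union> E2 (column (\<omega> a))"
      using \<omega> by (auto simp: E1_def E2_def outcome_def b_def al_def split: if_splits)
    then show "\<omega> \<in> ?R" using column_less by blast
  qed (auto simp: E1_def E2_def outcome_def b_def al_def split: if_splits)
  also have "measure uniform_oracle (\<Union>j<K. E1 j \<union> E2 j) = (\<Sum>j<K. measure uniform_oracle (E1 j \<union> E2 j))"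
    by (intro uo.finite_measure_finite_Union)
      (use E1 E2 in \<open>auto simp: disjoint_family_on_def E1_def E2_def split: if_splits\<close>)
  also have "\<dots> = (\<Sum>j<K. of_bool (j = x) * b j + of_bool (al j = x) * (1 - b j)) / K *
      measure unit_uniform {w \<in> {0..1}. W w}"
    unfolding sum_divide_distrib sum_distrib_right by (intro sum.cong) (auto simp: mE)
  also have "(\<Sum>j<K. of_bool (j = x) * b j + of_bool (al j = x) * (1 - b j)) = weight r q x"
    unfolding b_def al_def using assms(1,2)
    by (intro alias_table(2)[OF weight_nonneg weight_sum, symmetric])
  finally show ?thesis .
qed

lemma other_less: "q < S \<Longrightarrow> j < K \<Longrightarrow> other r q j < K"
  using alias_table(1)[of K "weight r q" j, OF weight_nonneg weight_sum] by blast

lemma outcome_less: "q < S \<Longrightarrow> outcome r q u v < K"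
  using column_less[of u] other_less[of q "column u" r] by (simp add: outcome_def)

lemma prob_pick:
  assumes "q < S" "c < d"
  shows "measure uniform_oracle {\<omega> \<in> space uniform_oracle.
      pick r q (\<omega> a) (\<omega> (a + 1)) (\<omega> (a + 2)) = c} = A r (gt q (min c m)) / V r q"
proof -
  define E1 where "E1 = (if c < m then {\<omega> \<in> space uniform_oracle.
      outcome r q (\<omega> a) (\<omega> (a + 1)) = c \<and> True} else {})"
  define E2 where "E2 = {\<omega> \<in> space uniform_oracle.
      outcome r q (\<omega> a) (\<omega> (a + 1)) = m \<and> rare (\<omega> (a + 2)) = c}"
  have o: "(\<lambda>\<omega>. outcome r q (\<omega> a) (\<omega> (a + 1))) \<in> uniform_oracle \<rightarrow>\<^sub>M count_space UNIV"
    by (intro outcome_measurable oracle_coordinate_measurable)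
  have w: "(\<lambda>\<omega>. rare (\<omega> (a + 2))) \<in> uniform_oracle \<rightarrow>\<^sub>M count_space UNIV"
    by (intro measurable_compose[OF oracle_coordinate_measurable rare_measurable])
  have "{\<omega> \<in> space uniform_oracle. outcome r q (\<omega> a) (\<omega> (a + 1)) = x} \<in> sets uniform_oracle"
    "{\<omega> \<in> space uniform_oracle. rare (\<omega> (a + 2)) = x} \<in> sets uniform_oracle" for x
    using measurable_sets[OF o, of "{x}"] measurable_sets[OF w, of "{x}"]
    by (simp_all add: vimage_def Int_def conj_commute)
  then have sets: "E1 \<in> sets uniform_oracle" "E2 \<in> sets uniform_oracle"
    unfolding E1_def E2_def by (auto intro: sets.sets_Collect_conj)
  have "{\<omega> \<in> space uniform_oracle. pick r q (\<omega> a) (\<omega> (a + 1)) (\<omega> (a + 2)) = c} = E1 \<union> E2"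
    using outcome_less[OF assms(1), of r]
    by (auto simp: E1_def E2_def pick_alt less_Suc_eq)
  also have "measure uniform_oracle \<dots> = measure uniform_oracle E1 + measure uniform_oracle E2"
    by (intro uo.finite_measure_Union sets) (auto simp: E1_def E2_def)
  also have "measure uniform_oracle E2 = weight r q m / K * measure unit_uniform {w \<in> {0..1}. rare w = c}"
    unfolding E2_def using assms(1) by (intro prob_outcome unit_sets) auto
  also have "measure uniform_oracle E1 = (if c < m then weight r q c / K else 0)"
  proof -
    have "measure unit_uniform {w \<in> {0..1}. True} = 1"
    proof -
      have "{w \<in> {0..1::real}. True} = space unit_uniform" by auto
      then show ?thesis using coord.M.prob_space by (simp only:)
    qed
    then show ?thesis
      unfolding E1_def using assms(1) prob_outcome[of q c "\<lambda>_. True" r a, OF _ _ unit_sets]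
      by (auto simp del: of_nat_Suc)
  qed
  also have "(if c < m then weight r q c / K else 0) +
      weight r q m / K * measure unit_uniform {w \<in> {0..1}. rare w = c} = A r (gt q (min c m)) / V r q"
  proof (cases "c < m")
    case True
    then have "weight r q m / K * measure unit_uniform {w \<in> {0..1}. rare w = c} = 0"
      using prob_rare_0[of c] weight_eq(2)[of r q] by (cases "m < d") simp_all
    then show ?thesis using True by (simp add: weight_eq del: of_nat_Suc)
  next
    case False
    then show ?thesis using prob_rare[of c] assms(2) by (simp add: weight_eq min_def del: of_nat_Suc)
  qed
  finally show ?thesis .
qed

text \<open>The state takes countably many values, so drawing from a random state is a countable
  case distinction over \<open>pick\<close> with a constant state.\<close>

lemma letter_at_measurable:
  assumes "\<And>j. j < 3 * N \<Longrightarrow> (\<lambda>x. h x j) \<in> borel_measurable M" "i < N"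
  shows "(\<lambda>x. letter_at (h x) i) \<in> M \<rightarrow>\<^sub>M count_space UNIV"
proof -
  have pick: "(\<lambda>x. pick r q (h x (3 * i)) (h x (3 * i + 1)) (h x (3 * i + 2))) \<in> M \<rightarrow>\<^sub>M count_space UNIV"
    if "i < N" for i r q
    by (intro pick_measurable assms(1)) (use that in auto)
  have "(\<lambda>x. state_at (h x) i) \<in> M \<rightarrow>\<^sub>M count_space UNIV \<and>
      (\<lambda>x. letter_at (h x) i) \<in> M \<rightarrow>\<^sub>M count_space UNIV" if "i < N" for i
    using that
  proof (induction i)
    case 0
    then show ?case using pick[of 0 n 0] by (simp add: letter_at_def)
  next
    case (Suc i)
    have "(\<lambda>x. (state_at (h x) i, letter_at (h x) i)) \<in> M \<rightarrow>\<^sub>M count_space UNIV \<Otimes>\<^sub>M count_space UNIV"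
      using Suc by (intro measurable_Pair) auto
    then have "(\<lambda>x. (state_at (h x) i, letter_at (h x) i)) \<in> M \<rightarrow>\<^sub>M count_space UNIV"
      by (simp add: pair_measure_countable)
    from measurable_compose[OF this, of "\<lambda>(q, l). gt q (min l m)" "count_space UNIV"]
    have st: "(\<lambda>x. state_at (h x) (Suc i)) \<in> M \<rightarrow>\<^sub>M count_space UNIV"
      by (simp add: state_at_Suc del: state_at.simps)
    have "(\<lambda>x. letter_at (h x) (Suc i)) \<in> M \<rightarrow>\<^sub>M count_space UNIV"
      unfolding letter_at_def
      by (rule measurable_compose_countable[OF pick st]) (use Suc in auto)
    with st show ?case by simp
  qed
  then show ?thesis using assms(2) by simp
qed

text \<open>Confines the letters of a run to its own block of oracle values, which is what
  independence of the runs rests on.\<close>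

lemma state_letter_cong:
  assumes "\<And>j. j < 3 * Suc i \<Longrightarrow> \<eta> j = \<eta>' j"
  shows "state_at \<eta> i = state_at \<eta>' i \<and> letter_at \<eta> i = letter_at \<eta>' i"
  using assms
proof (induction i)
  case 0
  then show ?case by (simp add: letter_at_def)
next
  case (Suc i)
  then have "state_at \<eta> (Suc i) = state_at \<eta>' (Suc i)"
    unfolding state_at_Suc by simp
  then show ?case using Suc.prems by (simp add: letter_at_def del: state_at.simps)
qed

lemma pick_block_measurable:
  assumes "{a, a + 1, a + 2} \<subseteq> J"
  shows "(\<lambda>x. pick r q (x a) (x (a + 1)) (x (a + 2))) \<in> PiM J (\<lambda>_. unit_uniform) \<rightarrow>\<^sub>M count_space UNIV"
  by (intro pick_measurable coordinate_measurable) (use assms in auto)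

section \<open>Law of a whole word\<close>

primrec state_after :: "(nat \<Rightarrow> nat) \<Rightarrow> nat \<Rightarrow> nat" where
  "state_after z 0 = 0"
| "state_after z (Suc i) = gt (state_after z i) (min (z i) m)"

lemma state_after_less: "state_after z i < S"
  by (induction i) (auto simp: gt_less pos)

text \<open>As long as the letters agree with \<open>z\<close>, the random states are the states of
  \<open>z\<close>. Inserting these constants turns a condition on a chain into conditions on
  separate triples of draws.\<close>

lemma letters_eq_iff:
  "(\<forall>i<N. letter_at \<eta> i = z i) \<longleftrightarrow>
   (\<forall>i<N. pick (n - i) (state_after z i) (\<eta> (3 * i)) (\<eta> (3 * i + 1)) (\<eta> (3 * i + 2)) = z i)"
proof -
  \<comment> \<open>Each side forces the states to agree, and the sides are compared under this
    agreement; the three claims are proved by one induction.\<close>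
  have "(\<forall>i<N. letter_at \<eta> i = z i) \<and> state_at \<eta> N = state_after z N \<longleftrightarrow>
    (\<forall>i<N. pick (n - i) (state_after z i) (\<eta> (3 * i)) (\<eta> (3 * i + 1)) (\<eta> (3 * i + 2)) = z i)
    \<and> state_at \<eta> N = state_after z N"
    "(\<forall>i<N. letter_at \<eta> i = z i) \<longrightarrow> state_at \<eta> N = state_after z N"
    "(\<forall>i<N. pick (n - i) (state_after z i) (\<eta> (3 * i)) (\<eta> (3 * i + 1)) (\<eta> (3 * i + 2)) = z i)
      \<longrightarrow> state_at \<eta> N = state_after z N"
    by (induction N) (auto simp: less_Suc_eq letter_at_def)
  then show ?thesis by blast
qed

text \<open>By \<open>A_Suc\<close> the numerator for \<open>i\<close> is an exponential of the cost
  times the \<open>V\<close> that is the denominator for \<open>Suc i\<close>.\<close>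

lemma telescope:
  "(\<Prod>i<N. A (n - i) (state_after z (Suc i)) / V (n - i) (state_after z i)) =
    exp (- (\<Sum>i<N. cst (Suc i) (state_after z (Suc i)))) * V (n - N) (state_after z N) / V n 0"
  if "N \<le> n"
  using that
proof (induction N)
  case 0
  then show ?case using V_pos[of 0 n] pos by simp
next
  case (Suc N)
  then obtain r where r: "n - N = Suc r" "n - Suc N = r" "n - r = Suc N"
    by (metis Suc_diff_le Suc_leD diff_Suc_Suc diff_diff_cancel)
  have "V (Suc r) (state_after z N) > 0" by (intro V_pos state_after_less)
  then show ?case
    using Suc r(1,2,3) by (simp add: A_Suc r exp_add exp_diff exp_minus field_simps
        del: A.simps state_after.simps)
qed

lemma prob_letters:
  assumes "\<And>i. i < n \<Longrightarrow> z i < d"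
  shows "measure uniform_oracle {\<omega> \<in> space uniform_oracle.
      \<forall>i<n. letter_at (\<lambda>j. \<omega> (b + j)) i = z i} =
    exp (- (\<Sum>i<n. cst (Suc i) (state_after z (Suc i)))) * (real d / V n 0)"
proof -
  define Y where "Y i \<omega> = pick (n - i) (state_after z i) (\<omega> (b + 3 * i)) (\<omega> (b + 3 * i + 1)) (\<omega> (b + 3 * i + 2))"
    for i and \<omega> :: "nat \<Rightarrow> real"
  have ind: "uo.indep_vars (\<lambda>_. count_space UNIV) Y {..<n}"
  proof (rule oracle_blocks_indep[where J = "\<lambda>i. {b + 3 * i, b + 3 * i + 1, b + 3 * i + 2}" and f = Y])
    show "disjoint_family_on (\<lambda>i. {b + 3 * i, b + 3 * i + 1, b + 3 * i + 2}) {..<n}"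
    proof (unfold disjoint_family_on_def, intro ballI impI)
      fix i j :: nat assume "i \<noteq> j"
      then show "{b + 3 * i, b + 3 * i + 1, b + 3 * i + 2} \<inter> {b + 3 * j, b + 3 * j + 1, b + 3 * j + 2} = {}"
        by auto
    qed
    show "Y k \<in> PiM {b + 3 * k, b + 3 * k + 1, b + 3 * k + 2} (\<lambda>_. unit_uniform) \<rightarrow>\<^sub>M count_space UNIV" for k
      unfolding Y_def by (rule pick_block_measurable) simp
  qed (use pos in \<open>auto simp: Y_def\<close>)
  have "{\<omega> \<in> space uniform_oracle. \<forall>i<n. letter_at (\<lambda>j. \<omega> (b + j)) i = z i} =
      (\<Inter>i\<in>{..<n}. Y i -` {z i} \<inter> space uniform_oracle)"
    unfolding letters_eq_iff using pos(1) by (auto simp: Y_def add.assoc)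
  also have "measure uniform_oracle \<dots> = (\<Prod>i<n. measure uniform_oracle (Y i -` {z i} \<inter> space uniform_oracle))"
    using pos by (intro uo.indep_varsD[OF ind]) auto
  also have "\<dots> = (\<Prod>i<n. A (n - i) (state_after z (Suc i)) / V (n - i) (state_after z i))"
  proof (rule prod.cong[OF refl])
    fix i assume "i \<in> {..<n}"
    then have "measure uniform_oracle {\<omega> \<in> space uniform_oracle. Y i \<omega> = z i} =
        A (n - i) (state_after z (Suc i)) / V (n - i) (state_after z i)"
      unfolding Y_def using prob_pick[OF state_after_less assms, of i "n - i" z i "b + 3 * i"] by simp
    moreover have "Y i -` {z i} \<inter> space uniform_oracle = {\<omega> \<in> space uniform_oracle. Y i \<omega> = z i}" by auto
    ultimately show "measure uniform_oracle (Y i -` {z i} \<inter> space uniform_oracle) =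
        A (n - i) (state_after z (Suc i)) / V (n - i) (state_after z i)" by simp
  qed
  also have "\<dots> = exp (- (\<Sum>i<n. cst (Suc i) (state_after z (Suc i)))) * V (n - n) (state_after z n) / V n 0"
    by (rule telescope) simp
  also have "V (n - n) (state_after z n) = real d" by (simp add: V_def)
  finally show ?thesis by simp
qed

end

text \<open>\<open>dec\<close> turns a relabelled letter into the letter that the machine outputs for it.\<close>

locale gibbs_machine = sampler_machine +
  fixes D :: "'a set" and \<Gamma> :: "'a list set" and \<psi> :: "'a list \<Rightarrow> nat \<Rightarrow> nat \<Rightarrow> real" and enc :: "'a \<Rightarrow> nat"
    and dec :: "nat \<Rightarrow> 'a"
  assumes dec: "bij_betw dec {..<d} D" "\<And>c. c < d \<Longrightarrow> dec c = inv_into D enc (pm c)"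
    and energy: "\<And>z. (\<And>i. i < n \<Longrightarrow> z i < d) \<Longrightarrow>
      energy \<Gamma> n \<psi> (map (\<lambda>i. dec (z i)) [0..<n]) = (\<Sum>i<n. cst (Suc i) (state_after z (Suc i)))"
begin

text \<open>Every earlier run has consumed \<open>3 * n\<close> values, so the block of run
  \<open>k\<close> starts at \<open>3 * n * k\<close>.\<close>

definition sample :: "nat \<Rightarrow> (nat \<Rightarrow> real) \<Rightarrow> 'a list" where
  "sample k \<omega> = map (\<lambda>i. dec (letter_at (\<lambda>j. \<omega> (3 * n * k + j)) i)) [0..<n]"

lemma letter_at_less: "letter_at \<eta> i < d"
  by (simp add: letter_at_def pick_less)

lemma sample_in_words: "sample k \<omega> \<in> words D n"
  using dec(1) letter_at_less by (auto simp: sample_def words_def bij_betw_def)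

lemma finite_words: "finite (words D n)"
proof -
  have "finite D" using dec(1) bij_betw_finite by blast
  then show ?thesis
    using finite_lists_length_eq[of D n] by (simp add: words_def conj_commute)
qed

lemma sample_eq_iff:
  assumes "x \<in> words D n"
  shows "sample k \<omega> = x \<longleftrightarrow>
    (\<forall>i<n. letter_at (\<lambda>j. \<omega> (3 * n * k + j)) i = inv_into {..<d} dec (x ! i))"
proof -
  have one: "dec l = x ! i \<longleftrightarrow> l = inv_into {..<d} dec (x ! i)" if "i < n" "l < d" for i l
  proof -
    have inj: "inj_on dec {..<d}" and "x ! i \<in> dec ` {..<d}"
      using dec(1) assms that by (auto simp: bij_betw_def words_def)
    then obtain c where "c < d" "x ! i = dec c" by auto
    then show ?thesis using inj that(2) by (simp add: inv_into_f_f inj_on_eq_iff)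
  qed
  have "sample k \<omega> = x \<longleftrightarrow> (\<forall>i<n. dec (letter_at (\<lambda>j. \<omega> (3 * n * k + j)) i) = x ! i)"
    using assms by (auto simp: list_eq_iff_nth_eq sample_def words_def)
  then show ?thesis using one letter_at_less by simp
qed

lemma sample_measurable:
  assumes "\<And>j. j < 3 * n \<Longrightarrow> (\<lambda>\<omega>. \<omega> (3 * n * k + j)) \<in> borel_measurable M"
  shows "sample k \<in> M \<rightarrow>\<^sub>M count_space (words D n)"
proof (subst measurable_count_space_eq2[OF finite_words], intro conjI ballI)
  fix x assume x: "x \<in> words D n"
  have "{\<omega> \<in> space M. letter_at (\<lambda>j. \<omega> (3 * n * k + j)) i = c} \<in> sets M" if "i < n" for i c
  proof -
    have "(\<lambda>\<omega>. letter_at (\<lambda>j. \<omega> (3 * n * k + j)) i) \<in> M \<rightarrow>\<^sub>M count_space UNIV"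
      by (rule letter_at_measurable[OF assms that])
    from measurable_sets[OF this, of "{c}"] show ?thesis by (simp add: vimage_def Int_def conj_commute)
  qed
  then have "{\<omega> \<in> space M. \<forall>i\<in>{..<n}. letter_at (\<lambda>j. \<omega> (3 * n * k + j)) i = inv_into {..<d} dec (x ! i)} \<in> sets M"
    by (intro sets.sets_Collect_finite_All) auto
  also have "{\<omega> \<in> space M. \<forall>i\<in>{..<n}. letter_at (\<lambda>j. \<omega> (3 * n * k + j)) i = inv_into {..<d} dec (x ! i)} =
      sample k -` {x} \<inter> space M"
    using sample_eq_iff[OF x] by auto
  finally show "sample k -` {x} \<inter> space M \<in> sets M" .
qed (simp add: sample_in_words)

lemma sample_measurable_oracle: "sample k \<in> uniform_oracle \<rightarrow>\<^sub>M count_space (words D n)"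
  by (intro sample_measurable oracle_coordinate_measurable)

lemma sample_indep: "uo.indep_vars (\<lambda>_. count_space (words D n)) sample UNIV"
proof (rule oracle_blocks_indep[where J = "\<lambda>k. {3 * n * k..<3 * n * Suc k}" and f = sample])
  show "disjoint_family_on (\<lambda>k. {3 * n * k..<3 * n * Suc k}) UNIV"
  proof (unfold disjoint_family_on_def, intro ballI impI)
    fix j k :: nat assume "j \<noteq> k"
    then consider "Suc j \<le> k" | "Suc k \<le> j" by linarith
    then have "3 * n * Suc j \<le> 3 * n * k \<or> 3 * n * Suc k \<le> 3 * n * j"
      by cases (metis mult_le_mono2)+
    then show "{3 * n * j..<3 * n * Suc j} \<inter> {3 * n * k..<3 * n * Suc k} = {}" by auto
  qed
  show "sample k \<in> PiM {3 * n * k..<3 * n * Suc k} (\<lambda>_. unit_uniform) \<rightarrow>\<^sub>M count_space (words D n)" for k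
    by (intro sample_measurable coordinate_measurable) auto
  show "sample k \<omega> = sample k (restrict \<omega> {3 * n * k..<3 * n * Suc k})" for k \<omega>
    unfolding sample_def
  proof (intro map_cong refl arg_cong[of _ _ dec])
    fix i assume "i \<in> set [0..<n]"
    then show "letter_at (\<lambda>j. \<omega> (3 * n * k + j)) i =
        letter_at (\<lambda>j. restrict \<omega> {3 * n * k..<3 * n * Suc k} (3 * n * k + j)) i"
      by (intro state_letter_cong[THEN conjunct2]) auto
  qed
qed simp

text \<open>All words have probability \<open>exp (- energy)\<close> times the same factor
  \<open>c\<close>. Since every sample lies in \<open>words D n\<close>, these probabilities add up
  to 1, which forces \<open>c\<close> to be the inverse of the partition function.\<close>

lemma prob_sample:
  assumes "x \<in> words D n"
  shows "measure uniform_oracle {\<omega> \<in> space uniform_oracle. sample k \<omega> = x} = gibbs D \<Gamma> n \<psi> x"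
proof -
  define c where "c = real d / V n 0"
  have p: "measure uniform_oracle {\<omega> \<in> space uniform_oracle. sample k \<omega> = x} =
      exp (- energy \<Gamma> n \<psi> x) * c" if x: "x \<in> words D n" for x
  proof -
    define z where "z i = inv_into {..<d} dec (x ! i)" for i
    have "x ! i \<in> dec ` {..<d}" if "i < n" for i
      using dec(1) x that by (auto simp: bij_betw_def words_def)
    then have z: "z i < d" "dec (z i) = x ! i" if "i < n" for i
      using that inv_into_into[of "x ! i" dec "{..<d}"] f_inv_into_f[of "x ! i" dec "{..<d}"]
      by (auto simp: z_def)
    then have "map (\<lambda>i. dec (z i)) [0..<n] = x"
      using x by (auto simp: list_eq_iff_nth_eq words_def)
    then show ?thesis
      unfolding sample_eq_iff[OF x] z_def[symmetric] c_def
      using prob_letters[of z "3 * n * k", OF z(1)] energy[of z, OF z(1)] by simp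
  qed
  have "1 = measure uniform_oracle (\<Union>x\<in>words D n. {\<omega> \<in> space uniform_oracle. sample k \<omega> = x})"
    using sample_in_words uo.prob_space
    by (subst arg_cong[of _ "space uniform_oracle" "measure uniform_oracle"]) auto
  also have "\<dots> = (\<Sum>x\<in>words D n. measure uniform_oracle {\<omega> \<in> space uniform_oracle. sample k \<omega> = x})"
  proof (rule uo.finite_measure_finite_Union[OF finite_words])
    have "sample k -` {x} \<inter> space uniform_oracle \<in> sets uniform_oracle" if "x \<in> words D n" for x
      using measurable_sets[OF sample_measurable_oracle, of "{x}" k] that by simp
    then show "(\<lambda>x. {\<omega> \<in> space uniform_oracle. sample k \<omega> = x}) ` words D n \<subseteq> sets uniform_oracle"
      by (auto simp: vimage_def Int_def conj_commute)
  qed (auto simp: disjoint_family_on_def)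
  also have "\<dots> = partition_fun D \<Gamma> n \<psi> * c"
    unfolding partition_fun_def sum_distrib_right by (intro sum.cong) (auto simp: p)
  finally have "c = 1 / partition_fun D \<Gamma> n \<psi>" by (cases "partition_fun D \<Gamma> n \<psi> = 0") (auto simp: field_simps)
  then show ?thesis using p[OF assms] by (simp add: gibbs_def)
qed

lemma sample_distributed:
  "distributed uniform_oracle (count_space (words D n)) (sample k) (\<lambda>x. ennreal (gibbs D \<Gamma> n \<psi> x))"
  unfolding distributed_def
proof (intro conjI)
  show "distr uniform_oracle (count_space (words D n)) (sample k) =
      density (count_space (words D n)) (\<lambda>x. ennreal (gibbs D \<Gamma> n \<psi> x))"
  proof (rule measure_eqI_finite)
    fix x assume x: "x \<in> words D n"
    have "emeasure (distr uniform_oracle (count_space (words D n)) (sample k)) {x} =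
        emeasure uniform_oracle (sample k -` {x} \<inter> space uniform_oracle)"
      using x by (intro emeasure_distr sample_measurable_oracle) auto
    also have "sample k -` {x} \<inter> space uniform_oracle = {\<omega> \<in> space uniform_oracle. sample k \<omega> = x}"
      by auto
    also have "emeasure uniform_oracle \<dots> = ennreal (gibbs D \<Gamma> n \<psi> x)"
      using prob_sample[OF x, of k] by (simp add: uo.emeasure_eq_measure)
    finally show "emeasure (distr uniform_oracle (count_space (words D n)) (sample k)) {x} =
        emeasure (density (count_space (words D n)) (\<lambda>x. ennreal (gibbs D \<Gamma> n \<psi> x))) {x}"
      using x finite_words by (subst emeasure_density) (auto simp: nn_integral_count_space_finite)
  qed (auto simp: finite_words)
qed (auto simp: sample_measurable_oracle)

text \<open>A run may start in any state satisfying \<open>P\<close>, and \<open>drawn\<close> alone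
  decides which block it reads. The outputs thus equal the functions \<open>sample k\<close>, and
  independence and law carry over by equality.\<close>

lemma iid_samplerI:
  assumes init: "\<And>\<omega>. \<omega> \<in> space uniform_oracle \<Longrightarrow> P (s0 \<omega>) \<and> drawn (s0 \<omega>) = 0"
    and run: "\<And>\<omega> s. \<omega> \<in> space uniform_oracle \<Longrightarrow> P s \<Longrightarrow> terminates B \<omega> c s t
      (\<lambda>s'. P s' \<and> drawn s' = drawn s + 3 * n \<and>
        (\<forall>i<n. nmem s' 0 i = pm (letter_at (\<lambda>j. \<omega> (drawn s + j)) i)))"
  shows "iid_sampler B c s0 t D enc n (gibbs D \<Gamma> n \<psi>)"
proof -
  have "\<exists>f. (\<omega> \<in> space uniform_oracle \<longrightarrow>
        f 0 = s0 \<omega> \<and> (\<forall>k. \<exists>u\<le>t. exec B \<omega> c (f k) u (f (Suc k)))) \<and>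
      (\<forall>k. output_word D enc n (f (Suc k)) = sample k \<omega>)" for \<omega>
  proof (cases "\<omega> \<in> space uniform_oracle")
    case \<omega>: True
    \<comment> \<open>The clause for \<open>k = 0\<close> pins the start to
      \<open>s0 \<omega>\<close>, which dependent choice would otherwise leave open.\<close>
    define G where "G k s \<longleftrightarrow> P s \<and> drawn s = 3 * n * k \<and> (k = 0 \<longrightarrow> s = s0 \<omega>)" for k s
    define Q where "Q k s s' \<longleftrightarrow> (\<exists>u\<le>t. exec B \<omega> c s u s') \<and> output_word D enc n s' = sample k \<omega>" for k s s'
    have "\<exists>f. \<forall>k. G k (f k) \<and> Q k (f k) (f (Suc k))"
    proof (rule dependent_nat_choice)
      show "\<exists>s. G 0 s" using init[OF \<omega>] by (auto simp: G_def)
      fix s k assume s: "G k s"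
      from run[OF \<omega>, of s] s obtain u s' where s': "exec B \<omega> c s u s'" "u \<le> t" "P s'"
        "drawn s' = drawn s + 3 * n" "\<forall>i<n. nmem s' 0 i = pm (letter_at (\<lambda>j. \<omega> (drawn s + j)) i)"
        by (auto simp: terminates_def G_def)
      have "output_word D enc n s' = sample k \<omega>"
        using s' s dec(2)[OF letter_at_less] by (auto simp: output_word_def sample_def G_def)
      then show "\<exists>s'. G (Suc k) s' \<and> Q k s s'"
        using s' s by (intro exI[of _ s']) (auto simp: G_def Q_def)
    qed
    then obtain f where "\<And>k. G k (f k)" "\<And>k. Q k (f k) (f (Suc k))" by blast
    then show ?thesis unfolding G_def Q_def by (intro exI[of _ f]) blast
  next
    case False
    \<comment> \<open>Off the probability space no execution is required, but the outputs must still
      equal \<open>sample k\<close> to give an equality of functions. States with these outputs are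
      written down directly.\<close>
    define f where "f k = \<lparr>nmem = \<lambda>_ i. pm (letter_at (\<lambda>j. \<omega> (3 * n * (k - 1) + j)) i),
      rmem = \<lambda>_ _. 0, drawn = 0\<rparr>" for k
    have "output_word D enc n (f (Suc k)) = sample k \<omega>" for k
      using dec(2)[OF letter_at_less] by (auto simp: output_word_def sample_def f_def)
    then show ?thesis using False by blast
  qed
  then obtain S where S: "\<And>\<omega>. \<omega> \<in> space uniform_oracle \<Longrightarrow> S \<omega> 0 = s0 \<omega>"
    "\<And>\<omega> k. \<omega> \<in> space uniform_oracle \<Longrightarrow> \<exists>u\<le>t. exec B \<omega> c (S \<omega> k) u (S \<omega> (Suc k))"
    "\<And>\<omega> k. output_word D enc n (S \<omega> (Suc k)) = sample k \<omega>"
    by metis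
  have out: "(\<lambda>\<omega>. output_word D enc n (S \<omega> (Suc k))) = sample k" for k
    using S(3) by blast
  have "uo.indep_vars (\<lambda>_. count_space (words D n)) (\<lambda>k \<omega>. output_word D enc n (S \<omega> (Suc k))) UNIV"
    unfolding out by (rule sample_indep)
  moreover have "distributed uniform_oracle (count_space (words D n)) (\<lambda>\<omega>. output_word D enc n (S \<omega> (Suc k)))
      (\<lambda>x. ennreal (gibbs D \<Gamma> n \<psi> x))" for k
    unfolding out by (rule sample_distributed)
  ultimately show ?thesis
    unfolding iid_sampler_def Let_def
    by (intro exI[of _ "\<lambda>k \<omega>. S \<omega> k"] conjI ballI allI) (use S(1,2) in blast)+
qed

end

section \<open>The automaton of prefixes\<close>

primrec longest :: "'a list set \<Rightarrow> 'a list \<Rightarrow> 'a list" where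
  "longest P [] = []"
| "longest P (a # x) = (if a # x \<in> P then a # x else longest P x)"

lemma suffix_longest: "suffix (longest P x) x"
  by (induction x) (auto intro: suffix_ConsI)

lemma longest_id: "p \<in> P \<Longrightarrow> longest P p = p"
  by (cases p) auto

lemma longest_in: "[] \<in> P \<Longrightarrow> longest P x \<in> P"
  by (induction x) auto

text \<open>Of two suffixes of a word the shorter is a suffix of the longer, so passing to the
  longest one loses no member of \<open>P\<close> ending at this point.\<close>

lemma suffix_longest_iff: "p \<in> P \<Longrightarrow> suffix p (longest P x) \<longleftrightarrow> suffix p x"
  by (induction x) (auto simp: suffix_Cons)

text \<open>If \<open>a # x\<close> is not in \<open>P\<close>, closure under prefixes keeps its
  extension by \<open>c\<close> out of \<open>P\<close> too, and both sides drop \<open>a\<close>.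
  Hence the longest suffix after a letter depends only on the longest suffix before it.\<close>

lemma longest_snoc:
  assumes "\<And>p c. p @ [c] \<in> P \<Longrightarrow> p \<in> P"
  shows "longest P (longest P x @ [c]) = longest P (x @ [c])"
proof (induction x)
  case (Cons a x)
  then show ?case using assms[of "a # x" c] by auto
qed simp

section \<open>Numbering of the states, failure links and transitions\<close>

definition position :: "'a list \<Rightarrow> 'a \<Rightarrow> nat" where
  "position xs x = length (takeWhile (\<lambda>y. y \<noteq> x) xs)"

lemma position:
  assumes "x \<in> set xs"
  shows "position xs x < length xs" "xs ! position xs x = x"
proof -
  have "position xs x < length xs \<and> xs ! position xs x = x"
    using assms by (induction xs) (auto simp: position_def)
  then show "position xs x < length xs" "xs ! position xs x = x" by auto
qed

lemma position_nth: "distinct xs \<Longrightarrow> i < length xs \<Longrightarrow> position xs (xs ! i) = i"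
  using position[of "xs ! i" xs] by (auto simp: nth_eq_iff_index_eq)

text \<open>Sorting by length gives the empty prefix the number 0 and makes failure links, which
  lead to shorter prefixes, decrease.\<close>

definition states :: "nat list list \<Rightarrow> nat list list" where
  "states ws = sort_key length (remdups (concat (map prefixes ws)))"

definition number :: "nat list list \<Rightarrow> nat list \<Rightarrow> nat" where
  "number ws = position (states ws)"

definition suffix_state :: "nat list list \<Rightarrow> nat list \<Rightarrow> nat list" where
  "suffix_state ws = longest (set (states ws))"

definition fail_link :: "nat list list \<Rightarrow> nat \<Rightarrow> nat" where
  "fail_link ws q = number ws (suffix_state ws (tl (states ws ! q)))"

definition parent_link :: "nat list list \<Rightarrow> nat \<Rightarrow> nat" where
  "parent_link ws q = number ws (butlast (states ws ! q))"

definition transition :: "nat list list \<Rightarrow> nat \<Rightarrow> nat \<Rightarrow> nat" where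
  "transition ws q e = number ws (suffix_state ws (states ws ! q @ [e]))"

text \<open>Shifted by one, so that 0 can mean that the state is not a word.\<close>

definition word_number :: "nat list list \<Rightarrow> nat \<Rightarrow> nat" where
  "word_number ws q = (if states ws ! q \<in> set ws then Suc (position ws (states ws ! q)) else 0)"

definition state_cost :: "nat list list \<Rightarrow> (nat list \<Rightarrow> nat \<Rightarrow> real) \<Rightarrow> nat \<Rightarrow> nat \<Rightarrow> real" where
  "state_cost ws \<phi> i q = (\<Sum>w | w \<in> set ws \<and> suffix w (states ws ! q). \<phi> w i)"

locale word_list =
  fixes ws :: "nat list list" and m d :: nat
  assumes ws: "ws \<noteq> []" "[] \<notin> set ws" "distinct ws" and letters: "\<And>w. w \<in> set ws \<Longrightarrow> set w \<subseteq> {..<m}"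
    and m: "m \<le> d"
begin

abbreviation "P \<equiv> set (states ws)"
abbreviation "S \<equiv> length (states ws)"

lemma P_iff: "p \<in> P \<longleftrightarrow> (\<exists>w\<in>set ws. prefix p w)"
  by (auto simp: states_def)

lemma distinct_states: "distinct (states ws)"
  by (simp add: states_def)

lemma Nil_in: "[] \<in> P"
  using ws(1) unfolding P_iff by (cases ws) auto

lemma snoc_in: "p @ [c] \<in> P \<Longrightarrow> p \<in> P"
  unfolding P_iff by (meson append_prefixD)

lemma butlast_in: "p \<in> P \<Longrightarrow> butlast p \<in> P"
  by (cases p rule: rev_cases) (auto dest: snoc_in)

lemma letter_less: "p \<in> P \<Longrightarrow> c \<in> set p \<Longrightarrow> c < m"
  using letters unfolding P_iff by (meson lessThan_iff set_mono_prefix subsetD)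

lemma word_in: "w \<in> set ws \<Longrightarrow> w \<in> P"
  by (auto simp: P_iff)

text \<open>A nonempty prefix is given by a word and a cut position in it; the empty prefix accounts
  for the summand 1.\<close>

lemma card_states: "S \<le> 1 + sum_list (map length ws)"
proof -
  have "P - {[]} \<subseteq> (\<Union>w\<in>set ws. (\<lambda>k. take (Suc k) w) ` {..<length w})"
  proof
    fix p assume "p \<in> P - {[]}"
    then obtain w where w: "w \<in> set ws" "prefix p w" "p \<noteq> []" by (auto simp: P_iff)
    then have "p = take (Suc (length p - 1)) w" "length p - 1 < length w"
      using prefix_length_le[OF w(2)] by (cases p; auto simp: prefix_def)+
    then show "p \<in> (\<Union>w\<in>set ws. (\<lambda>k. take (Suc k) w) ` {..<length w})" using w(1) by blast
  qed
  then have "card (P - {[]}) \<le> card (\<Union>w\<in>set ws. (\<lambda>k. take (Suc k) w) ` {..<length w})"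
    by (intro card_mono) auto
  also have "\<dots> \<le> (\<Sum>w\<in>set ws. card ((\<lambda>k. take (Suc k) w) ` {..<length w}))"
    by (rule card_UN_le) simp
  also have "\<dots> \<le> (\<Sum>w\<in>set ws. length w)"
    by (intro sum_mono) (metis card_image_le card_lessThan finite_lessThan)
  also have "\<dots> = sum_list (map length ws)"
    using ws(3) by (simp add: sum_list_distinct_conv_sum_set)
  finally have "card (P - {[]}) \<le> sum_list (map length ws)" .
  moreover have "S = card P" using distinct_states by (simp add: distinct_card)
  ultimately show ?thesis using Nil_in by (simp add: card_Diff_singleton)
qed

lemma number_less: "p \<in> P \<Longrightarrow> number ws p < S"
  and states_number: "p \<in> P \<Longrightarrow> states ws ! number ws p = p"
  and number_states: "q < S \<Longrightarrow> number ws (states ws ! q) = q"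
  by (auto simp: number_def position position_nth distinct_states)

lemma S_pos: "0 < S"
  using Nil_in by (cases "states ws") auto

lemma length_mono: "i \<le> j \<Longrightarrow> j < S \<Longrightarrow> length (states ws ! i) \<le> length (states ws ! j)"
proof -
  assume "i \<le> j" "j < S"
  moreover have "sorted (map length (states ws))" by (simp add: states_def)
  ultimately show ?thesis using sorted_nth_mono[of "map length (states ws)" i j] by simp
qed

lemma states_0: "states ws ! 0 = []"
  using length_mono[of 0 "number ws []"] Nil_in by (simp add: number_less states_number)

lemma states_Nil_iff: "q < S \<Longrightarrow> states ws ! q = [] \<longleftrightarrow> q = 0"
  using states_0 S_pos distinct_states by (metis nth_eq_iff_index_eq)

lemma number_Nil: "number ws [] = 0"
  using number_states[of 0] states_0 S_pos by simp

lemma suffix_state_in: "suffix_state ws x \<in> P"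
  by (simp add: suffix_state_def longest_in Nil_in)

lemma suffix_state_snoc: "suffix_state ws (suffix_state ws x @ [c]) = suffix_state ws (x @ [c])"
  unfolding suffix_state_def by (rule longest_snoc) (rule snoc_in)

lemma suffix_state_id: "p \<in> P \<Longrightarrow> suffix_state ws p = p"
  by (simp add: suffix_state_def longest_id)

lemma states_fail: "states ws ! fail_link ws q = suffix_state ws (tl (states ws ! q))"
  by (simp add: fail_link_def states_number suffix_state_in)

lemma fail_link_less: "0 < q \<Longrightarrow> q < S \<Longrightarrow> fail_link ws q < q"
proof (rule ccontr)
  assume q: "0 < q" "q < S" and "\<not> fail_link ws q < q"
  then have "length (states ws ! q) \<le> length (states ws ! fail_link ws q)"
    by (intro length_mono) (auto simp: fail_link_def number_less suffix_state_in)
  also have "\<dots> \<le> length (tl (states ws ! q))"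
    unfolding states_fail suffix_state_def by (intro suffix_length_le suffix_longest)
  finally show False using q states_Nil_iff[of q] by (cases "states ws ! q") auto
qed

lemma parent_link_less: "q < S \<Longrightarrow> parent_link ws q < S"
  by (simp add: parent_link_def number_less butlast_in)

lemma transition_less: "transition ws q e < S"
  by (simp add: transition_def number_less suffix_state_in)

text \<open>States contain only letters below \<open>m\<close>, so a nonempty one cannot end in
  \<open>e\<close>. All letters from \<open>m\<close> on therefore act alike.\<close>

lemma fresh_state: "m \<le> e \<Longrightarrow> suffix_state ws (x @ [e]) = []"
proof -
  assume e: "m \<le> e"
  have "suffix (suffix_state ws (x @ [e])) (x @ [e])"
    unfolding suffix_state_def by (rule suffix_longest)
  moreover have "e \<notin> set (suffix_state ws (x @ [e]))"
    using letter_less[OF suffix_state_in, of e] e by force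
  ultimately show ?thesis by (auto simp: suffix_snoc)
qed

lemma transition_min: "transition ws q (min e m) = transition ws q e"
  by (cases "e \<le> m") (auto simp: transition_def fresh_state min_def)

text \<open>If \<open>qe\<close> is not a prefix of a word, reading \<open>e\<close> in state \<open>q\<close> has the same effect as reading
  it in the failure state of \<open>q\<close>; otherwise that effect is the failure state of \<open>qe\<close>.\<close>

lemma transition_sum:
  fixes f :: "nat \<Rightarrow> real"
  assumes q: "q < S"
  defines "base e \<equiv> (if q = 0 then 0 else transition ws (fail_link ws q) e)"
  shows "(\<Sum>e<d. f (transition ws q (min e m))) = (\<Sum>e<d. f (base e)) +
    (\<Sum>p | 0 < p \<and> p < S \<and> parent_link ws p = q. f p - f (fail_link ws p))"
proof -
  define u where "u = states ws ! q"
  have u: "u \<in> P" using q by (simp add: u_def)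
  \<comment> \<open>Written with \<open>tl (u @ [e])\<close>, the failure transition covers the root
    too: there the list is empty and the target is state 0.\<close>
  have base: "base e = number ws (suffix_state ws (tl (u @ [e])))" for e
  proof (cases "q = 0")
    case True
    then show ?thesis using states_0 number_Nil by (simp add: base_def u_def suffix_state_def)
  next
    case False
    then have "u \<noteq> []" using states_Nil_iff[OF q] by (simp add: u_def)
    then show ?thesis
      using False suffix_state_snoc[of "tl u" e] by (simp add: base_def transition_def states_fail u_def)
  qed
  have tr: "transition ws q e = (if u @ [e] \<in> P then number ws (u @ [e]) else base e)" for e
  proof (cases "u @ [e] \<in> P")
    case False
    then have "suffix_state ws (u @ [e]) = suffix_state ws (tl (u @ [e]))"
      unfolding suffix_state_def by (cases "u @ [e]") auto
    then show ?thesis using False base by (simp add: transition_def u_def)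
  qed (simp add: transition_def u_def suffix_state_id)
  let ?I = "{p. 0 < p \<and> p < S \<and> parent_link ws p = q}"
  \<comment> \<open>The children of \<open>q\<close> are exactly the prefixes
    \<open>u @ [e]\<close>, so they correspond to the letters on which \<open>q\<close> may differ
    from its failure state.\<close>
  have bij: "bij_betw (\<lambda>e. number ws (u @ [e])) {e. e < d \<and> u @ [e] \<in> P} ?I"
  proof (rule bij_betwI')
    fix e e' assume "e \<in> {e. e < d \<and> u @ [e] \<in> P}" "e' \<in> {e. e < d \<and> u @ [e] \<in> P}"
    then show "(number ws (u @ [e]) = number ws (u @ [e'])) = (e = e')"
      by (metis (mono_tags, lifting) last_snoc mem_Collect_eq states_number)
  next
    fix e assume e: "e \<in> {e. e < d \<and> u @ [e] \<in> P}"
    then have "states ws ! number ws (u @ [e]) = u @ [e]" "number ws (u @ [e]) < S"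
      by (simp_all add: states_number number_less)
    moreover from this have "number ws (u @ [e]) \<noteq> 0" by (metis snoc_eq_iff_butlast states_0)
    ultimately show "number ws (u @ [e]) \<in> ?I"
      using number_states[OF q] by (simp add: parent_link_def u_def)
  next
    fix p assume p: "p \<in> ?I"
    then have "states ws ! p \<noteq> []" using states_Nil_iff by auto
    then obtain v e where v: "states ws ! p = v @ [e]" by (metis rev_exhaust)
    have in_P: "v @ [e] \<in> P" using p v by (metis (mono_tags, lifting) mem_Collect_eq nth_mem)
    then have "v \<in> P" by (rule snoc_in)
    then have "v = u" using p v states_number[of v] by (auto simp: parent_link_def u_def)
    moreover have "e < d" using letter_less[OF in_P, of e] m by simp
    moreover have "number ws (v @ [e]) = p" using v number_states[of p] p by simp
    ultimately show "\<exists>e\<in>{e. e < d \<and> u @ [e] \<in> P}. p = number ws (u @ [e])" using in_P by blast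
  qed
  have "(\<Sum>e<d. f (transition ws q (min e m))) - (\<Sum>e<d. f (base e)) =
      (\<Sum>e<d. if u @ [e] \<in> P then f (number ws (u @ [e])) - f (base e) else 0)"
    unfolding sum_subtractf[symmetric] transition_min by (intro sum.cong) (auto simp: tr)
  also have "\<dots> = (\<Sum>e | e < d \<and> u @ [e] \<in> P. f (number ws (u @ [e])) - f (base e))"
    by (subst sum.inter_filter[symmetric]) (auto intro!: sum.cong)
  also have "\<dots> = (\<Sum>e | e < d \<and> u @ [e] \<in> P. f (number ws (u @ [e])) - f (fail_link ws (number ws (u @ [e]))))"
    by (intro sum.cong) (auto simp: fail_link_def states_number base)
  also have "\<dots> = (\<Sum>p\<in>?I. f p - f (fail_link ws p))"
    by (rule sum.reindex_bij_betw[OF bij])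
  finally show ?thesis by simp
qed

lemma state_cost_0: "state_cost ws \<phi> i 0 = 0"
  using ws(2) by (auto simp: state_cost_def states_0 intro!: sum.neutral)

text \<open>A word ending the state is the state itself or a suffix of its tail. In the second case
  it is also a state, hence a suffix of the failure state, the longest such suffix of the
  tail.\<close>

lemma state_cost_rec:
  assumes "0 < q" "q < S"
  shows "state_cost ws \<phi> i q = state_cost ws \<phi> i (fail_link ws q) +
    (if states ws ! q \<in> set ws then \<phi> (states ws ! q) i else 0)"
proof -
  define u where "u = states ws ! q"
  have u: "u \<noteq> []" using states_Nil_iff[of q] assms by (simp add: u_def)
  have "suffix w (states ws ! fail_link ws q) \<longleftrightarrow> suffix w (tl u)" if "w \<in> set ws" for w
    unfolding states_fail u_def suffix_state_def using word_in[OF that] by (rule suffix_longest_iff)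
  then have F: "{w. w \<in> set ws \<and> suffix w (states ws ! fail_link ws q)} = {w. w \<in> set ws \<and> suffix w (tl u)}"
    by blast
  have "{w. w \<in> set ws \<and> suffix w u} = {w. w \<in> set ws \<and> suffix w (tl u)} \<union> (if u \<in> set ws then {u} else {})"
    using u by (cases u) (auto simp: suffix_Cons)
  moreover have "\<not> suffix u (tl u)" using u suffix_length_le[of u "tl u"] by (cases u) auto
  ultimately show ?thesis
    unfolding state_cost_def F u_def[symmetric] by (cases "u \<in> set ws") auto
qed

lemma state_cost_suffix_state:
  "state_cost ws \<phi> i (number ws (suffix_state ws x)) = (\<Sum>w | w \<in> set ws \<and> suffix w x. \<phi> w i)"
proof -
  have "{w. w \<in> set ws \<and> suffix w (suffix_state ws x)} = {w. w \<in> set ws \<and> suffix w x}"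
    unfolding suffix_state_def using suffix_longest_iff word_in by blast
  then show ?thesis by (simp add: state_cost_def states_number suffix_state_in)
qed

lemma transition_suffix_state:
  "transition ws (number ws (suffix_state ws x)) e = number ws (suffix_state ws (x @ [e]))"
  by (simp add: transition_def states_number suffix_state_in suffix_state_snoc)

end

section \<open>The energy grouped by end positions\<close>

lemma subword_eq_suffix:
  assumes "j < length x" "\<alpha> \<noteq> []"
  shows "length \<alpha> \<le> Suc j \<and> subword x (Suc j - length \<alpha> + 1) (Suc j) = \<alpha> \<longleftrightarrow> suffix \<alpha> (take (Suc j) x)"
proof (cases "length \<alpha> \<le> Suc j")
  case True
  have "subword x (a + 1) b = drop a (take b x)" if "b \<le> length x" for a b
    using that by (intro nth_equalityI) (auto simp: subword_def simp del: upt_Suc)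
  then have "subword x (Suc j - length \<alpha> + 1) (Suc j) = drop (Suc j - length \<alpha>) (take (Suc j) x)"
    using assms by simp
  moreover have "drop (Suc j - length \<alpha>) y = \<alpha> \<longleftrightarrow> suffix \<alpha> y" if "length y = Suc j" for y
    using that True suffix_drop[of "Suc j - length \<alpha>" y] by (auto simp: suffix_def)
  ultimately show ?thesis using True assms(1) by simp
next
  case False
  then show ?thesis using assms by (auto dest: suffix_length_le)
qed

text \<open>End and length determine an interval: \<open>Suc j\<close> is the 1-based end and
  \<open>Suc j - length \<alpha> + 1\<close> the start. An occurrence there is a suffix of the first
  \<open>Suc j\<close> letters, which is what the automaton detects.\<close>

lemma energy_by_end:
  assumes "length x = n" "finite \<Gamma>" "[] \<notin> \<Gamma>"
  shows "energy \<Gamma> n \<psi> x =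
    (\<Sum>j<n. \<Sum>\<alpha> | \<alpha> \<in> \<Gamma> \<and> suffix \<alpha> (take (Suc j) x). \<psi> \<alpha> (Suc j - length \<alpha> + 1) (Suc j))"
proof -
  have "(\<Sum>(i, j) \<in> {(i, j). 1 \<le> i \<and> i \<le> j \<and> j \<le> n \<and> j - i + 1 = length \<alpha>}.
        \<psi> \<alpha> i j * of_bool (subword x i j = \<alpha>)) =
      (\<Sum>j<n. if suffix \<alpha> (take (Suc j) x) then \<psi> \<alpha> (Suc j - length \<alpha> + 1) (Suc j) else 0)"
    if \<alpha>: "\<alpha> \<in> \<Gamma>" for \<alpha>
  proof -
    have l: "\<alpha> \<noteq> []" "0 < length \<alpha>" using \<alpha> assms(3) by auto
    have "{(i, j). 1 \<le> i \<and> i \<le> j \<and> j \<le> n \<and> j - i + 1 = length \<alpha>} =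
        (\<lambda>j. (Suc j - length \<alpha> + 1, Suc j)) ` {j. j < n \<and> length \<alpha> \<le> Suc j}" (is "?L = ?R")
    proof (intro equalityI subsetI)
      fix ij assume "ij \<in> ?L"
      then obtain i j where ij: "ij = (i, j)" "1 \<le> i" "i \<le> j" "j \<le> n" "j - i + 1 = length \<alpha>" by auto
      then have "ij = (Suc (j - 1) - length \<alpha> + 1, Suc (j - 1))" "j - 1 < n" "length \<alpha> \<le> Suc (j - 1)"
        by auto
      then show "ij \<in> ?R" by blast
    next
      fix ij assume "ij \<in> ?R"
      moreover obtain k where "length \<alpha> = Suc k" using l by (cases "length \<alpha>") auto
      ultimately show "ij \<in> ?L" by auto
    qed
    then have "(\<Sum>(i, j) \<in> {(i, j). 1 \<le> i \<and> i \<le> j \<and> j \<le> n \<and> j - i + 1 = length \<alpha>}.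
        \<psi> \<alpha> i j * of_bool (subword x i j = \<alpha>)) =
        (\<Sum>j | j < n \<and> length \<alpha> \<le> Suc j. \<psi> \<alpha> (Suc j - length \<alpha> + 1) (Suc j) *
          of_bool (subword x (Suc j - length \<alpha> + 1) (Suc j) = \<alpha>))"
      by (simp only:) (subst sum.reindex, auto intro: inj_onI)
    also have "\<dots> = (\<Sum>j | j < n \<and> length \<alpha> \<le> Suc j.
        if suffix \<alpha> (take (Suc j) x) then \<psi> \<alpha> (Suc j - length \<alpha> + 1) (Suc j) else 0)"
      using subword_eq_suffix[of _ x \<alpha>] l assms(1) by (intro sum.cong) auto
    also have "\<dots> = (\<Sum>j<n. if suffix \<alpha> (take (Suc j) x) then \<psi> \<alpha> (Suc j - length \<alpha> + 1) (Suc j) else 0)"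
      by (intro sum.mono_neutral_left) (auto dest: suffix_length_le)
    finally show ?thesis .
  qed
  then have "energy \<Gamma> n \<psi> x = (\<Sum>\<alpha>\<in>\<Gamma>. \<Sum>j<n.
      if suffix \<alpha> (take (Suc j) x) then \<psi> \<alpha> (Suc j - length \<alpha> + 1) (Suc j) else 0)"
    unfolding energy_def by (intro sum.cong) auto
  also have "\<dots> = (\<Sum>j<n. \<Sum>\<alpha>\<in>\<Gamma>. if suffix \<alpha> (take (Suc j) x) then \<psi> \<alpha> (Suc j - length \<alpha> + 1) (Suc j) else 0)"
    by (rule sum.swap)
  also have "\<dots> = (\<Sum>j<n. \<Sum>\<alpha> | \<alpha> \<in> \<Gamma> \<and> suffix \<alpha> (take (Suc j) x). \<psi> \<alpha> (Suc j - length \<alpha> + 1) (Suc j))"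
    by (simp only: sum.inter_filter[OF assms(2)])
  finally show ?thesis .
qed

section \<open>Relabelling of the letters and the input table\<close>

definition used_letters :: "nat list list \<Rightarrow> nat list" where
  "used_letters code = sorted_list_of_set (\<Union>(set ` set code))"

text \<open>Used letters come first and so get the numbers below \<open>m\<close>. The list stops at
  the largest used letter, since the table may not depend on |D|.\<close>

definition letter_order :: "nat list list \<Rightarrow> nat list" where
  "letter_order code = used_letters code @
     filter (\<lambda>c. c \<notin> set (used_letters code)) [0..<Suc (Max (\<Union>(set ` set code)))]"

definition letter_of :: "nat list list \<Rightarrow> nat \<Rightarrow> nat" where
  "letter_of code c = (if c < length (letter_order code) then letter_order code ! c else c)"

definition relabel :: "nat list list \<Rightarrow> nat list list" where
  "relabel code = map (map (inv (letter_of code))) code"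

text \<open>Columns 6 and 7 hold the positive and the negative part of the shift from
  \<open>k\<close> to \<open>letter_of code k\<close>. Memory beyond the table is 0 and so encodes
  the identity, which is right for all larger letters.\<close>

definition table_entry :: "nat list list \<Rightarrow> nat \<Rightarrow> nat \<Rightarrow> nat" where
  "table_entry code r k =
     (let ws = relabel code; m = length (used_letters code)
      in if r = 0 then (if k = 0 then length (states ws) else m)
         else if r = 1 then fail_link ws k
         else if r = 2 then parent_link ws k
         else if r = 3 then word_number ws k
         else if r = 4 then length (states ws ! k)
         else if r = 5 then transition ws (k div Suc m) (k mod Suc m)
         else if r = 6 then letter_of code k - k
         else k - letter_of code k)"

definition table_height :: "nat list list \<Rightarrow> nat" where
  "table_height code = 2 + length (states (relabel code)) * Suc (length (used_letters code)) +
     length (letter_order code)"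

definition table :: "nat list list \<Rightarrow> nat list" where
  "table code = map (\<lambda>k. table_entry code (k mod 8) (k div 8)) [0..<table_height code * 8]"

text \<open>The used letters followed by the remaining ones list the numbers up to the maximum once
  each; a permutation of this initial segment extends by the identity.\<close>

lemma letter_of_permutes:
  assumes "finite (\<Union>(set ` set code))" "\<Union>(set ` set code) \<subseteq> {..<d}" "\<Union>(set ` set code) \<noteq> {}"
  shows "letter_of code permutes {..<d}" and "length (letter_order code) \<le> d"
proof -
  let ?U = "\<Union>(set ` set code)"
  have used: "set (used_letters code) = ?U" "distinct (used_letters code)"
    using assms(1) by (simp_all add: used_letters_def)
  have set: "set (letter_order code) = {..<Suc (Max ?U)}"
  proof -
    have "?U \<subseteq> {..<Suc (Max ?U)}" using Max_ge[OF assms(1)] by (meson le_imp_less_Suc lessThan_iff subsetI)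
    then show ?thesis unfolding letter_order_def set_append set_filter used(1) by (auto simp del: upt_Suc)
  qed
  have dist: "distinct (letter_order code)"
    using used by (auto simp: letter_order_def)
  have len: "length (letter_order code) = Suc (Max ?U)"
    using distinct_card[OF dist] set by simp
  have "Max ?U \<in> ?U" using Max_in[OF assms(1,3)] .
  then have d: "Suc (Max ?U) \<le> d" using assms(2) by auto
  show "length (letter_order code) \<le> d" using len d by simp
  have nth: "bij_betw ((!) (letter_order code)) {..<Suc (Max ?U)} {..<Suc (Max ?U)}"
    by (rule bij_betw_nth[OF dist]) (simp_all only: len set)
  have "(!) (letter_order code) c = letter_of code c" if "c \<in> {..<Suc (Max ?U)}" for c
    using that by (simp only: letter_of_def len lessThan_iff if_True)
  from bij_betw_cong[THEN iffD1, OF this nth]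
  have "bij_betw (letter_of code) {..<Suc (Max ?U)} {..<Suc (Max ?U)}" .
  then have "letter_of code permutes {..<Suc (Max ?U)}"
    by (rule bij_imp_permutes) (simp only: letter_of_def len lessThan_iff if_False)
  then show "letter_of code permutes {..<d}"
    by (rule permutes_subset) (use d in auto)
qed

section \<open>From a problem instance to the machine\<close>

locale crf =
  fixes D :: "'a set" and \<Gamma> :: "'a list set" and n :: nat and \<psi> :: "'a list \<Rightarrow> nat \<Rightarrow> nat \<Rightarrow> real"
    and enc :: "'a \<Rightarrow> nat" and gs :: "'a list list"
  assumes inst: "crf_instance D \<Gamma> n enc gs"
begin

definition "d = card D"
definition "code = map (map enc) gs"
definition "ws = relabel code"
definition "m = length (used_letters code)"
definition "init = init_state D gs n \<psi> (table code)"
definition "dec c = inv_into D enc (letter_of code c)"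
text \<open>Read at the address that the program uses, so the recursion for the costs holds
  literally, even for \<open>i < length w\<close>, where truncated subtraction reads an unrelated
  entry. \<open>psi_lookup\<close> gives the meaning for words that fit.\<close>

definition "\<phi> w i = rmem init 0 (position ws w * n + (i - length w))" for w :: "nat list" and i :: nat

lemma basic: "finite D" "finite \<Gamma>" "\<Gamma> \<noteq> {}" "[] \<notin> \<Gamma>" "\<Gamma> \<subseteq> lists D" "0 < n"
    "bij_betw enc D {..<d}" "distinct gs" "set gs = \<Gamma>"
  using inst by (auto simp: crf_instance_def d_def)

lemma code_letters: "\<Union>(set ` set code) = enc ` \<Union>(set ` \<Gamma>)"
  using basic(9) by (auto simp: code_def)

lemma code_letters_props: "finite (\<Union>(set ` set code))" "\<Union>(set ` set code) \<subseteq> {..<d}"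
    "\<Union>(set ` set code) \<noteq> {}"
proof -
  show "\<Union>(set ` set code) \<subseteq> {..<d}"
    unfolding code_letters using basic(5,7) by (auto simp: bij_betw_def)
  obtain \<alpha> where "\<alpha> \<in> \<Gamma>" "\<alpha> \<noteq> []" using basic(3,4) by blast
  then show "\<Union>(set ` set code) \<noteq> {}"
    unfolding code_letters by (cases \<alpha>) force+
qed auto

lemmas perm = letter_of_permutes[OF code_letters_props]

lemma used: "set (used_letters code) = \<Union>(set ` set code)" "m = card (\<Union>(set ` set code))"
  using code_letters_props(1) by (simp_all add: used_letters_def m_def)

lemma m_le_d: "m \<le> d"
  using card_mono[OF _ code_letters_props(2)] used(2) by simp

lemma m_le_length: "m \<le> total_length \<Gamma>"
proof -
  have "m = card (enc ` (\<Union>\<alpha>\<in>\<Gamma>. set \<alpha>))" unfolding used(2) code_letters ..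
  also have "\<dots> \<le> card (\<Union>\<alpha>\<in>\<Gamma>. set \<alpha>)" using basic(2) by (intro card_image_le) auto
  also have "\<dots> \<le> (\<Sum>\<alpha>\<in>\<Gamma>. card (set \<alpha>))" by (rule card_UN_le[OF basic(2)])
  also have "\<dots> \<le> total_length \<Gamma>" unfolding total_length_def by (intro sum_mono card_length)
  finally show ?thesis .
qed

lemma total_length_pos: "0 < total_length \<Gamma>"
  unfolding total_length_def using basic(2,3,4) by (intro sum_pos) auto

lemma d_pos: "0 < d"
  using code_letters_props(2,3) by (cases d) auto

definition "coding a = inv (letter_of code) (enc a)" for a :: 'a

lemma ws_eq: "ws = map (map coding) gs"
  by (simp add: ws_def relabel_def code_def coding_def comp_def)

lemma dec_coding: "a \<in> D \<Longrightarrow> dec (coding a) = a"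
  unfolding dec_def coding_def permutes_inverses(1)[OF perm(1)]
  using basic(7) by (intro inv_into_f_f) (auto simp: bij_betw_def)

lemma dec_bij: "bij_betw dec {..<d} D"
proof -
  have "bij_betw (inv_into D enc \<circ> letter_of code) {..<d} D"
    by (rule bij_betw_trans[OF permutes_imp_bij[OF perm(1)] bij_betw_inv_into[OF basic(7)]])
  then show ?thesis by (simp add: dec_def[abs_def] comp_def)
qed

lemma coding_dec: "c < d \<Longrightarrow> coding (dec c) = c"
proof -
  assume c: "c < d"
  then have "letter_of code c < d" using permutes_in_image[OF perm(1), of c] by simp
  then have "enc (dec c) = letter_of code c"
    using basic(7) unfolding dec_def by (intro f_inv_into_f) (auto simp: bij_betw_def)
  then show ?thesis using permutes_inverses(2)[OF perm(1)] by (simp add: coding_def)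
qed

lemma map_dec_coding: "\<alpha> \<in> \<Gamma> \<Longrightarrow> map dec (map coding \<alpha>) = \<alpha>"
  using basic(5) dec_coding by (auto intro!: map_idI)

lemma coding_less: "\<alpha> \<in> \<Gamma> \<Longrightarrow> a \<in> set \<alpha> \<Longrightarrow> coding a < m"
proof -
  assume "\<alpha> \<in> \<Gamma>" "a \<in> set \<alpha>"
  then have "enc a \<in> set (used_letters code)" unfolding used(1) code_letters by blast
  then obtain c where c: "c < m" "used_letters code ! c = enc a"
    by (metis in_set_conv_nth m_def)
  then have "letter_of code c = enc a" by (simp add: letter_of_def letter_order_def nth_append m_def)
  then have "coding a = c" using permutes_inverses(2)[OF perm(1)] by (metis coding_def)
  then show ?thesis using c by simp
qed

sublocale word_list ws m d
proof
  show "ws \<noteq> []" using basic(3,9) by (auto simp: ws_eq)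
  show "[] \<notin> set ws" using basic(4,9) by (auto simp: ws_eq)
  have "inj_on (map coding) \<Gamma>" by (rule inj_on_inverseI[of _ "map dec"]) (rule map_dec_coding)
  then show "distinct ws" using basic(8,9) by (simp add: ws_eq distinct_map)
  show "set w \<subseteq> {..<m}" if "w \<in> set ws" for w
    using that coding_less basic(9) by (auto simp: ws_eq)
qed (rule m_le_d)

lemma states_bound: "length (states ws) \<le> 1 + total_length \<Gamma>"
proof -
  have "sum_list (map length ws) = sum_list (map length gs)" by (simp add: ws_eq comp_def)
  also have "\<dots> = total_length \<Gamma>"
    using basic(8,9) by (simp add: sum_list_distinct_conv_sum_set total_length_def)
  finally show ?thesis using card_states by simp
qed

lemma look_table:
  assumes "k < table_height code" "r < 8"
  shows "look (nmem init 2) r k = table_entry code r k"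
proof -
  have "k * 8 + r < table_height code * 8" using assms by simp
  then show ?thesis
    using assms(2) by (simp add: look_def init_def init_state_def table_def)
qed

lemma height: "q < length (states ws) \<Longrightarrow> e \<le> m \<Longrightarrow> q * Suc m + e < table_height code"
  and height_states: "q < length (states ws) \<Longrightarrow> q < table_height code"
proof -
  assume "q < length (states ws)" "e \<le> m"
  then have "q * Suc m + e < Suc q * Suc m" by simp
  also have "\<dots> \<le> length (states ws) * Suc m" using \<open>q < length (states ws)\<close> by (intro mult_le_mono1) simp
  finally show "q * Suc m + e < table_height code" by (simp add: table_height_def ws_def m_def)
next
  assume "q < length (states ws)"
  then show "q < table_height code" by (simp add: table_height_def ws_def)
qed

lemma look_letter:
  "look (nmem init 2) 6 c = letter_of code c - c" "look (nmem init 2) 7 c = c - letter_of code c"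
proof -
  have "look (nmem init 2) r c = 0 \<and> letter_of code c = c" if "\<not> c < table_height code" for r
    using that by (simp add: look_def init_def init_state_def table_def table_height_def letter_of_def)
  then show "look (nmem init 2) 6 c = letter_of code c - c" "look (nmem init 2) 7 c = c - letter_of code c"
    using look_table[of c 6] look_table[of c 7]
    by (cases "c < table_height code"; simp add: table_entry_def Let_def)+
qed

lemma psi_lookup:
  assumes w: "w \<in> set ws" "length w \<le> Suc j" "j < n"
  shows "\<phi> w (Suc j) = \<psi> (map dec w) (Suc j - length w + 1) (Suc j)"
proof -
  define g where "g = position ws w"
  have g: "g < length ws" "ws ! g = w" using position[OF w(1)] by (simp_all add: g_def)
  then have g': "g < length gs" "gs ! g = map dec w"
    using map_dec_coding[of "gs ! g"] basic(9) by (auto simp: ws_eq)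
  have "w \<noteq> []" using w(1) ws(2) by metis
  then obtain k where "length w = Suc k" by (cases w) auto
  then have l: "Suc j - length w < n" using w by simp
  have "g * n + (Suc j - length w) < Suc g * n" using l by simp
  also have "\<dots> \<le> length gs * n" using g' by (intro mult_le_mono1) simp
  finally have "g * n + (Suc j - length w) < length gs * n" .
  moreover have "(g * n + (Suc j - length w)) div n = g" "(g * n + (Suc j - length w)) mod n = Suc j - length w"
    using l by simp_all
  ultimately show ?thesis
    using g' w(2,3) by (simp add: \<phi>_def g_def[symmetric] init_def init_state_def Let_def)
qed

lemma sampler_machine: "sampler_machine n d (length (states ws)) m (index_bound D \<Gamma> n) (nmem init 1) (nmem init 2)
    (rmem init 0) (fail_link ws) (parent_link ws) (letter_of code) (transition ws) (state_cost ws \<phi>)"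
proof
  have B: "d \<le> index_bound D \<Gamma> n" "Suc m \<le> index_bound D \<Gamma> n"
  proof -
    have "1 * (total_length \<Gamma> + 1) * (d + 1) \<le> index_bound D \<Gamma> n"
      unfolding index_bound_def d_def by (intro mult_le_mono1) simp
    moreover have "d + 1 \<le> (total_length \<Gamma> + 1) * (d + 1)" "total_length \<Gamma> + 1 \<le> (total_length \<Gamma> + 1) * (d + 1)"
      by simp_all
    ultimately show "d \<le> index_bound D \<Gamma> n" "Suc m \<le> index_bound D \<Gamma> n"
      using m_le_length by linarith+
  qed
  show "m + 1 \<le> index_bound D \<Gamma> n" "d \<le> index_bound D \<Gamma> n" using B by auto
  show "nmem init 1 0 = n" "nmem init 1 (Suc 0) = d"
    by (simp_all add: init_def init_state_def d_def)
  show "look (nmem init 2) 0 0 = length (states ws)" "look (nmem init 2) 0 (Suc 0) = m"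
    by (subst look_table; simp add: table_height_def table_entry_def Let_def ws_def m_def)+
  fix q assume q: "q < length (states ws)"
  show "look (nmem init 2) (Suc 0) q = fail_link ws q" "look (nmem init 2) 2 q = parent_link ws q"
    using look_table[OF height_states[OF q]] by (simp_all add: table_entry_def Let_def ws_def)
  show "look (nmem init 2) 5 (q * Suc m + e) = transition ws q e" if "e \<le> m" for e
  proof -
    have "(q * Suc m + e) div Suc m = q" "(q * Suc m + e) mod Suc m = e"
      using that by (simp_all del: mult_Suc_right)
    then show ?thesis
      using look_table[OF height[OF q that], of 5]
      by (simp add: table_entry_def Let_def ws_def m_def del: mult_Suc_right)
  qed
  show "state_cost ws \<phi> i q = state_cost ws \<phi> i (fail_link ws q) +
      real (Suc 0 - (Suc 0 - look (nmem init 2) 3 q)) *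
      rmem init 0 ((look (nmem init 2) 3 q - Suc 0) * n + (i - look (nmem init 2) 4 q))"
    if "0 < q" for i
    using state_cost_rec[OF that q, of \<phi> i] look_table[OF height_states[OF q], of 3]
      look_table[OF height_states[OF q], of 4]
    by (simp add: table_entry_def Let_def ws_def[symmetric] word_number_def \<phi>_def)
  show "(\<Sum>e<d. f (transition ws q (min e m))) = (\<Sum>e<d. f (transition ws (fail_link ws q) (min e m))) +
      (\<Sum>p | 0 < p \<and> p < length (states ws) \<and> parent_link ws p = q. f p - f (fail_link ws p))"
    if "0 < q" for f :: "nat \<Rightarrow> real"
    using transition_sum[OF q, of f] that by (simp add: transition_min)
next
  show "c + look (nmem init 2) 6 c - look (nmem init 2) 7 c = letter_of code c" for c
    by (simp add: look_letter)
  show "(\<Sum>e<d. f (transition ws 0 (min e m))) = real d * f 0 +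
      (\<Sum>p | 0 < p \<and> p < length (states ws) \<and> parent_link ws p = 0. f p - f (fail_link ws p))"
    for f :: "nat \<Rightarrow> real"
    using transition_sum[OF S_pos, of f] by simp
qed (use d_pos m_le_d S_pos basic(6) in
    \<open>auto simp: fail_link_less parent_link_less transition_less state_cost_0\<close>)

sublocale sampler_machine n d "length (states ws)" m "index_bound D \<Gamma> n" "nmem init 1" "nmem init 2"
    "rmem init 0" "fail_link ws" "parent_link ws" "letter_of code" "transition ws" "state_cost ws \<phi>"
  by (rule sampler_machine)

lemma state_after_eq: "state_after z i = number ws (suffix_state ws (map z [0..<i]))"
proof (induction i)
  case 0
  then show ?case by (simp add: suffix_state_def number_Nil)
next
  case (Suc i)
  then show ?case by (simp add: transition_min transition_suffix_state)
qed

sublocale gibbs_machine n d "length (states ws)" m "index_bound D \<Gamma> n" "nmem init 1" "nmem init 2"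
    "rmem init 0" "fail_link ws" "parent_link ws" "letter_of code" "transition ws" "state_cost ws \<phi>"
    D \<Gamma> \<psi> enc dec
proof
  show "bij_betw dec {..<d} D" by (rule dec_bij)
  show "dec c = inv_into D enc (letter_of code c)" for c by (simp add: dec_def)
  fix z :: "nat \<Rightarrow> nat" assume z: "\<And>i. i < n \<Longrightarrow> z i < d"
  define x where "x = map (\<lambda>i. dec (z i)) [0..<n]"
  have "(\<Sum>\<alpha> | \<alpha> \<in> \<Gamma> \<and> suffix \<alpha> (take (Suc j) x). \<psi> \<alpha> (Suc j - length \<alpha> + 1) (Suc j)) =
      state_cost ws \<phi> (Suc j) (state_after z (Suc j))" if j: "j < n" for j
  proof -
    let ?y = "map z [0..<Suc j]"
    have prefix: "take (Suc j) x = map dec ?y"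
      using j by (simp add: x_def take_map comp_def take_upt del: upt_Suc)
    have decoded: "map coding (map dec ?y) = ?y"
      using j coding_dec z by (auto intro!: map_idI simp del: upt_Suc)
    have coded: "map coding (map dec w) = w" if "w \<in> set ws" for w
      using letters[OF that] m_le_d coding_dec by (auto intro!: map_idI)
    \<comment> \<open>\<open>map dec\<close> and \<open>map coding\<close> are mutually inverse here
      and preserve suffixes, which matches the terms one to one.\<close>
    have "(\<Sum>w | w \<in> set ws \<and> suffix w ?y. \<phi> w (Suc j)) =
        (\<Sum>\<alpha> | \<alpha> \<in> \<Gamma> \<and> suffix \<alpha> (take (Suc j) x). \<psi> \<alpha> (Suc j - length \<alpha> + 1) (Suc j))"
    proof (rule sum.reindex_bij_witness[of _ "map coding" "map dec"])
      fix w assume w: "w \<in> {w. w \<in> set ws \<and> suffix w ?y}"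
      then have l: "length w \<le> Suc j" using suffix_length_le[of w ?y] by simp
      show "map coding (map dec w) = w" using coded w by simp
      obtain \<alpha> where "\<alpha> \<in> \<Gamma>" "w = map coding \<alpha>" using w basic(9) by (auto simp: ws_eq simp del: upt_Suc)
      then have "map dec w \<in> \<Gamma>" using map_dec_coding by metis
      moreover have "suffix (map dec w) (take (Suc j) x)"
        unfolding prefix using w by (intro map_mono_suffix) simp
      ultimately show "map dec w \<in> {\<alpha>. \<alpha> \<in> \<Gamma> \<and> suffix \<alpha> (take (Suc j) x)}" by simp
      show "\<psi> (map dec w) (Suc j - length (map dec w) + 1) (Suc j) = \<phi> w (Suc j)"
        using psi_lookup[of w j] w l j by simp
    next
      fix \<alpha> assume \<alpha>: "\<alpha> \<in> {\<alpha>. \<alpha> \<in> \<Gamma> \<and> suffix \<alpha> (take (Suc j) x)}"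
      show "map dec (map coding \<alpha>) = \<alpha>" using \<alpha> map_dec_coding by simp
      have "suffix (map coding \<alpha>) (map coding (map dec ?y))"
        using \<alpha> unfolding prefix by (intro map_mono_suffix) simp
      then show "map coding \<alpha> \<in> {w. w \<in> set ws \<and> suffix w ?y}"
        using \<alpha> basic(9) unfolding decoded by (simp add: ws_eq)
    qed
    then show ?thesis by (simp add: state_after_eq state_cost_suffix_state del: upt_Suc)
  qed
  then show "energy \<Gamma> n \<psi> (map (\<lambda>i. dec (z i)) [0..<n]) =
      (\<Sum>i<n. state_cost ws \<phi> (Suc i) (state_after z (Suc i)))"
    unfolding x_def[symmetric] by (subst energy_by_end) (use basic(2,4) in \<open>auto simp: x_def\<close>)
qed

lemma static_init: "static init" "drawn init = 0"
  unfolding static_def by (auto simp: init_def init_state_def)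

text \<open>Additive ones are absorbed because \<open>total_length \<Gamma>\<close> and
  \<open>card D\<close> are positive. The number of outcomes is charged to the total length in the
  direct method and to |D| in the preprocessing.\<close>

lemma size_bounds:
  "length (states ws) \<le> 2 * total_length \<Gamma>" "Suc m \<le> 2 * total_length \<Gamma>" "Suc m \<le> 2 * card D"
  using states_bound m_le_length m_le_d total_length_pos d_pos unfolding d_def by linarith+

lemma sample_direct_iid:
  "iid_sampler (index_bound D \<Gamma> n) sample_direct (\<lambda>\<omega>. init) (30000 * (n * total_length \<Gamma>))
     D enc n (gibbs D \<Gamma> n \<psi>)"
proof (rule iid_samplerI[where P = static])
  fix \<omega> s assume "\<omega> \<in> space uniform_oracle" "static s"
  then have *: "\<And>j. \<omega> j \<in> {0..1}" "static s" by (auto simp: space_oracle)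
  have "4000 * (n * length (states ws)) + n * (1000 * Suc m + 2000) =
      n * (4000 * length (states ws) + 1000 * Suc m + 2000)" by (simp add: algebra_simps)
  also have "\<dots> \<le> n * (30000 * total_length \<Gamma>)"
  proof (rule mult_le_mono2)
    have "4000 * length (states ws) \<le> 4000 * (2 * total_length \<Gamma>)" "1000 * Suc m \<le> 1000 * (2 * total_length \<Gamma>)"
      using size_bounds(1,2) by (auto intro: mult_le_mono2)
    then show "4000 * length (states ws) + 1000 * Suc m + 2000 \<le> 30000 * total_length \<Gamma>"
      using total_length_pos by simp
  qed
  finally show "terminates (index_bound D \<Gamma> n) \<omega> sample_direct s (30000 * (n * total_length \<Gamma>))
    (\<lambda>s'. static s' \<and> drawn s' = drawn s + 3 * n \<and>
      (\<forall>i<n. nmem s' 0 i = letter_of code (letter_at (\<lambda>j. \<omega> (drawn s + j)) i)))"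
    by (intro terminates_weaken[OF sample_direct_correct[OF *(2,1)]]) (auto simp: ac_simps)
qed (use static_init in blast)

lemma sample_prepared_iid:
  "\<exists>s :: (nat \<Rightarrow> real) \<Rightarrow> state.
    (\<forall>\<omega>\<in>space uniform_oracle. \<exists>u \<le> 30000 * (n * total_length \<Gamma> * card D).
       exec (index_bound D \<Gamma> n) \<omega> preprocess init u (s \<omega>)) \<and>
    iid_sampler (index_bound D \<Gamma> n) sample_prepared s (30000 * n) D enc n (gibbs D \<Gamma> n \<psi>)"
proof -
  let ?S = "length (states ws)" and ?L = "total_length \<Gamma>"
  have d1: "1 \<le> card D" using d_pos by (simp add: d_def)
  have "4000 * (n * ?S) + 5000 * (n * ?S * Suc m) = n * (?S * (4000 + 5000 * Suc m))"
    by (simp add: algebra_simps)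
  \<comment> \<open>The factor 2 from the number of states times 15000 is the origin of the constant
    30000.\<close>
  also have "\<dots> \<le> n * ((2 * ?L) * (15000 * card D))"
  proof (intro mult_le_mono2 mult_le_mono size_bounds)
    have "5000 * Suc m \<le> 5000 * (2 * card D)" by (intro mult_le_mono2 size_bounds)
    then show "4000 + 5000 * Suc m \<le> 15000 * card D" using d1 by linarith
  qed
  finally have time: "4000 * (n * ?S) + 5000 * (n * ?S * Suc m) \<le> 30000 * (n * ?L * card D)"
    by (simp add: ac_simps)
  have "\<exists>s u. u \<le> 30000 * (n * ?L * card D) \<and> exec (index_bound D \<Gamma> n) \<omega> preprocess init u s \<and>
      static s \<and> prepared s \<and> drawn s = 0" for \<omega>
  proof -
    obtain u s where "u \<le> 4000 * (n * ?S) + 5000 * (n * ?S * Suc m)"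
      "exec (index_bound D \<Gamma> n) \<omega> preprocess init u s" "static s" "prepared s" "drawn s = 0"
      using preprocess_correct[OF static_init(1), of \<omega>] static_init(2) unfolding terminates_def by auto
    with time show ?thesis by (intro exI[of _ s] exI[of _ u]) simp
  qed
  then obtain s where s: "\<And>\<omega>. \<exists>u \<le> 30000 * (n * ?L * card D). exec (index_bound D \<Gamma> n) \<omega> preprocess init u (s \<omega>)"
    "\<And>\<omega>. static (s \<omega>) \<and> prepared (s \<omega>) \<and> drawn (s \<omega>) = 0"
    by metis
  have "iid_sampler (index_bound D \<Gamma> n) sample_prepared s (30000 * n) D enc n (gibbs D \<Gamma> n \<psi>)"
  proof (rule iid_samplerI[where P = "\<lambda>s. static s \<and> prepared s"])
    fix \<omega> s assume "\<omega> \<in> space uniform_oracle" "static s \<and> prepared s"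
    then have *: "\<And>j. \<omega> j \<in> {0..1}" "static s" "prepared s" by (auto simp: space_oracle)
    show "terminates (index_bound D \<Gamma> n) \<omega> sample_prepared s (30000 * n)
      (\<lambda>s'. (static s' \<and> prepared s') \<and> drawn s' = drawn s + 3 * n \<and>
        (\<forall>i<n. nmem s' 0 i = letter_of code (letter_at (\<lambda>j. \<omega> (drawn s + j)) i)))"
      by (rule terminates_weaken[OF sample_prepared_correct[OF *(2,3,1)]]) auto
  qed (use s in auto)
  then show ?thesis using s by blast
qed

end

theorem mainTheorem2:
  shows "\<exists>(T\<^sub>1 :: nat list list \<Rightarrow> nat list) (sample\<^sub>1 :: com)
          (T\<^sub>2 :: nat list list \<Rightarrow> nat list) (prep :: com) (sample\<^sub>2 :: com) (C :: nat).
    \<forall>(D :: 'a set) (\<Gamma> :: 'a list set) (n :: nat) (\<psi> :: 'a list \<Rightarrow> nat \<Rightarrow> nat \<Rightarrow> real)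
      (enc :: 'a \<Rightarrow> nat) (gs :: 'a list list).
      crf_instance D \<Gamma> n enc gs \<longrightarrow>
        (let L = total_length \<Gamma>; B = index_bound D \<Gamma> n; code = map (map enc) gs in
          iid_sampler B sample\<^sub>1 (\<lambda>\<omega>. init_state D gs n \<psi> (T\<^sub>1 code)) (C * (n * L))
            D enc n (gibbs D \<Gamma> n \<psi>) \<and>
          (\<exists>s :: (nat \<Rightarrow> real) \<Rightarrow> state.
            (\<forall>\<omega>\<in>space uniform_oracle. \<exists>u \<le> C * (n * L * card D).
               exec B \<omega> prep (init_state D gs n \<psi> (T\<^sub>2 code)) u (s \<omega>)) \<and>
            iid_sampler B sample\<^sub>2 s (C * n) D enc n (gibbs D \<Gamma> n \<psi>)))"
proof (rule exI[of _ table], rule exI[of _ sample_direct], rule exI[of _ table], rule exI[of _ preprocess],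
    rule exI[of _ sample_prepared], rule exI[of _ 30000], intro allI impI)
  fix D :: "'a set" and \<Gamma> :: "'a list set" and n \<psi> enc gs
  assume "crf_instance D \<Gamma> n enc gs"
  then interpret crf D \<Gamma> n \<psi> enc gs by unfold_locales
  show "let L = total_length \<Gamma>; B = index_bound D \<Gamma> n; code = map (map enc) gs in
          iid_sampler B sample_direct (\<lambda>\<omega>. init_state D gs n \<psi> (table code)) (30000 * (n * L))
            D enc n (gibbs D \<Gamma> n \<psi>) \<and>
          (\<exists>s :: (nat \<Rightarrow> real) \<Rightarrow> state.
            (\<forall>\<omega>\<in>space uniform_oracle. \<exists>u \<le> 30000 * (n * L * card D).
               exec B \<omega> preprocess (init_state D gs n \<psi> (table code)) u (s \<omega>)) \<and>
            iid_sampler B sample_prepared s (30000 * n) D enc n (gibbs D \<Gamma> n \<psi>))"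
    unfolding Let_def using sample_direct_iid sample_prepared_iid
    unfolding init_def code_def by blast
qed

end
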